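(* Let $n\ge 4$, let $\sigma$ be an $(n-2)$-dimensional simplex, let $\alpha=[v_0,v_1,\dots,v_5=v_0]$ be a closed cycle of five distinct vertices (a circle subdivided into five edges), and let $K=\sigma*\alpha$ be the simplicial join of $\sigma$ and $\alpha$, equipped with the regular piecewise Euclidean metric. Then $K$ is an $n$-dimensional $\mathrm{CAT}(0)$ simplicial complex. There are exactly $n-1$ disks of minimal combinatorial area spanning $\alpha$ in $K$, one through each vertex $w$ of $\sigma$, consisting of the five triangles containing $w$ and an edge of $\alpha$. Each of these disks is a full subcomplex of $K$ that is not nonpositively curved. In particular, for every $n\ge 4$ there is a regular $\mathrm{CAT}(0)$ simplicial $n$-complex having a full subcomplex that is not nonpositively curved.
   Context: A simplicial complex is a piecewise Euclidean complex (Euclidean polytopes glued along faces by isometries) in which each cell is isometric to a Euclidean simplex; it is regular if every edge has unit length. Its dimension is the maximum of the dimensions of its cells. A subcomplex $L$ of $K$ is full in $K$ if for every simplex $\sigma$ of $K$, $\sigma^{(0)}\subseteq L$ implies $\sigma\subseteq L$. A disk spanning $\alpha$ in $K$ is here a subcomplex of $K$ that is a triangulated disk with boundary $\alpha$; its combinatorial area is its number of triangles. Metric link: if $\sigma$ is a $k$-face of an $m$-simplex $\tau$, the metric link of $\sigma$ in $\tau$ is the set of unit tangent vectors orthogonal to $\sigma$ and pointing into $\tau$, a spherical $(m-k-1)$-simplex. For a simplex $\sigma$ of a simplicial complex $K$, the metric link $lk_K(\sigma)$ is the spherical simplicial complex whose cells are the links of $\sigma$ in each simplex $\tau\supseteq\sigma$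 of $K$. A locally geodesic loop in a geodesic metric space $X$ is an embedding of a metric circle into $X$ such that at each point $x$ of its image the angle between its incoming and outgoing tangent vectors in $lk_X(x)$ is at least $\pi$. A piecewise Euclidean complex with finitely many isometry types of cells is nonpositively curved if the link of each cell contains no locally geodesic loop of length less than $2\pi$. It is $\mathrm{CAT}(0)$ if in addition it is connected and simply connected. *)

theory Defs
  imports "HOL-Analysis.Analysis"
begin

section \<open>Simplicial complexes\<close>

text \<open>A simplicial complex is given by the vertex sets of its simplices; the empty simplex is
  excluded.\<close>

definition abstract_complex :: "'v set set \<Rightarrow> bool" where
  "abstract_complex K \<longleftrightarrow>
     (\<forall>\<tau>\<in>K. finite \<tau> \<and> \<tau> \<noteq> {}) \<and> (\<forall>\<tau>\<in>K. \<forall>\<rho>. \<rho> \<subseteq> \<tau> \<and> \<rho> \<noteq> {} \<longrightarrow> \<rho> \<in> K)"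

definition generated_complex :: "'v set set \<Rightarrow> 'v set set" where
  "generated_complex T = {\<rho>. \<rho> \<noteq> {} \<and> (\<exists>\<tau>\<in>T. \<rho> \<subseteq> \<tau>)}"

definition cycle_complex :: "nat \<Rightarrow> (nat \<Rightarrow> 'v) \<Rightarrow> 'v set set" where
  "cycle_complex k v = generated_complex {{v i, v (Suc i)} |i. i < k}"

text \<open>The vertex sets of the two factors are meant to be disjoint.\<close>

definition simplicial_join :: "'v set set \<Rightarrow> 'v set set \<Rightarrow> 'v set set" where
  "simplicial_join A B = {\<sigma> \<union> \<tau> |\<sigma> \<tau>. \<sigma> \<in> insert {} A \<and> \<tau> \<in> insert {} B} - {{}}"

definition has_dimension :: "'v set set \<Rightarrow> nat \<Rightarrow> bool" where
  "has_dimension K n \<longleftrightarrow> (\<exists>\<tau>\<in>K. card \<tau> = n + 1) \<and> (\<forall>\<tau>\<in>K. card \<tau> \<le> n + 1)"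

definition subcomplex :: "'v set set \<Rightarrow> 'v set set \<Rightarrow> bool" where
  "subcomplex L K \<longleftrightarrow> abstract_complex L \<and> L \<subseteq> K"

definition full_subcomplex :: "'v set set \<Rightarrow> 'v set set \<Rightarrow> bool" where
  "full_subcomplex L K \<longleftrightarrow> subcomplex L K \<and> (\<forall>\<tau>\<in>K. (\<forall>x\<in>\<tau>. {x} \<in> L) \<longrightarrow> \<tau> \<in> L)"

definition triangles :: "'v set set \<Rightarrow> 'v set set" where
  "triangles K = {\<tau>\<in>K. card \<tau> = 3}"

section \<open>Realization and the regular piecewise Euclidean metric\<close>

text \<open>Points are written in barycentric coordinates.  On a finite-dimensional complex the
  pointwise topology inherited from \<^typ>\<open>'v \<Rightarrow> real\<close> agrees with the topology of the regular
  piecewise Euclidean metric: points close to \<open>x\<close> in either sense lie in a common simplex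
  with \<open>x\<close>.\<close>

definition closed_cell :: "'v set \<Rightarrow> ('v \<Rightarrow> real) set" where
  "closed_cell \<tau> = {x. (\<forall>v. 0 \<le> x v) \<and> (\<forall>v. v \<notin> \<tau> \<longrightarrow> x v = 0) \<and> sum x \<tau> = 1}"

definition realization :: "'v set set \<Rightarrow> ('v \<Rightarrow> real) set" where
  "realization K = (\<Union>\<tau>\<in>K. closed_cell \<tau>)"

text \<open>The Euclidean inner product for which every simplex is regular with edges of length 1:
  vertex \<open>v\<close> sits at the unit coordinate vector of \<open>v\<close> divided by \<open>sqrt 2\<close>.  It is used for
  finitely supported vectors only.\<close>

definition ip :: "('v \<Rightarrow> real) \<Rightarrow> ('v \<Rightarrow> real) \<Rightarrow> real" where
  "ip x y = (\<Sum>v | x v \<noteq> 0 \<and> y v \<noteq> 0. x v * y v) / 2"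

definition vertex_point :: "'v \<Rightarrow> 'v \<Rightarrow> real" where
  "vertex_point a = (\<lambda>v. if v = a then 1 else 0)"

lemma regular_edge_length:
  assumes "a \<noteq> b"
  defines "e \<equiv> \<lambda>v. vertex_point b v - vertex_point a v"
  shows "sqrt (ip e e) = 1"
proof -
  have "{v. e v \<noteq> 0 \<and> e v \<noteq> 0} = {a, b}"
    using assms(1) by (auto simp: e_def vertex_point_def)
  then have "ip e e = (\<Sum>v\<in>{a, b}. e v * e v) / 2"
    by (simp add: ip_def)
  also have "\<dots> = 1"
    using assms(1) by (simp add: e_def vertex_point_def)
  finally show ?thesis by simp
qed

section \<open>Metric links\<close>

text \<open>Unit tangent vectors orthogonal to \<open>\<sigma>\<close> and pointing into \<open>\<tau>\<close>, for \<open>\<sigma> \<subseteq> \<tau>\<close>.\<close>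

definition metric_link :: "'v set \<Rightarrow> 'v set \<Rightarrow> ('v \<Rightarrow> real) set" where
  "metric_link \<sigma> \<tau> = {u. ip u u = 1 \<and>
     (\<forall>p\<in>closed_cell \<sigma>. \<forall>q\<in>closed_cell \<sigma>. ip u (\<lambda>v. p v - q v) = 0) \<and>
     (\<exists>p\<in>closed_cell \<sigma>. \<exists>\<epsilon>>0. (\<lambda>v. p v + \<epsilon> * u v) \<in> closed_cell \<tau>)}"

text \<open>The cells of the piecewise spherical complex \<open>lk_K(\<sigma>)\<close>.  Cells for different \<open>\<tau>\<close> meet
  exactly in the cell of the common face, so the gluing is given by union.\<close>

definition link_cells :: "'v set set \<Rightarrow> 'v set \<Rightarrow> ('v \<Rightarrow> real) set set" where
  "link_cells K \<sigma> = {metric_link \<sigma> \<tau> |\<tau>. \<tau> \<in> K \<and> \<sigma> \<subseteq> \<tau>}"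

section \<open>Piecewise spherical complexes and locally geodesic loops\<close>

text \<open>A piecewise spherical complex is a set \<open>C\<close> of convex cells consisting of \<^const>\<open>ip\<close>-unit
  vectors.  Its intrinsic distance is the infimum of the lengths of strings of points, consecutive
  ones lying in a common cell; it is infinite between different components.\<close>

definition string_length :: "('v \<Rightarrow> real) list \<Rightarrow> real" where
  "string_length xs = (\<Sum>i<length xs - 1. arccos (ip (xs ! i) (xs ! Suc i)))"

definition intrinsic_dist ::
    "('v \<Rightarrow> real) set set \<Rightarrow> ('v \<Rightarrow> real) \<Rightarrow> ('v \<Rightarrow> real) \<Rightarrow> ereal" where
  "intrinsic_dist C x y =
     (INF xs\<in>{xs. xs \<noteq> [] \<and> hd xs = x \<and> last xs = y \<and>
                  successively (\<lambda>a b. \<exists>c\<in>C. a \<in> c \<and> b \<in> c) xs}. ereal (string_length xs))"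

definition great_arc :: "('v \<Rightarrow> real) \<Rightarrow> ('v \<Rightarrow> real) \<Rightarrow> real \<Rightarrow> 'v \<Rightarrow> real" where
  "great_arc x \<xi> s = (\<lambda>v. cos s * x v + sin s * \<xi> v)"

text \<open>The unit tangent vectors at \<open>x\<close> pointing into the spherical cell \<open>c\<close>, and the cells of the
  link \<open>lk_X(x)\<close> of the point \<open>x\<close> in the piecewise spherical complex \<open>X\<close> with set of cells \<open>C\<close>.
  The angle between two directions at \<open>x\<close> is their intrinsic distance in this link.\<close>

definition direction_cell :: "('v \<Rightarrow> real) set \<Rightarrow> ('v \<Rightarrow> real) \<Rightarrow> ('v \<Rightarrow> real) set" where
  "direction_cell c x =
     {\<xi>. ip \<xi> \<xi> = 1 \<and> ip x \<xi> = 0 \<and> (\<exists>\<epsilon>>0. \<forall>s\<in>{0..\<epsilon>}. great_arc x \<xi> s \<in> c)}"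

definition point_link_cells ::
    "('v \<Rightarrow> real) set set \<Rightarrow> ('v \<Rightarrow> real) \<Rightarrow> ('v \<Rightarrow> real) set set" where
  "point_link_cells C x = {direction_cell c x |c. c \<in> C \<and> x \<in> c}"

definition angle_at ::
    "('v \<Rightarrow> real) set set \<Rightarrow> ('v \<Rightarrow> real) \<Rightarrow> ('v \<Rightarrow> real) \<Rightarrow> ('v \<Rightarrow> real) \<Rightarrow> ereal" where
  "angle_at C x \<xi> \<eta> = intrinsic_dist (point_link_cells C x) \<xi> \<eta>"

text \<open>From time \<open>t\<close> on, \<open>\<gamma>\<close> runs for a while at unit speed along the geodesic with initial
  direction \<open>\<xi>\<close> in one cell.\<close>

definition departs_along ::
    "('v \<Rightarrow> real) set set \<Rightarrow> (real \<Rightarrow> 'v \<Rightarrow> real) \<Rightarrow> real \<Rightarrow> ('v \<Rightarrow> real) \<Rightarrow> bool" where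
  "departs_along C \<gamma> t \<xi> \<longleftrightarrow> ip \<xi> \<xi> = 1 \<and> ip (\<gamma> t) \<xi> = 0 \<and>
     (\<exists>c\<in>C. \<exists>\<epsilon>>0. \<forall>s\<in>{0..\<epsilon>}. \<gamma> (t + s) = great_arc (\<gamma> t) \<xi> s \<and> \<gamma> (t + s) \<in> c)"

text \<open>The metric circle of length \<open>l\<close> is the real line modulo \<open>l\<close>, and its embedding is piecewise
  geodesic of unit speed (by compactness, the one-sided condition at every point yields a finite
  subdivision into geodesic arcs lying in single cells).  Without this the angle condition alone
  would also admit smooth curves that are not geodesic.  The vector \<open>\<eta>\<close> is the direction at
  \<open>\<gamma> t\<close> of the incoming branch, i.e. the outgoing direction of the reversed loop.\<close>

definition locally_geodesic_loop ::
    "('v \<Rightarrow> real) set set \<Rightarrow> real \<Rightarrow> (real \<Rightarrow> 'v \<Rightarrow> real) \<Rightarrow> bool" where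
  "locally_geodesic_loop C l \<gamma> \<longleftrightarrow>
     0 < l \<and> (\<forall>t. \<gamma> (t + l) = \<gamma> t) \<and> inj_on \<gamma> {0..<l} \<and>
     (\<forall>t. \<exists>\<xi> \<eta>. departs_along C \<gamma> t \<xi> \<and> departs_along C (\<lambda>s. \<gamma> (- s)) (- t) \<eta> \<and>
            ereal pi \<le> angle_at C (\<gamma> t) \<xi> \<eta>)"

text \<open>Curvature of complexes with the regular metric.  Having finitely many isometry types
  of cells amounts to being finite-dimensional, and is not repeated here.\<close>

definition nonpositively_curved :: "'v set set \<Rightarrow> bool" where
  "nonpositively_curved K \<longleftrightarrow>
     (\<forall>\<sigma>\<in>K. \<not> (\<exists>l \<gamma>. l < 2 * pi \<and> locally_geodesic_loop (link_cells K \<sigma>) l \<gamma>))"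

definition CAT0 :: "'v set set \<Rightarrow> bool" where
  "CAT0 K \<longleftrightarrow>
     nonpositively_curved K \<and> connected (realization K) \<and> simply_connected (realization K)"

section \<open>Spanning disks\<close>

definition spanning_disk :: "'v set set \<Rightarrow> 'v set set \<Rightarrow> 'v set set \<Rightarrow> bool" where
  "spanning_disk K \<alpha> D \<longleftrightarrow> subcomplex D K \<and> \<alpha> \<subseteq> D \<and>
     (\<exists>h k. homeomorphism (realization D) (cball (0::complex) 1) h k \<and>
            h ` realization \<alpha> = sphere 0 1)"

definition combinatorial_area :: "'v set set \<Rightarrow> nat" where
  "combinatorial_area D = card (triangles D)"

definition minimal_disks :: "'v set set \<Rightarrow> 'v set set \<Rightarrow> 'v set set set" where
  "minimal_disks K \<alpha> = {D. spanning_disk K \<alpha> D \<and>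
     (\<forall>D'. spanning_disk K \<alpha> D' \<longrightarrow> combinatorial_area D \<le> combinatorial_area D')}"

definition cone_disk :: "'v \<Rightarrow> 'v set set \<Rightarrow> 'v set set" where
  "cone_disk w \<alpha> = generated_complex {insert w e |e. e \<in> \<alpha> \<and> card e = 2}"

end

theory Submission
  imports Defs
begin

text \<open>In the link of a simplex that misses a vertex \<open>s\<close> of \<open>S\<close>, every cell lies in a cell containing
  the direction \<open>e\<close> towards \<open>s\<close>, at distance less than \<open>pi / 2\<close> from all points.  At a point of a
  closed geodesic farthest from \<open>e\<close> both branches turn towards \<open>e\<close>, so that the angle between them
  is less than \<open>pi\<close>: there is no locally geodesic loop.  Links of simplices strictly containing
  \<open>S\<close> have cells of at most one point.  The link of \<open>S\<close> is a circle of length \<open>5 * \<theta>\<close> with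
  \<open>\<theta> = arccos (1 / (card S + 1))\<close>, which is at least \<open>2 * pi\<close> if \<open>card S \<ge> 3\<close>, whereas the cone disk,
  which is the case \<open>card S = 1\<close>, has the length \<open>5 * pi / 3\<close>.

  In a spanning disk, invariance of domain shows that every maximal simplex has at least three
  vertices and that an edge outside the boundary is not contained in just one triangle.  The first
  gives a triangle over each of the five edges of \<open>\<alpha>\<close>; the second forces the apices of
  neighbouring triangles to agree if there are no more triangles than these.\<close>

subsection \<open>The inner product\<close>

text \<open>The number \<theta> is the dihedral angle of a regular simplex of dimension card S + 1
  along a face of codimension 2. Five such simplices around S close up with total angle at least 2 *
  pi exactly if 1 / (card S + 1) \<le> cos (2 * pi / 5), which is about 0.309. This holds for card S
  = 3 and fails for card S = 2, whence the bound n \<ge> 4.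

  A loop is an arbitrary periodic map that is known only through one-sided conditions at each time.
  Even in a circle its length therefore has to be derived: injectivity makes the two branches at
  each time leave in opposite directions, so that the loop locally has the form
  \<open>c (r + d * t)\<close> with d = 1 or d = -1, and connectedness of the line extends one such
  formula to all times.

  Likewise a spanning disk is known only through a homeomorphism with the round disk. Its
  combinatorics near a simplex is read off by charting the open star of the simplex in the plane by
  barycentric coordinates.\<close>

text \<open>The index set in \<open>ip\<close> depends on both arguments; passing to a fixed finite
  set is what makes bilinearity provable.\<close>

lemma ip_eq_sum:
  assumes "finite V" "{v. x v \<noteq> 0 \<and> y v \<noteq> 0} \<subseteq> V"
  shows "ip x y = (\<Sum>v\<in>V. x v * y v) / 2"
proof -
  have "(\<Sum>v | x v \<noteq> 0 \<and> y v \<noteq> 0. x v * y v) = (\<Sum>v\<in>V. x v * y v)"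
    using assms by (intro sum.mono_neutral_left) auto
  then show ?thesis by (simp add: ip_def)
qed

lemma ip_commute: "ip x y = ip y x"
  by (simp add: ip_def mult.commute conj_commute)

lemma ip_nonneg: "0 \<le> ip x x"
  by (simp add: ip_def sum_nonneg)

text \<open>A sum over an infinite set is 0 by convention, so norm 1 already forces finite support.
  Points of links and unit directions thus satisfy the finiteness hypotheses of
  \<open>ip_lincomb\<close>.\<close>

lemma ip_unit_finite_support:
  assumes "ip x x = 1"
  shows "finite {v. x v \<noteq> 0}"
  using assms by (auto simp: ip_def intro: ccontr)

lemma ip_pos:
  assumes "finite {v. x v \<noteq> 0}" "x a \<noteq> 0"
  shows "0 < ip x x"
proof -
  have "0 < (\<Sum>v | x v \<noteq> 0 \<and> x v \<noteq> 0. x v * x v)"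
    using assms by (intro sum_pos2[where i = a]) (auto simp: zero_less_mult_iff linorder_neq_iff)
  then show ?thesis by (simp add: ip_def)
qed

lemma ip_lincomb:
  assumes "finite {v. x v \<noteq> 0}" "finite {v. y v \<noteq> 0}"
  shows "ip (\<lambda>v. a * x v + b * y v) z = a * ip x z + b * ip y z"
proof -
  define V where "V = {v. x v \<noteq> 0} \<union> {v. y v \<noteq> 0}"
  have fV: "finite V" using assms by (simp add: V_def)
  have "ip (\<lambda>v. a * x v + b * y v) z = (\<Sum>v\<in>V. (a * x v + b * y v) * z v) / 2"
    by (rule ip_eq_sum[OF fV]) (auto simp: V_def)
  also have "\<dots> = a * ((\<Sum>v\<in>V. x v * z v) / 2) + b * ((\<Sum>v\<in>V. y v * z v) / 2)"
    by (simp add: algebra_simps sum.distrib sum_distrib_left add_divide_distrib)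
  also have "(\<Sum>v\<in>V. x v * z v) / 2 = ip x z"
    by (rule ip_eq_sum[OF fV, symmetric]) (auto simp: V_def)
  also have "(\<Sum>v\<in>V. y v * z v) / 2 = ip y z"
    by (rule ip_eq_sum[OF fV, symmetric]) (auto simp: V_def)
  finally show ?thesis .
qed

lemma ip_lincomb_right:
  assumes "finite {v. x v \<noteq> 0}" "finite {v. y v \<noteq> 0}"
  shows "ip z (\<lambda>v. a * x v + b * y v) = a * ip z x + b * ip z y"
  using ip_lincomb[OF assms] by (simp add: ip_commute[of z])

text \<open>Cauchy-Schwarz for unit vectors, by expanding the squared norm of x - y.\<close>

lemma ip_le_1:
  assumes "ip x x = 1" "ip y y = 1"
  shows "ip x y \<le> 1"
proof -
  note f = ip_unit_finite_support[OF assms(1)] ip_unit_finite_support[OF assms(2)]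
  have "0 \<le> ip (\<lambda>v. 1 * x v + (-1) * y v) (\<lambda>v. 1 * x v + (-1) * y v)"
    by (rule ip_nonneg)
  also have "\<dots> = 2 - 2 * ip x y"
    using f assms by (simp add: ip_lincomb[of x y 1 "-1", simplified] ip_lincomb_right[of x y _ 1 "-1", simplified] ip_commute[of y x])
  finally show ?thesis by simp
qed

lemma ip_great_arc:
  assumes "ip x x = 1" "ip \<xi> \<xi> = 1" "ip x \<xi> = 0"
  shows "ip (great_arc x \<xi> s) (great_arc x \<xi> s') = cos (s - s')"
proof -
  note f = ip_unit_finite_support[OF assms(1)] ip_unit_finite_support[OF assms(2)]
  show ?thesis
    using assms f by (simp add: great_arc_def ip_lincomb ip_lincomb_right ip_commute[of \<xi> x] cos_diff)
qed

lemma ip_great_arc_left: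
  assumes "ip x x = 1" "ip \<xi> \<xi> = 1"
  shows "ip (great_arc x \<xi> s) y = cos s * ip x y + sin s * ip \<xi> y"
  using ip_unit_finite_support[OF assms(1)] ip_unit_finite_support[OF assms(2)]
  by (simp add: great_arc_def ip_lincomb)

lemma great_arc_0 [simp]: "great_arc x \<xi> 0 = x"
  by (simp add: great_arc_def)

subsection \<open>Metric links\<close>

lemma vertex_point_in_closed_cell [simp]:
  assumes "finite \<tau>" "a \<in> \<tau>"
  shows "vertex_point a \<in> closed_cell \<tau>"
  using assms by (auto simp: closed_cell_def vertex_point_def)

text \<open>Orthogonality to the edges of \<rho> makes u constant on \<rho>. Pointing into \<tau> is
  a sign condition off \<rho> only, because from the barycenter of \<rho> a short step keeps the
  coordinates on \<rho> nonnegative. Base point and step size disappear, and all conditions but the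
  norm become linear.\<close>

lemma metric_link_iff:
  assumes "finite \<tau>" "\<rho> \<subseteq> \<tau>" "\<rho> \<noteq> {}"
  shows "u \<in> metric_link \<rho> \<tau> \<longleftrightarrow>
    ip u u = 1 \<and> (\<forall>a\<in>\<rho>. \<forall>b\<in>\<rho>. u a = u b) \<and> (\<forall>v. v \<notin> \<tau> \<longrightarrow> u v = 0) \<and>
    sum u \<tau> = 0 \<and> (\<forall>v\<in>\<tau> - \<rho>. 0 \<le> u v)" (is "?L \<longleftrightarrow> ?R")
proof
  have f\<rho>: "finite \<rho>" using assms finite_subset by blast
  {
    assume L: ?L
    then have one: "ip u u = 1"
      and orth: "\<And>p q. p \<in> closed_cell \<rho> \<Longrightarrow> q \<in> closed_cell \<rho> \<Longrightarrow> ip u (\<lambda>v. p v - q v) = 0"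
      by (auto simp: metric_link_def)
    obtain p \<epsilon> where p: "p \<in> closed_cell \<rho>" and \<epsilon>: "\<epsilon> > 0"
      and q: "(\<lambda>v. p v + \<epsilon> * u v) \<in> closed_cell \<tau>"
      using L by (auto simp: metric_link_def)
    have const: "u a = u b" if "a \<in> \<rho>" "b \<in> \<rho>" for a b
    proof (cases "a = b")
      case False
      let ?e = "\<lambda>v. vertex_point a v - vertex_point b v"
      have "0 = ip u ?e" using orth[of "vertex_point a" "vertex_point b"] that f\<rho> by simp
      also have "\<dots> = (\<Sum>v\<in>{a, b}. u v * ?e v) / 2"
        by (rule ip_eq_sum) (auto simp: vertex_point_def)
      also have "\<dots> = (u a - u b) / 2"
        using False by (simp add: vertex_point_def)
      finally show ?thesis by simp
    qed simp
    have p0: "p v = 0" if "v \<notin> \<rho>" for v using p that by (auto simp: closed_cell_def)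
    have out: "u v = 0" if "v \<notin> \<tau>" for v
    proof -
      have "p v + \<epsilon> * u v = 0" using q that by (auto simp: closed_cell_def)
      moreover have "p v = 0" using p0 that assms(2) by blast
      ultimately show ?thesis using \<epsilon> by simp
    qed
    have "sum p \<tau> = sum p \<rho>"
      using assms p0 by (intro sum.mono_neutral_right) auto
    then have "sum p \<tau> = 1" using p by (auto simp: closed_cell_def)
    moreover have "sum p \<tau> + \<epsilon> * sum u \<tau> = 1"
      using q by (auto simp: closed_cell_def sum.distrib sum_distrib_left)
    ultimately have "sum u \<tau> = 0" using \<epsilon> by simp
    moreover have "0 \<le> u v" if "v \<in> \<tau> - \<rho>" for v
    proof -
      have "0 \<le> p v + \<epsilon> * u v" using q by (auto simp: closed_cell_def)
      then show ?thesis using p0[of v] that \<epsilon> by (simp add: zero_le_mult_iff)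
    qed
    ultimately show ?R using one const out by blast
  }
  assume R: ?R
  have card: "0 < card \<rho>" using f\<rho> assms by (simp add: card_gt_0_iff)
  define p where "p v = (if v \<in> \<rho> then 1 / real (card \<rho>) else 0)" for v
  obtain a where a: "a \<in> \<rho>" using assms by blast
  \<comment> \<open>On \<rho> the vector u has the value \<open>u a\<close>, so this step changes a
    barycentric coordinate by at most 1 / card \<rho>; the summand 1 keeps the denominator positive
    when \<open>u a\<close> is 0.\<close>
  define \<epsilon> where "\<epsilon> = 1 / (real (card \<rho>) * (\<bar>u a\<bar> + 1))"
  have \<epsilon>: "\<epsilon> > 0" using card by (simp add: \<epsilon>_def)
  have pc: "p \<in> closed_cell \<rho>"
    using card by (auto simp: closed_cell_def p_def)
  have "0 \<le> p v + \<epsilon> * u v" for v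
  proof (cases "v \<in> \<rho>")
    case True
    then have "u v = u a" using R a by blast
    moreover have "\<epsilon> * \<bar>u a\<bar> \<le> 1 / real (card \<rho>)"
      using card by (simp add: \<epsilon>_def divide_simps)
    moreover have "\<epsilon> * (- u a) \<le> \<epsilon> * \<bar>u a\<bar>" using \<epsilon> by (intro mult_left_mono) auto
    ultimately show ?thesis using True by (simp add: p_def)
  next
    case False
    then show ?thesis using R \<epsilon> by (cases "v \<in> \<tau>") (auto simp: p_def)
  qed
  moreover have "p v + \<epsilon> * u v = 0" if "v \<notin> \<tau>" for v
    using R that assms by (auto simp: p_def)
  moreover have "(\<Sum>v\<in>\<tau>. p v + \<epsilon> * u v) = 1"
  proof -
    have "sum p \<tau> = sum p \<rho>"
      using assms by (intro sum.mono_neutral_right) (auto simp: p_def)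
    then show ?thesis using R pc by (simp add: sum.distrib sum_distrib_left[symmetric] closed_cell_def)
  qed
  ultimately have qc: "(\<lambda>v. p v + \<epsilon> * u v) \<in> closed_cell \<tau>"
    by (auto simp: closed_cell_def)
  have "ip u (\<lambda>v. p v - q v) = 0" if "p \<in> closed_cell \<rho>" "q \<in> closed_cell \<rho>" for p q
  proof -
    have "ip u (\<lambda>v. p v - q v) = (\<Sum>v\<in>\<rho>. u v * (p v - q v)) / 2"
      using that by (intro ip_eq_sum f\<rho>) (auto simp: closed_cell_def, metis)
    also have "(\<Sum>v\<in>\<rho>. u v * (p v - q v)) = (\<Sum>v\<in>\<rho>. u a * (p v - q v))"
      by (intro sum.cong refl) (metis R a)
    also have "\<dots> = 0"
      using that by (simp add: sum_distrib_left[symmetric] sum_subtractf closed_cell_def)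
    finally show ?thesis by simp
  qed
  then show ?L using R pc qc \<epsilon> unfolding metric_link_def by blast
qed

lemma metric_link_mono:
  assumes "finite \<tau>'" "\<rho> \<noteq> {}" "\<rho> \<subseteq> \<tau>" "\<tau> \<subseteq> \<tau>'"
  shows "metric_link \<rho> \<tau> \<subseteq> metric_link \<rho> \<tau>'"
proof
  fix u assume u: "u \<in> metric_link \<rho> \<tau>"
  have f: "finite \<tau>" "\<rho> \<subseteq> \<tau>'" using assms finite_subset by auto
  note u = u[unfolded metric_link_iff[OF f(1) assms(3,2)]]
  have "sum u \<tau>' = sum u \<tau>" using assms u by (intro sum.mono_neutral_right) blast+
  with u have "sum u \<tau>' = 0" by simp
  then show "u \<in> metric_link \<rho> \<tau>'"
    unfolding metric_link_iff[OF assms(1) f(2) assms(2)]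
  proof (intro conjI)
    show "\<forall>v\<in>\<tau>' - \<rho>. 0 \<le> u v" using u by (metis DiffD2 DiffI order_refl)
    show "\<forall>v. v \<notin> \<tau>' \<longrightarrow> u v = 0" using u assms by blast
    show "\<forall>a\<in>\<rho>. \<forall>b\<in>\<rho>. u a = u b" using u by (elim conjE)
  qed (use u in \<open>simp_all only: simp_thms\<close>)
qed

text \<open>The coordinates sum to 0 and are nonnegative off \<rho>, so the constant value on \<rho>
  balances the others. If it were 0, all coordinates would vanish, against the unit norm; in
  particular the link of \<rho> in \<rho> itself is empty.\<close>

lemma metric_link_const_neg:
  assumes "finite \<tau>" "\<rho> \<subseteq> \<tau>" "u \<in> metric_link \<rho> \<tau>" "a \<in> \<rho>"
  shows "u a = - sum u (\<tau> - \<rho>) / card \<rho>" "u a < 0"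
proof -
  have ne: "\<rho> \<noteq> {}" using assms by auto
  note u = assms(3)[unfolded metric_link_iff[OF assms(1,2) ne]]
  have f\<rho>: "finite \<rho>" using assms finite_subset by blast
  have card: "0 < real (card \<rho>)" using f\<rho> ne by (simp add: card_gt_0_iff)
  have "sum u \<rho> = (\<Sum>v\<in>\<rho>. u a)" using u assms(4) by (intro sum.cong refl) blast
  then have s1: "sum u \<rho> = card \<rho> * u a" by simp
  moreover have "sum u \<tau> = sum u (\<tau> - \<rho>) + sum u \<rho>"
    using assms by (simp add: sum.subset_diff)
  moreover have "sum u \<tau> = 0" using u by (elim conjE)
  ultimately have *: "card \<rho> * u a = - sum u (\<tau> - \<rho>)" by simp
  then show "u a = - sum u (\<tau> - \<rho>) / card \<rho>" using card by (simp add: field_simps)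
  have "0 < sum u (\<tau> - \<rho>)"
  proof (rule ccontr)
    assume "\<not> 0 < sum u (\<tau> - \<rho>)"
    then have s0: "sum u (\<tau> - \<rho>) = 0" using u sum_nonneg[of "\<tau> - \<rho>" u] by force
    then have "\<forall>v\<in>\<tau> - \<rho>. u v = 0" using u assms(1)
      by (subst (asm) sum_nonneg_eq_0_iff) auto
    moreover have "u v = 0" if "v \<in> \<rho>" for v
    proof -
      have "u a = 0" using * s0 card by simp
      moreover have "u v = u a" using u that assms(4) by blast
      ultimately show ?thesis by simp
    qed
    ultimately have "u v = 0" for v using u by blast
    then have "ip u u = 0" by (simp add: ip_def)
    then show False using u by simp
  qed
  then have "card \<rho> * u a < 0" using * by simp
  then show "u a < 0" using card by (simp add: mult_less_0_iff)
qed

lemma link_cells_unit: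
  assumes "c \<in> link_cells K \<rho>" "x \<in> c"
  shows "ip x x = 1"
  using assms by (auto simp: link_cells_def metric_link_def)

lemma departs_along_cell:
  assumes "departs_along (link_cells K \<rho>) \<gamma> t \<xi>"
  obtains \<tau> \<epsilon> where "\<tau> \<in> K" "\<rho> \<subseteq> \<tau>" "\<epsilon> > 0"
    "\<And>s. 0 \<le> s \<Longrightarrow> s \<le> \<epsilon> \<Longrightarrow> \<gamma> (t + s) = great_arc (\<gamma> t) \<xi> s"
    "\<And>s. 0 \<le> s \<Longrightarrow> s \<le> \<epsilon> \<Longrightarrow> great_arc (\<gamma> t) \<xi> s \<in> metric_link \<rho> \<tau>"
    "ip \<xi> \<xi> = 1" "ip (\<gamma> t) \<xi> = 0" "ip (\<gamma> t) (\<gamma> t) = 1" "\<gamma> t \<in> metric_link \<rho> \<tau>"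
proof -
  obtain c \<epsilon> where c: "c \<in> link_cells K \<rho>" "\<epsilon> > 0"
    "\<forall>s\<in>{0..\<epsilon>}. \<gamma> (t + s) = great_arc (\<gamma> t) \<xi> s \<and> \<gamma> (t + s) \<in> c"
    using assms unfolding departs_along_def by blast
  then obtain \<tau> where \<tau>: "c = metric_link \<rho> \<tau>" "\<tau> \<in> K" "\<rho> \<subseteq> \<tau>" by (auto simp: link_cells_def)
  have x: "\<gamma> t \<in> c" using c(2) c(3)[rule_format, of 0] by simp
  show ?thesis
  proof (rule that[of \<tau> \<epsilon>])
    show "ip \<xi> \<xi> = 1" "ip (\<gamma> t) \<xi> = 0" using assms by (auto simp: departs_along_def)
    fix s assume "0 \<le> s" "s \<le> \<epsilon>"
    then show "\<gamma> (t + s) = great_arc (\<gamma> t) \<xi> s" "great_arc (\<gamma> t) \<xi> s \<in> metric_link \<rho> \<tau>"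
      using c(3)[rule_format, of s] \<tau>(1) by auto
  qed (use c \<tau> x link_cells_unit[OF c(1) x] in auto)
qed

section \<open>Periodic maps on the real line\<close>

lemma periodic_int:
  assumes "\<forall>t. \<gamma> (t + l) = \<gamma> (t::real)"
  shows "\<gamma> (t + of_int k * l) = \<gamma> t"
proof -
  have nat: "\<gamma> (t + of_nat n * l) = \<gamma> t" for n t
  proof (induction n arbitrary: t)
    case (Suc n)
    have "t + of_nat (Suc n) * l = (t + of_nat n * l) + l" by (simp add: algebra_simps)
    then show ?case using assms Suc by metis
  qed simp
  show ?thesis
  proof (cases k)
    case (nonneg n)
    then show ?thesis using nat by simp
  next
    case (neg n)
    have "\<gamma> (t + of_int k * l + of_nat (Suc n) * l) = \<gamma> (t + of_int k * l)" by (rule nat)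
    moreover have "t + of_int k * l + of_nat (Suc n) * l = t"
      unfolding neg by (simp add: algebra_simps)
    ultimately show ?thesis by (simp only:)
  qed
qed

lemma periodic_reduce:
  assumes "0 < l" "\<forall>t. \<gamma> (t + l) = \<gamma> (t::real)"
  obtains r where "r \<in> {0..<l}" "\<gamma> r = \<gamma> t"
proof
  let ?r = "t - \<lfloor>t / l\<rfloor> * l"
  have "of_int \<lfloor>t / l\<rfloor> \<le> t / l" "t / l < of_int \<lfloor>t / l\<rfloor> + 1" by linarith+
  then have "of_int \<lfloor>t / l\<rfloor> * l \<le> t" "t < of_int \<lfloor>t / l\<rfloor> * l + l"
    using assms(1) by (simp_all only: pos_le_divide_eq pos_divide_less_eq distrib_right mult_1)
  then show "?r \<in> {0..<l}" by simp
  show "\<gamma> ?r = \<gamma> t" using periodic_int[OF assms(2), of t "- \<lfloor>t / l\<rfloor>"] by simp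
qed

text \<open>After reduction into \<open>{0..<l}\<close> both times coincide, so s - t is an integer
  multiple of l, and a multiple shorter than l is 0. This covers pairs of times on both sides of a
  multiple of l.\<close>

lemma periodic_inj_eq:
  assumes "0 < l" "\<forall>t. \<gamma> (t + l) = \<gamma> (t::real)" "inj_on \<gamma> {0..<l}"
    and eq: "\<gamma> s = \<gamma> t" and near: "\<bar>s - t\<bar> < l"
  shows "s = t"
proof -
  define k where "k = \<lfloor>t / l\<rfloor>"
  define k' where "k' = \<lfloor>s / l\<rfloor>"
  have "of_int k \<le> t / l" "t / l < of_int k + 1" "of_int k' \<le> s / l" "s / l < of_int k' + 1"
    unfolding k_def k'_def by linarith+
  then have b: "t - k * l \<in> {0..<l}" "s - k' * l \<in> {0..<l}"
    using assms(1) by (simp_all add: pos_le_divide_eq pos_divide_less_eq distrib_right)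
  have "\<gamma> (t - k * l) = \<gamma> (s - k' * l)"
    using periodic_int[OF assms(2), of t "-k"] periodic_int[OF assms(2), of s "-k'"] eq by simp
  then have e: "t - k * l = s - k' * l" using b assms(3) by (auto simp: inj_on_def)
  then have "\<bar>of_int (k' - k)\<bar> * l < 1 * l"
  proof -
    have "s - t = of_int (k' - k) * l" using e by (simp add: algebra_simps)
    then have "\<bar>s - t\<bar> = \<bar>of_int (k' - k)\<bar> * l" using assms(1) by (simp add: abs_mult)
    then show ?thesis using near by simp
  qed
  then have "\<bar>real_of_int (k' - k)\<bar> < 1" using assms(1) mult_less_cancel_right_pos by blast
  then have "k' = k" by linarith
  then show ?thesis using e by simp
qed

lemma locally_geodesic_loopD:
  assumes "locally_geodesic_loop C l \<gamma>"
  shows "0 < l" "\<forall>t. \<gamma> (t + l) = \<gamma> t" "inj_on \<gamma> {0..<l}"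
    "\<And>t. \<exists>\<xi> \<eta>. departs_along C \<gamma> t \<xi> \<and> departs_along C (\<lambda>s. \<gamma> (- s)) (- t) \<eta> \<and>
            ereal pi \<le> angle_at C (\<gamma> t) \<xi> \<eta>"
  using assms unfolding locally_geodesic_loop_def by auto

subsection \<open>Links that are stars of a vertex\<close>

text \<open>A departing branch traverses an arc of positive length inside one cell, for which a
  single point leaves no room.\<close>

lemma no_loop_in_small_links:
  assumes "\<And>\<tau>. \<tau> \<in> K \<Longrightarrow> \<rho> \<subseteq> \<tau> \<Longrightarrow> \<exists>x. metric_link \<rho> \<tau> \<subseteq> {x}"
  shows "\<not> locally_geodesic_loop (link_cells K \<rho>) l \<gamma>"
proof
  assume "locally_geodesic_loop (link_cells K \<rho>) l \<gamma>"
  from locally_geodesic_loopD(4)[OF this]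
  obtain \<xi> where "departs_along (link_cells K \<rho>) \<gamma> 0 \<xi>" by blast
  then obtain \<tau> \<epsilon> where d: "\<tau> \<in> K" "\<rho> \<subseteq> \<tau>" "\<epsilon> > 0"
    "\<And>s. 0 \<le> s \<Longrightarrow> s \<le> \<epsilon> \<Longrightarrow> great_arc (\<gamma> 0) \<xi> s \<in> metric_link \<rho> \<tau>"
    "ip \<xi> \<xi> = 1" "ip (\<gamma> 0) \<xi> = 0" "ip (\<gamma> 0) (\<gamma> 0) = 1"
    by (rule departs_along_cell) metis
  define s where "s = min \<epsilon> 1"
  have s: "0 < s" "s \<le> \<epsilon>" "s \<le> 1" using d(3) by (auto simp: s_def)
  obtain x where x: "metric_link \<rho> \<tau> \<subseteq> {x}" using assms d by blast
  have "great_arc (\<gamma> 0) \<xi> s = great_arc (\<gamma> 0) \<xi> 0"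
    using d(4)[of s] d(4)[of 0] s x by auto
  then have "cos (s - 0) = 1"
    using ip_great_arc[OF d(7,5,6), of s 0] d(7) by simp
  moreover have "cos s < cos 0" using s pi_gt3 by (intro cos_monotone_0_pi) auto
  ultimately show False by simp
qed

text \<open>Following a great arc gives the limit from the right, and the same for the reversed loop
  gives the limit from the left.\<close>

lemma loop_coordinate_continuous:
  assumes "locally_geodesic_loop C l \<gamma>"
  shows "continuous_on UNIV (\<lambda>t. \<gamma> t v)"
proof -
  have right: "((\<lambda>t. \<beta> t v) \<longlongrightarrow> \<beta> t v) (at_right t)" if dep: "departs_along C \<beta> t \<xi>" for \<beta> t \<xi>
  proof -
    obtain c \<epsilon> where \<epsilon>: "\<epsilon> > 0"
      "\<forall>s\<in>{0..\<epsilon>}. \<beta> (t + s) = great_arc (\<beta> t) \<xi> s \<and> \<beta> (t + s) \<in> c"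
      using dep unfolding departs_along_def by blast
    have "((\<lambda>t'. great_arc (\<beta> t) \<xi> (t' - t) v) \<longlongrightarrow> great_arc (\<beta> t) \<xi> (t - t) v) (at_right t)"
      unfolding great_arc_def by (intro tendsto_intros)
    moreover have "\<forall>\<^sub>F t' in at_right t. great_arc (\<beta> t) \<xi> (t' - t) v = \<beta> t' v"
      unfolding eventually_at_right_field
    proof (intro exI[of _ "t + \<epsilon>"] conjI allI impI)
      fix y assume "t < y" "y < t + \<epsilon>"
      then show "great_arc (\<beta> t) \<xi> (y - t) v = \<beta> y v"
        using \<epsilon>(2)[rule_format, of "y - t"] by simp
    qed (use \<epsilon> in simp)
    ultimately show ?thesis by (simp add: tendsto_cong)
  qed
  have "isCont (\<lambda>t. \<gamma> t v) t" for t
  proof -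
    obtain \<xi> \<eta> where d: "departs_along C \<gamma> t \<xi>" "departs_along C (\<lambda>s. \<gamma> (- s)) (- t) \<eta>"
      using locally_geodesic_loopD(4)[OF assms] by blast
    have "((\<lambda>s. \<gamma> (- s) v) \<longlongrightarrow> \<gamma> t v) (at_right (- t))" using right[OF d(2)] by simp
    then have "((\<lambda>s. \<gamma> s v) \<longlongrightarrow> \<gamma> t v) (at_left t)"
      by (simp add: at_left_minus filterlim_filtermap)
    then show ?thesis using right[OF d(1)]
      unfolding isCont_def by (simp add: filterlim_split_at)
  qed
  then show ?thesis by (simp add: continuous_on_eq_continuous_at)
qed

lemma no_loop_in_star:
  assumes K: "\<And>\<tau>. \<tau> \<in> K \<Longrightarrow> finite \<tau>"
    and star: "\<And>\<tau>. \<tau> \<in> K \<Longrightarrow> \<rho> \<subseteq> \<tau> \<Longrightarrow> insert s \<tau> \<in> K"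
    and \<rho>: "\<rho> \<noteq> {}" "finite \<rho>" "s \<notin> \<rho>"
  shows "\<not> locally_geodesic_loop (link_cells K \<rho>) l \<gamma>"
proof
  let ?C = "link_cells K \<rho>"
  assume loop: "locally_geodesic_loop ?C l \<gamma>"
  \<comment> \<open>The vector from the barycenter of \<rho> to the vertex s. It is orthogonal to
    \<rho>, and only its direction matters.\<close>
  define e where "e v = (if v = s then 1 else if v \<in> \<rho> then - 1 / card \<rho> else (0::real))" for v
  have card: "0 < real (card \<rho>)" using \<rho> by (simp add: card_gt_0_iff)
  have fe: "finite {v. e v \<noteq> 0}"
    by (rule finite_subset[of _ "insert s \<rho>"]) (use \<rho> in \<open>auto simp: e_def split: if_splits\<close>)
  have ipe: "ip u e = (u s - sum u \<rho> / card \<rho>) / 2" for u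
  proof -
    have "ip u e = (\<Sum>v\<in>insert s \<rho>. u v * e v) / 2"
      by (rule ip_eq_sum) (use \<rho> in \<open>auto simp: e_def split: if_splits\<close>)
    also have "(\<Sum>v\<in>insert s \<rho>. u v * e v) = u s + (\<Sum>v\<in>\<rho>. u v * e v)"
      using \<rho> by (simp add: e_def)
    also have "(\<Sum>v\<in>\<rho>. u v * e v) = (\<Sum>v\<in>\<rho>. - (u v / card \<rho>))"
      using \<rho> by (intro sum.cong) (auto simp: e_def)
    finally show ?thesis by (simp add: sum_negf sum_divide_distrib)
  qed
  have pos: "0 < ip u e" if "\<tau> \<in> K" "\<rho> \<subseteq> \<tau>" "u \<in> metric_link \<rho> \<tau>" for u \<tau>
  proof -
    have fin: "finite \<tau>" using that K by blast
    have "sum u \<rho> < 0"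
      using sum_strict_mono[OF \<rho>(2,1) metric_link_const_neg(2)[OF fin that(2,3)]] by simp
    then have "sum u \<rho> / card \<rho> < 0" using card by (rule divide_neg_pos)
    moreover have "0 \<le> u s"
      using that(3) \<rho> unfolding metric_link_iff[OF fin that(2) \<rho>(1)] by (cases "s \<in> \<tau>") auto
    ultimately show ?thesis by (simp add: ipe)
  qed
  \<comment> \<open>Up to the positive factor given by the norm of e, this is the cosine of the
    distance from \<open>\<gamma> t\<close> to the direction of e; a farthest point is a minimum of
    f.\<close>
  define f where "f t = ip (\<gamma> t) e" for t
  have "continuous_on {0..l} f"
    unfolding f_def ipe
    by (intro continuous_intros continuous_on_subset[OF loop_coordinate_continuous[OF loop]]) (use card in auto)
  moreover have "{0..l} \<noteq> {}" using locally_geodesic_loopD(1)[OF loop] by auto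
  ultimately have "\<exists>t0\<in>{0..l}. \<forall>t\<in>{0..l}. f t0 \<le> f t"
    by (intro continuous_attains_inf) auto
  then obtain t0 where t0: "\<And>t. t \<in> {0..l} \<Longrightarrow> f t0 \<le> f t" by blast
  have min: "f t0 \<le> f t" for t
  proof -
    obtain r where "r \<in> {0..<l}" "\<gamma> r = \<gamma> t"
      using periodic_reduce[OF locally_geodesic_loopD(1,2)[OF loop]] by blast
    then show ?thesis using t0[of r] by (simp add: f_def)
  qed
  define x where "x = \<gamma> t0"
  \<comment> \<open>Along the branch, the product with e is cos r * \<open>ip x e\<close> + sin r *
    \<open>ip \<xi> e\<close>. The first term drops below its initial value since
    \<open>ip x e\<close> is positive, so at a minimum the second term must make up for the
    loss.\<close>
  have descent: "0 < ip \<xi> e"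
    if d: "departs_along ?C \<beta> t \<xi>" and "\<beta> t = x" and m: "\<And>t. f t0 \<le> ip (\<beta> t) e" for \<beta> t \<xi>
  proof -
    obtain \<tau> \<epsilon> where a: "\<tau> \<in> K" "\<rho> \<subseteq> \<tau>" "\<epsilon> > 0"
      "\<And>s. 0 \<le> s \<Longrightarrow> s \<le> \<epsilon> \<Longrightarrow> \<beta> (t + s) = great_arc x \<xi> s"
      "ip \<xi> \<xi> = 1" "ip x x = 1" "x \<in> metric_link \<rho> \<tau>"
      using d \<open>\<beta> t = x\<close> by (elim departs_along_cell) metis
    define r where "r = min \<epsilon> 1"
    have r: "0 < r" "r \<le> \<epsilon>" "r \<le> 1" using a(3) by (auto simp: r_def)
    have "f t0 \<le> cos r * ip x e + sin r * ip \<xi> e"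
      using m[of "t + r"] a(4)[of r] r ip_great_arc_left[OF a(6,5)] by simp
    moreover have "f t0 = ip x e" by (simp add: f_def x_def)
    moreover have "cos r < 1" using cos_monotone_0_pi[of 0 r] r pi_gt3 by simp
    moreover have "0 < ip x e" using pos[OF a(1,2,7)] .
    ultimately have "0 < sin r * ip \<xi> e"
      using mult_strict_right_mono[of "cos r" 1 "ip x e"] by linarith
    moreover have "0 < sin r" using r pi_gt3 by (intro sin_gt_zero) auto
    ultimately show ?thesis by (simp add: zero_less_mult_iff)
  qed
  obtain \<xi> \<eta> where d: "departs_along ?C \<gamma> t0 \<xi>" "departs_along ?C (\<lambda>s. \<gamma> (- s)) (- t0) \<eta>"
    and angle: "ereal pi \<le> angle_at ?C x \<xi> \<eta>"
    using locally_geodesic_loopD(4)[OF loop] unfolding x_def by blast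
  have \<xi>: "0 < ip \<xi> e" by (rule descent[OF d(1)]) (use min in \<open>auto simp: x_def f_def\<close>)
  have \<eta>: "0 < ip \<eta> e" by (rule descent[OF d(2)]) (use min in \<open>auto simp: x_def f_def\<close>)
  obtain \<tau>0 where \<tau>0: "\<tau>0 \<in> K" "\<rho> \<subseteq> \<tau>0" "x \<in> metric_link \<rho> \<tau>0" "ip x x = 1"
    using d(1) unfolding x_def by (elim departs_along_cell) metis
  have fx: "finite {v. x v \<noteq> 0}" using ip_unit_finite_support[OF \<tau>0(4)] .
  define a where "a = ip x e"
  have a: "0 < a" using pos[OF \<tau>0(1-3)] by (simp add: a_def)
  \<comment> \<open>The component of e orthogonal to x; its normalization \<zeta> is the direction
    from x towards e. The coefficients 1 here and 0 in \<zeta> bring both into the shape of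
    \<open>ip_lincomb\<close>.\<close>
  define g where "g v = 1 * e v + (- a) * x v" for v
  have fg: "finite {v. g v \<noteq> 0}"
    by (rule finite_subset[OF _ finite_UnI[OF fe fx]]) (auto simp: g_def)
  have ipg: "ip g u = ip u e - a * ip x u" for u
    unfolding g_def using ip_lincomb[OF fe fx, of 1 "-a" u] by (simp add: ip_commute)
  have unit_orth: "ip \<zeta> \<zeta> = 1 \<and> ip x \<zeta> = 0" if "departs_along ?C \<beta> t \<zeta>" "\<beta> t = x" for \<beta> t \<zeta>
    using that by (auto simp: departs_along_def)
  have \<xi>1: "ip \<xi> \<xi> = 1" "ip x \<xi> = 0" and \<eta>1: "ip \<eta> \<eta> = 1" "ip x \<eta> = 0"
    using unit_orth[OF d(1)] unit_orth[OF d(2)] by (auto simp: x_def)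
  have "g \<noteq> (\<lambda>_. 0)"
  proof
    assume "g = (\<lambda>_. 0)"
    then have "ip g \<xi> = 0" by (simp add: ip_def)
    then show False using \<xi> \<xi>1 by (simp add: ipg)
  qed
  then obtain b where "g b \<noteq> 0" by auto
  then have gg: "0 < ip g g" by (rule ip_pos[OF fg])
  define N where "N = sqrt (ip g g)"
  have N: "0 < N" "N * N = ip g g" using gg by (auto simp: N_def)
  define \<zeta> where "\<zeta> v = (1 / N) * g v + 0 * g v" for v
  have ip\<zeta>: "ip \<zeta> u = ip g u / N" for u
    unfolding \<zeta>_def using ip_lincomb[OF fg fg, of "1/N" 0 u] by simp
  have \<zeta>1: "ip \<zeta> \<zeta> = 1"
  proof -
    have "ip \<zeta> \<zeta> = ip \<zeta> g / N" using ip\<zeta>[of \<zeta>] by (simp only: ip_commute[of g \<zeta>])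
    also have "ip \<zeta> g = N" using ip\<zeta>[of g] N(1) by (simp add: N(2)[symmetric])
    finally show ?thesis using N by simp
  qed
  have x\<zeta>: "ip x \<zeta> = 0"
    using ip\<zeta>[of x] ipg[of x] \<tau>0 by (simp add: ip_commute[of x \<zeta>] a_def)
  have \<zeta>\<xi>: "0 < ip \<zeta> \<xi>" "0 < ip \<zeta> \<eta>"
    using ip\<zeta> ipg \<xi> \<eta> \<xi>1 \<eta>1 N by auto
  \<comment> \<open>Expanding \<zeta> writes the arc from x as a combination of x and e, and this is
    the coefficient of x. It has to stay nonnegative for the arc to remain in the cell.\<close>
  have "((\<lambda>r. cos r - sin r * (a / N)) \<longlongrightarrow> cos 0 - sin 0 * (a / N)) (at_right 0)"
    by (intro tendsto_intros)
  then have "\<forall>\<^sub>F r in at_right 0. 0 < cos r - sin r * (a / N)"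
    by (rule order_tendstoD) simp
  then obtain \<delta>' where \<delta>': "\<delta>' > 0" "\<forall>r>0. r < \<delta>' \<longrightarrow> 0 < cos r - sin r * (a / N)"
    unfolding eventually_at_right_field by auto
  define \<delta> where "\<delta> = min (\<delta>' / 2) 1"
  have \<delta>: "\<delta> > 0" "\<delta> \<le> 1" "\<delta> < \<delta>'" using \<delta>'(1) by (auto simp: \<delta>_def)
  have \<delta>cs: "0 \<le> cos r - sin r * (a / N)" if "0 \<le> r" "r \<le> \<delta>" for r
    using \<delta>'(2)[rule_format, of r] that \<delta> by (cases "r = 0") auto
  \<comment> \<open>Adding s to the simplex that carries a branch yields one cell containing both
    the branch and the start of the arc towards e. Hence \<zeta> shares a cell of the link of x with
    \<xi> and another with \<eta>, and \<xi>, \<zeta>, \<eta> is an admissible string.\<close>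
  have cell: "\<exists>c\<in>?C. x \<in> c \<and> \<theta> \<in> direction_cell c x \<and> \<zeta> \<in> direction_cell c x"
    if dep: "departs_along ?C \<beta> t \<theta>" and bx: "\<beta> t = x" for \<beta> t \<theta>
  proof -
    obtain \<tau> \<epsilon> where c: "\<tau> \<in> K" "\<rho> \<subseteq> \<tau>" "\<epsilon> > 0"
      "\<And>s. 0 \<le> s \<Longrightarrow> s \<le> \<epsilon> \<Longrightarrow> great_arc x \<theta> s \<in> metric_link \<rho> \<tau>" "ip \<theta> \<theta> = 1" "ip x \<theta> = 0"
      "x \<in> metric_link \<rho> \<tau>"
      using dep by (rule departs_along_cell) (metis bx)
    define \<tau>' where "\<tau>' = insert s \<tau>"
    have \<tau>': "\<tau>' \<in> K" "\<rho> \<subseteq> \<tau>'" "finite \<tau>'" "\<tau> \<subseteq> \<tau>'" using c star K by (auto simp: \<tau>'_def)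
    have mono: "metric_link \<rho> \<tau> \<subseteq> metric_link \<rho> \<tau>'" using metric_link_mono \<tau>' c \<rho> by blast
    then have xc: "x \<in> metric_link \<rho> \<tau>'" using c by blast
    note xc' = xc[unfolded metric_link_iff[OF \<tau>'(3,2) \<rho>(1)]]
    have "sum e \<tau>' = sum e (insert s \<rho>)"
      using \<tau>' by (intro sum.mono_neutral_right) (auto simp: e_def \<tau>'_def)
    also have "\<dots> = 1 + (\<Sum>v\<in>\<rho>. - 1 / card \<rho>)"
    proof -
      have "sum e \<rho> = (\<Sum>v\<in>\<rho>. - 1 / card \<rho>)"
        using \<rho> by (intro sum.cong) (auto simp: e_def)
      then show ?thesis using \<rho> by (simp add: e_def)
    qed
    also have "\<dots> = 0" using card by simp
    finally have sume: "sum e \<tau>' = 0" .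
    have arc: "great_arc x \<zeta> r \<in> metric_link \<rho> \<tau>'" if r: "0 \<le> r" "r \<le> \<delta>" for r
    proof -
      define A where "A = cos r - sin r * (a / N)"
      define B where "B = sin r / N"
      have A: "0 \<le> A" using \<delta>cs r by (simp add: A_def)
      have "0 \<le> sin r" using r \<delta> pi_gt3 by (intro sin_ge_zero) auto
      then have B: "0 \<le> B" using N by (simp add: B_def)
      have eq: "great_arc x \<zeta> r v = A * x v + B * e v" for v
        using N by (simp add: great_arc_def A_def B_def \<zeta>_def g_def field_simps)
      have "ip (great_arc x \<zeta> r) (great_arc x \<zeta> r) = 1"
        using ip_great_arc[OF \<tau>0(4) \<zeta>1 x\<zeta>, of r r] by simp
      moreover have "great_arc x \<zeta> r p = great_arc x \<zeta> r q" if "p \<in> \<rho>" "q \<in> \<rho>" for p q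
      proof -
        have "x p = x q" using xc' that by blast
        then show ?thesis using that \<rho> by (auto simp: eq e_def)
      qed
      moreover have "great_arc x \<zeta> r v = 0" if "v \<notin> \<tau>'" for v
        using xc' that \<tau>' by (auto simp: eq e_def \<tau>'_def)
      moreover have "sum (great_arc x \<zeta> r) \<tau>' = 0"
        using xc' sume by (simp add: eq sum.distrib sum_distrib_left[symmetric])
      moreover have "0 \<le> great_arc x \<zeta> r v" if "v \<in> \<tau>' - \<rho>" for v
        using xc' that A B by (auto simp: eq e_def)
      ultimately show ?thesis unfolding metric_link_iff[OF \<tau>'(3,2) \<rho>(1)] by blast
    qed
    show ?thesis
    proof (intro bexI[of _ "metric_link \<rho> \<tau>'"] conjI)
      show "metric_link \<rho> \<tau>' \<in> ?C" using \<tau>' by (auto simp: link_cells_def)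
      show "\<theta> \<in> direction_cell (metric_link \<rho> \<tau>') x"
        using c mono unfolding direction_cell_def by force
      show "\<zeta> \<in> direction_cell (metric_link \<rho> \<tau>') x"
        using \<zeta>1 x\<zeta> arc \<delta>(1) unfolding direction_cell_def by force
    qed (rule xc)
  qed
  have "angle_at ?C x \<xi> \<eta> \<le> ereal (string_length [\<xi>, \<zeta>, \<eta>])"
    unfolding angle_at_def intrinsic_dist_def
  proof (rule INF_lower, intro CollectI conjI)
    show "successively (\<lambda>a b. \<exists>c\<in>point_link_cells ?C x. a \<in> c \<and> b \<in> c) [\<xi>, \<zeta>, \<eta>]"
      using cell[OF d(1)] cell[OF d(2)] by (auto simp: x_def point_link_cells_def)
  qed auto
  also have "string_length [\<xi>, \<zeta>, \<eta>] = arccos (ip \<zeta> \<xi>) + arccos (ip \<zeta> \<eta>)"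
    by (simp add: string_length_def ip_commute[of \<xi>] numeral_2_eq_2)
  also have "\<dots> < pi"
  proof -
    have "arccos (ip \<zeta> u) < pi / 2" if "0 < ip \<zeta> u" "ip u u = 1" for u
      using arccos_less_arccos[of 0 "ip \<zeta> u"] ip_le_1[OF \<zeta>1 that(2)] that by simp
    from this[OF \<zeta>\<xi>(1) \<xi>1(1)] this[OF \<zeta>\<xi>(2) \<eta>1(1)] show ?thesis by linarith
  qed
  finally show False using angle by auto
qed

text \<open>The linear conditions leave the multiples of one vector, called w in the proof and
  normalized to 1 at x. The unit norm and the sign at x then determine the multiple.\<close>

lemma metric_link_one_vertex:
  assumes "finite \<tau>" "\<rho> \<subseteq> \<tau>" "\<rho> \<noteq> {}" "\<tau> \<subseteq> insert x \<rho>"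
  shows "\<exists>u. metric_link \<rho> \<tau> \<subseteq> {u}"
proof -
  have "u = u'" if u: "u \<in> metric_link \<rho> \<tau>" and u': "u' \<in> metric_link \<rho> \<tau>" for u u'
  proof -
    obtain a where a: "a \<in> \<rho>" using assms by blast
    have "\<tau> \<noteq> \<rho>"
      using metric_link_const_neg[OF assms(1,2) u a] by auto
    then have x: "\<tau> - \<rho> = {x}" using assms by blast
    define w where "w y = (if y \<in> \<rho> then - 1 / card \<rho> else if y = x then 1 else (0::real))" for y
    have *: "z = (\<lambda>y. z x * w y) \<and> 0 \<le> z x \<and> (z x)\<^sup>2 * (\<Sum>y\<in>\<tau>. w y * w y) = 2"
      if z: "z \<in> metric_link \<rho> \<tau>" for z
    proof -
      note zz = z[unfolded metric_link_iff[OF assms(1-3)]]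
      have eq: "z y = z x * w y" for y
      proof (cases "y \<in> \<rho>")
        case True
        then show ?thesis using metric_link_const_neg(1)[OF assms(1,2) z True] x by (simp add: w_def)
      next
        case False
        then show ?thesis using zz x by (cases "y = x") (auto simp: w_def)
      qed
      have "ip z z = (\<Sum>y\<in>\<tau>. z y * z y) / 2"
        by (rule ip_eq_sum[OF assms(1)]) (use zz in blast)
      also have "(\<Sum>y\<in>\<tau>. z y * z y) = (\<Sum>y\<in>\<tau>. (z x)\<^sup>2 * (w y * w y))"
        by (intro sum.cong refl) (subst (1 2) eq, simp add: power2_eq_square)
      finally have "(z x)\<^sup>2 * (\<Sum>y\<in>\<tau>. w y * w y) = 2"
        using zz by (simp add: sum_distrib_left)
      moreover have "0 \<le> z x" using zz x by blast
      ultimately show ?thesis using eq by blast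
    qed
    have "(u x)\<^sup>2 * (\<Sum>y\<in>\<tau>. w y * w y) = (u' x)\<^sup>2 * (\<Sum>y\<in>\<tau>. w y * w y)"
      using *[OF u] *[OF u'] by simp
    moreover have "(\<Sum>y\<in>\<tau>. w y * w y) \<noteq> 0" using *[OF u] by auto
    ultimately have "(u x)\<^sup>2 = (u' x)\<^sup>2" by simp
    then have "u x = u' x" using *[OF u] *[OF u'] by (simp add: power2_eq_iff_nonneg)
    then show ?thesis using *[OF u] *[OF u'] by metis
  qed
  then show ?thesis by blast
qed

lemma string_length_Cons:
  "string_length (x # y # zs) = arccos (ip x y) + string_length (y # zs)"
proof -
  have "{..<Suc (length zs)} = insert 0 (Suc ` {..<length zs})"
    by (simp add: lessThan_Suc_eq_insert_0)
  then show ?thesis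
    by (simp add: string_length_def sum.reindex del: lessThan_Suc sum.lessThan_Suc)
qed

text \<open>Somewhere the string must change from \<xi> to \<eta>, and this step costs arccos (-1) =
  pi, while no step has negative length. This bounds angles in a link that consists of two
  directions.\<close>

lemma string_length_two_points:
  assumes P: "\<And>a b. P a b \<Longrightarrow> a \<in> {\<xi>, \<eta>} \<and> b \<in> {\<xi>, \<eta>} \<and> (a \<noteq> b \<longrightarrow> ip a b = - 1)"
    and unit: "ip \<xi> \<xi> = 1" "ip \<eta> \<eta> = 1"
    and xs: "xs \<noteq> []" "hd xs = \<xi>" "last xs = \<eta>" "successively P xs" and ne: "\<xi> \<noteq> \<eta>"
  shows "pi \<le> string_length xs"
proof -
  have step: "P a b \<Longrightarrow> 0 \<le> arccos (ip a b)" for a b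
    using P[of a b] unit by (cases "a = b") auto
  have nonneg: "successively P xs \<Longrightarrow> 0 \<le> string_length xs" for xs
  proof (induction xs rule: induct_list012)
    case (3 x y zs)
    then show ?case using step by (simp add: string_length_Cons)
  qed (auto simp: string_length_def)
  show ?thesis
    using xs
  proof (induction xs rule: induct_list012)
    case (3 x y zs)
    then have xy: "P x y" "x = \<xi>" "successively P (y # zs)" by auto
    show ?case
    proof (cases "y = \<xi>")
      case True
      then have "pi \<le> string_length (y # zs)" using 3 by auto
      then show ?thesis using step[OF xy(1)] by (simp add: string_length_Cons)
    next
      case False
      then have "arccos (ip x y) = pi" using P[OF xy(1)] xy by auto
      then show ?thesis using nonneg[OF xy(3)] by (simp add: string_length_Cons)
    qed
  qed (use ne in auto)
qed

subsection \<open>The join of a simplex and a pentagon\<close>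

text \<open>The cardinality of S is left free so that every result applies both to the given join
  and, with \<open>{w}\<close> for S, to a cone disk.\<close>

locale pentagon_join =
  fixes S :: "'v set" and v :: "nat \<Rightarrow> 'v"
  assumes finite_S: "finite S" and S_nonempty: "S \<noteq> {}"
    and inj_v: "inj_on v {..<5}" and v5: "v 5 = v 0" and disjoint: "S \<inter> v ` {..<5} = {}"
begin

text \<open>Integer indices number the edges along the line that covers the circle, so that
  \<open>\<lfloor>r / \<theta>\<rfloor>\<close> can serve as an index without wrapping
  around.\<close>

definition vx :: "int \<Rightarrow> 'v" where "vx i = v (nat (i mod 5))"

definition facet :: "int \<Rightarrow> 'v set" where "facet i = S \<union> {vx i, vx (i + 1)}"

definition J :: "'v set set" where "J = generated_complex (range facet)"

definition m :: real where "m = card S"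

definition \<theta> :: real where "\<theta> = arccos (1 / (m + 1))"

text \<open>Chosen so that A * sin \<theta> is the coordinate at \<open>vx i\<close> of the unit
  link vector pointing from S to \<open>vx i\<close>.\<close>

definition A :: real where "A = sqrt (2 * m / (m + 1)) / sin \<theta>"

text \<open>The value on S is the one forced by constancy on S and coordinate sum 0, so x and y are
  linear coordinates on the plane spanned by the i-th edge of the link.\<close>

definition arc :: "int \<Rightarrow> real \<Rightarrow> real \<Rightarrow> 'v \<Rightarrow> real" where
  "arc i x y u = (if u \<in> S then - (x + y) / m else if u = vx i then x
     else if u = vx (i + 1) then y else 0)"

text \<open>The great circle through the \<open>i\<close>-th edge of the link of \<open>S\<close>; the edge itself is the part
  of the circle with parameters in \<open>{i * \<theta>..i * \<theta> + \<theta>}\<close>.\<close>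

definition gc :: "int \<Rightarrow> real \<Rightarrow> 'v \<Rightarrow> real" where
  "gc i r = arc i (A * sin (\<theta> - (r - i * \<theta>))) (A * sin (r - i * \<theta>))"

text \<open>The unit-speed covering of the link of S by the line, with period 5 * \<theta>.\<close>

definition c :: "real \<Rightarrow> 'v \<Rightarrow> real" where "c r = gc \<lfloor>r / \<theta>\<rfloor> r"

lemma vx_eq_iff: "vx i = vx j \<longleftrightarrow> i mod 5 = j mod 5"
proof -
  have "nat (i mod 5) \<in> {..<5}" "nat (j mod 5) \<in> {..<5}" by auto
  then have "vx i = vx j \<longleftrightarrow> nat (i mod 5) = nat (j mod 5)"
    using inj_v by (auto simp: vx_def inj_on_def)
  then show ?thesis by (simp add: eq_nat_nat_iff)
qed

lemma vx_distinct [simp]: "vx i \<noteq> vx (i + 1)" "vx (i + 1) \<noteq> vx i"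
  by (simp_all add: vx_eq_iff) presburger+

lemma vx_notin [simp]: "vx i \<notin> S"
proof -
  have "nat (i mod 5) \<in> {..<5}" by auto
  then show ?thesis using disjoint by (auto simp: vx_def)
qed

lemma vx_v: "i \<le> 5 \<Longrightarrow> vx (int i) = v i"
  using v5 by (cases "i = 5") (auto simp: vx_def)

lemma m_pos: "0 < m"
  using finite_S S_nonempty by (simp add: m_def card_gt_0_iff)

lemma cos_theta: "cos \<theta> = 1 / (m + 1)"
  using m_pos by (simp add: \<theta>_def cos_arccos_abs)

lemma theta_bounds: "0 < \<theta>" "\<theta> < pi / 2" "0 < sin \<theta>"
proof -
  have "-1 \<le> 1 / (m + 1)" by (rule order_trans[of _ 0]) (use m_pos in auto)
  then show "0 < \<theta>" using arccos_less_arccos[of "1 / (m + 1)" 1] m_pos by (simp add: \<theta>_def)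
  moreover show "\<theta> < pi / 2" using arccos_less_arccos[of 0 "1 / (m + 1)"] m_pos by (simp add: \<theta>_def)
  ultimately show "0 < sin \<theta>" by (intro sin_gt_zero) auto
qed

lemma A_pos: "0 < A" and A_sq: "A * A * (sin \<theta>)\<^sup>2 = 2 * m / (m + 1)"
  using m_pos theta_bounds by (auto simp: A_def power2_eq_square)

lemma finite_facet: "finite (facet i)"
  using finite_S by (simp add: facet_def)

section \<open>The link of \<open>S\<close> as a circle of length 5 * \<theta>\<close>

lemma ip_arc: "ip (arc i x y) (arc i x' y') = ((x + y) * (x' + y') / m + x * x' + y * y') / 2"
proof -
  have "ip (arc i x y) (arc i x' y') = (\<Sum>u\<in>S \<union> {vx i, vx (i + 1)}. arc i x y u * arc i x' y' u) / 2"
    by (rule ip_eq_sum) (use finite_S in \<open>auto simp: arc_def\<close>)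
  also have "(\<Sum>u\<in>S \<union> {vx i, vx (i + 1)}. arc i x y u * arc i x' y' u)
    = (\<Sum>u\<in>S. arc i x y u * arc i x' y' u) + (\<Sum>u\<in>{vx i, vx (i + 1)}. arc i x y u * arc i x' y' u)"
    using finite_S by (intro sum.union_disjoint) auto
  also have "(\<Sum>u\<in>S. arc i x y u * arc i x' y' u) = (\<Sum>u\<in>S. ((x + y) * (x' + y')) / (m * m))"
    by (intro sum.cong) (auto simp: arc_def field_simps)
  also have "\<dots> = (x + y) * (x' + y') / m"
    using m_pos by (simp add: m_def)
  also have "(\<Sum>u\<in>{vx i, vx (i + 1)}. arc i x y u * arc i x' y' u) = x * x' + y * y'"
    by (simp add: arc_def)
  finally show ?thesis by simp
qed

text \<open>With k = cos \<theta> one has 1 / m = k / (1 - k), and \<open>ip_arc\<close> becomes a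
  multiple of x * x' + y * y' + k * (x * y' + x' * y), the Gram form of two unit vectors at angle
  \<theta>. In the basis of two such vectors, the point at angle q from the first has coordinates
  proportional to sin (\<theta> - q) and sin q.\<close>

lemma ip_gc: "ip (gc i r) (gc i r') = cos (r - r')"
proof -
  define q q' where "q = r - i * \<theta>" and "q' = r' - i * \<theta>"
  define sq cq sq' cq' s k where "sq = sin q" and "cq = cos q" and "sq' = sin q'" and "cq' = cos q'"
    and "s = sin \<theta>" and "k = cos \<theta>"
  have sk: "s\<^sup>2 + k\<^sup>2 = 1" by (simp add: s_def k_def)
  have k: "k = 1 / (m + 1)" using cos_theta by (simp add: k_def)
  define X X' where "X = s * cq - k * sq" and "X' = s * cq' - k * sq'"
  have gc: "gc i r = arc i (A * X) (A * sq)" "gc i r' = arc i (A * X') (A * sq')"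
    by (simp_all add: gc_def q_def[symmetric] q'_def[symmetric] X_def X'_def sin_diff s_def k_def
        sq_def cq_def sq'_def cq'_def)
  have mm: "1 / m = k / (1 - k)" "1 - k \<noteq> 0" "1 - k = m / (m + 1)" using m_pos by (auto simp: k field_simps)
  have A2: "A * A * s\<^sup>2 = 2 * (1 - k)" using A_sq mm by (simp add: s_def)
  have id: "X * X' + sq * sq' + k * (X * sq' + X' * sq) = s\<^sup>2 * (cq * cq' + sq * sq')"
  proof -
    have "X * X' + sq * sq' + k * (X * sq' + X' * sq) =
      s\<^sup>2 * (cq * cq') + (1 - k\<^sup>2) * (sq * sq')"
      by (simp add: X_def X'_def algebra_simps power2_eq_square)
    also have "1 - k\<^sup>2 = s\<^sup>2" using sk by simp
    finally show ?thesis by (simp add: algebra_simps)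
  qed
  have "ip (gc i r) (gc i r') = A * A * ((X + sq) * (X' + sq') * (1 / m) + X * X' + sq * sq') / 2"
    by (simp add: gc ip_arc algebra_simps add_divide_distrib)
  also have "(X + sq) * (X' + sq') * (1 / m) + X * X' + sq * sq'
     = (X * X' + sq * sq' + k * (X * sq' + X' * sq)) / (1 - k)"
    unfolding mm(1) using mm(2) by (simp add: divide_simps) (simp add: algebra_simps)
  also have "A * A * (\<dots>) / 2 = (A * A * s\<^sup>2) * (cq * cq' + sq * sq') / (1 - k) / 2"
    unfolding id by simp
  also have "\<dots> = cq * cq' + sq * sq'" unfolding A2 using mm(2) by (simp add: field_simps)
  also have "\<dots> = cos (q - q')" by (simp add: cos_diff cq_def cq'_def sq_def sq'_def)
  finally show ?thesis by (simp add: q_def q'_def)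
qed

text \<open>The unit tangent to a great circle is the point a quarter turn further on, so both
  directions at a point of the circle are again values of \<open>gc\<close>.\<close>

lemma great_arc_gc:
  "great_arc (gc i t) (gc i (t + pi / 2)) s = gc i (t + s)"
  "great_arc (gc i t) (gc i (t - pi / 2)) s = gc i (t - s)"
proof -
  have lin: "cos s * arc i x y u + sin s * arc i x' y' u
    = arc i (cos s * x + sin s * x') (cos s * y + sin s * y') u" for x y x' y' u
    using m_pos by (auto simp: arc_def field_simps)
  have 1: "gc i (t + pi / 2) = arc i (A * - cos (\<theta> - (t - i * \<theta>))) (A * cos (t - i * \<theta>))"
    "gc i (t - pi / 2) = arc i (A * cos (\<theta> - (t - i * \<theta>))) (A * - cos (t - i * \<theta>))"
  proof -
    have "sin (\<theta> - (t + pi / 2 - i * \<theta>)) = - cos (\<theta> - (t - i * \<theta>))"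
      using sin_diff[of "\<theta> - (t - i * \<theta>)" "pi / 2"] by (simp add: algebra_simps)
    moreover have "sin (t + pi / 2 - i * \<theta>) = cos (t - i * \<theta>)"
      using sin_add[of "t - i * \<theta>" "pi / 2"] by (simp add: algebra_simps)
    moreover have "sin (\<theta> - (t - pi / 2 - i * \<theta>)) = cos (\<theta> - (t - i * \<theta>))"
      using sin_add[of "\<theta> - (t - i * \<theta>)" "pi / 2"] by (simp add: algebra_simps)
    moreover have "sin (t - pi / 2 - i * \<theta>) = - cos (t - i * \<theta>)"
      using sin_diff[of "t - i * \<theta>" "pi / 2"] by (simp add: algebra_simps)
    ultimately show "gc i (t + pi / 2) = arc i (A * - cos (\<theta> - (t - i * \<theta>))) (A * cos (t - i * \<theta>))"
      "gc i (t - pi / 2) = arc i (A * cos (\<theta> - (t - i * \<theta>))) (A * - cos (t - i * \<theta>))"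
      by (simp_all only: gc_def)
  qed
  define q where "q = t - i * \<theta>"
  have 2: "gc i (t + s) = arc i (A * sin (\<theta> - q - s)) (A * sin (q + s))"
    "gc i (t - s) = arc i (A * sin (\<theta> - q + s)) (A * sin (q - s))"
    by (simp_all add: gc_def q_def algebra_simps)
  have 3: "gc i t = arc i (A * sin (\<theta> - q)) (A * sin q)" by (simp add: gc_def q_def)
  show "great_arc (gc i t) (gc i (t + pi / 2)) s = gc i (t + s)"
    unfolding great_arc_def 1 3 q_def[symmetric] lin 2
    by (rule ext, intro arg_cong2[where f = "\<lambda>x y. arc i x y _"])
      (simp_all only: sin_add sin_diff[of "\<theta> - q" s], simp_all add: algebra_simps)
  show "great_arc (gc i t) (gc i (t - pi / 2)) s = gc i (t - s)"
    unfolding great_arc_def 1 3 q_def[symmetric] lin 2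
    by (rule ext, intro arg_cong2[where f = "\<lambda>x y. arc i x y _"])
      (simp_all only: sin_diff[of q s] sin_add[of "\<theta> - q" s], simp_all add: algebra_simps)
qed

lemma floor_theta: "\<lfloor>r / \<theta>\<rfloor> * \<theta> \<le> r" "r < \<lfloor>r / \<theta>\<rfloor> * \<theta> + \<theta>"
proof -
  have "of_int \<lfloor>r / \<theta>\<rfloor> \<le> r / \<theta>" "r / \<theta> < of_int \<lfloor>r / \<theta>\<rfloor> + 1" by linarith+
  then show "\<lfloor>r / \<theta>\<rfloor> * \<theta> \<le> r" "r < \<lfloor>r / \<theta>\<rfloor> * \<theta> + \<theta>"
    using theta_bounds(1)
    by (simp_all only: pos_le_divide_eq pos_divide_less_eq distrib_right mult_1)
qed

lemma floor_eqI:
  fixes i :: int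
  assumes "i * \<theta> \<le> r" "r < i * \<theta> + \<theta>"
  shows "\<lfloor>r / \<theta>\<rfloor> = i"
  using assms theta_bounds(1)
  by (intro floor_unique) (simp_all add: pos_le_divide_eq pos_divide_less_eq distrib_right)

text \<open>At the right end the floor jumps to i + 1, but both formulas give the link vector
  pointing to \<open>vx (i + 1)\<close>. Hence the formula of an edge is valid on the closed
  edge.\<close>

lemma c_eq_gc:
  fixes i :: int
  assumes "i * \<theta> \<le> r" "r \<le> i * \<theta> + \<theta>"
  shows "c r = gc i r"
proof (cases "r = i * \<theta> + \<theta>")
  case True
  then have "\<lfloor>r / \<theta>\<rfloor> = i + 1" using theta_bounds by (intro floor_eqI) (auto simp: algebra_simps)
  then have "c r = arc (i + 1) (A * sin \<theta>) 0"
    using True by (simp add: c_def gc_def algebra_simps)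
  moreover have "gc i r = arc i 0 (A * sin \<theta>)"
    using True by (simp add: gc_def algebra_simps)
  moreover have "arc (i + 1) x 0 = arc i 0 x" for x by (auto simp: arc_def)
  ultimately show ?thesis by simp
next
  case False
  then show ?thesis using assms floor_eqI by (simp add: c_def)
qed

lemma ip_c:
  fixes i :: int
  assumes "i * \<theta> \<le> r" "r \<le> i * \<theta> + \<theta>" "i * \<theta> \<le> r'" "r' \<le> i * \<theta> + \<theta>"
  shows "ip (c r) (c r') = cos (r - r')"
  using c_eq_gc[of i r] c_eq_gc[of i r'] assms ip_gc by simp

lemma c_unit: "ip (c r) (c r) = 1"
  by (simp add: c_def ip_gc)

lemma c_period: "c (r + 5 * \<theta> * of_int k) = c r"
proof -
  have "(r + 5 * \<theta> * of_int k) / \<theta> = r / \<theta> + of_int (5 * k)"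
    using theta_bounds by (simp add: field_simps)
  then have fl: "\<lfloor>(r + 5 * \<theta> * of_int k) / \<theta>\<rfloor> = \<lfloor>r / \<theta>\<rfloor> + 5 * k" by linarith
  have "vx (i + 5 * k) = vx i" "vx (i + 5 * k + 1) = vx (i + 1)" for i
    by (simp_all add: vx_eq_iff) presburger
  then have "arc (i + 5 * k) x y = arc i x y" for i x y by (simp add: arc_def fun_eq_iff)
  then show ?thesis unfolding c_def fl by (simp add: gc_def algebra_simps)
qed

text \<open>The first vertex of the half-open edge containing a parameter has a nonzero coordinate.
  Equal points therefore have first vertices lying in each other's edges, and unless the edges
  agree, 5 would divide 2. On one edge the coordinate at the second vertex, a multiple of sin q,
  determines q.\<close>

lemma c_inj:
  assumes "c r = c r'"
  shows "\<exists>k::int. r' = r + 5 * \<theta> * of_int k"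
proof -
  define i i' where "i = \<lfloor>r / \<theta>\<rfloor>" and "i' = \<lfloor>r' / \<theta>\<rfloor>"
  define q q' where "q = r - i * \<theta>" and "q' = r' - i' * \<theta>"
  have q: "0 \<le> q" "q < \<theta>" "0 \<le> q'" "q' < \<theta>"
    using floor_theta[of r] floor_theta[of r'] by (auto simp: q_def q'_def i_def i'_def algebra_simps)
  have cr: "c r = arc i (A * sin (\<theta> - q)) (A * sin q)" "c r' = arc i' (A * sin (\<theta> - q')) (A * sin q')"
    by (simp_all add: c_def gc_def i_def[symmetric] i'_def[symmetric] q_def q'_def algebra_simps)
  have "0 < sin (\<theta> - q)" "0 < sin (\<theta> - q')"
    using q theta_bounds by (auto intro!: sin_gt_zero)
  then have pos: "c r (vx i) \<noteq> 0" "c r' (vx i') \<noteq> 0" using A_pos by (simp_all add: cr arc_def)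
  have "vx i \<in> {vx i', vx (i' + 1)}" using pos(1) unfolding assms by (auto simp: cr arc_def split: if_splits)
  moreover have "vx i' \<in> {vx i, vx (i + 1)}" using pos(2) unfolding assms[symmetric] by (auto simp: cr arc_def split: if_splits)
  moreover have False if "i mod 5 = (i' + 1) mod 5" "i' mod 5 = (i + 1) mod 5"
  proof -
    have "5 dvd (i - (i' + 1)) + (i' - (i + 1))"
      using that by (intro dvd_add) (simp_all only: mod_eq_dvd_iff)
    then show False by simp
  qed
  ultimately have ii: "i mod 5 = i' mod 5" by (auto simp: vx_eq_iff)
  then have "vx (i + 1) = vx (i' + 1)" by (simp add: vx_eq_iff mod_add_cong)
  moreover have "c r (vx (i + 1)) = A * sin q" "c r' (vx (i' + 1)) = A * sin q'" by (simp_all add: cr arc_def)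
  ultimately have "sin q = sin q'" using assms A_pos by simp
  then have "q = q'" using q theta_bounds sin_inj_pi[of q q'] by auto
  moreover obtain k where "i' = i + 5 * k"
    using ii by (metis mod_eqE add.commute mult.commute)
  ultimately show ?thesis
    by (intro exI[of _ k]) (simp add: q_def q'_def algebra_simps)
qed

text \<open>To see that every link vector is on the edge, the parameter q is read off from the
  second coordinate. For a given Y the norm equation is quadratic in X and, as k is positive, has at
  most one nonnegative root; sin (\<theta> - q) is one.\<close>

lemma metric_link_facet: "metric_link S (facet i) = c ` {i * \<theta>..i * \<theta> + \<theta>}"
proof (intro set_eqI iffI)
  have sub: "S \<subseteq> facet i" by (auto simp: facet_def)
  have fs: "facet i - S = {vx i, vx (i + 1)}" by (auto simp: facet_def)
  have sum: "sum f (facet i) = sum f S + (f (vx i) + f (vx (i + 1)))" for f :: "'v \<Rightarrow> real"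
    using sum.subset_diff[OF sub finite_facet, of f] by (simp add: fs)
  note iff = metric_link_iff[OF finite_facet sub S_nonempty]
  {
    fix u assume "u \<in> c ` {i * \<theta>..i * \<theta> + \<theta>}"
    then obtain r where r: "i * \<theta> \<le> r" "r \<le> i * \<theta> + \<theta>" "u = c r" by auto
    define x y where "x = A * sin (\<theta> - (r - i * \<theta>))" and "y = A * sin (r - i * \<theta>)"
    have u: "u = arc i x y" using c_eq_gc[OF r(1,2)] r(3) by (simp add: gc_def x_def y_def)
    have "0 \<le> sin (\<theta> - (r - i * \<theta>))" "0 \<le> sin (r - i * \<theta>)"
      using r theta_bounds by (auto intro!: sin_ge_zero simp: algebra_simps)
    then have xy: "0 \<le> x" "0 \<le> y" using A_pos by (simp_all add: x_def y_def)
    have "sum u S = (\<Sum>a\<in>S. - (x + y) / m)" by (intro sum.cong) (auto simp: u arc_def)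
    also have "\<dots> = - (x + y)" using m_pos by (simp add: m_def)
    finally have "sum u (facet i) = 0" by (simp add: sum u arc_def)
    then show "u \<in> metric_link S (facet i)"
      unfolding iff using c_unit[of r, folded r(3)] xy
      by (intro conjI) (auto simp: u arc_def facet_def)
  }
  fix u assume u: "u \<in> metric_link S (facet i)"
  note uu = u[unfolded iff]
  define x y where "x = u (vx i)" and "y = u (vx (i + 1))"
  have xy: "0 \<le> x" "0 \<le> y" using uu fs by (auto simp: x_def y_def)
  have u_arc: "u = arc i x y"
  proof
    fix a
    show "u a = arc i x y a"
    proof (cases "a \<in> S")
      case True
      then show ?thesis
        using metric_link_const_neg(1)[OF finite_facet sub u True] by (simp add: fs arc_def x_def y_def m_def)
    next
      case False
      then show ?thesis using uu by (auto simp: arc_def x_def y_def facet_def)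
    qed
  qed
  define X Y where "X = x / A" and "Y = y / A"
  have XY: "0 \<le> X" "0 \<le> Y" using xy A_pos by (auto simp: X_def Y_def)
  have xA: "x = A * X" "y = A * Y" using A_pos by (auto simp: X_def Y_def)
  define k where "k = cos \<theta>"
  have k: "0 < k" "k = 1 / (m + 1)" using cos_theta m_pos by (auto simp: k_def)
  have eq: "X\<^sup>2 + Y\<^sup>2 + 2 * k * X * Y = (sin \<theta>)\<^sup>2"
  proof -
    have "((x + y) * (x + y) / m + x * x + y * y) / 2 = 1"
      using uu ip_arc[of i x y x y] by (simp add: u_arc)
    then have "(x + y) * (x + y) + m * x * x + m * y * y = 2 * m"
      using m_pos by (simp add: field_simps)
    then have "(m + 1) * (x\<^sup>2 + y\<^sup>2 + 2 * k * x * y) = 2 * m"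
      using m_pos by (simp add: k(2) field_simps power2_eq_square)
    then have "x\<^sup>2 + y\<^sup>2 + 2 * k * x * y = 2 * m / (m + 1)"
      using m_pos by (subst eq_divide_eq) (auto simp: mult.commute)
    then have "x\<^sup>2 + y\<^sup>2 + 2 * k * x * y = A * A * (sin \<theta>)\<^sup>2"
      using A_sq by simp
    then have "(A * A) * (X\<^sup>2 + Y\<^sup>2 + 2 * k * X * Y) = (A * A) * (sin \<theta>)\<^sup>2"
      by (simp add: xA power2_eq_square algebra_simps)
    then show ?thesis using A_pos by simp
  qed
  have "0 \<le> 2 * k * X * Y" using XY k by simp
  \<comment> \<open>This is what places q before the end of the edge, so that sin (\<theta> - q) is
    nonnegative as well.\<close>
  then have "Y\<^sup>2 \<le> (sin \<theta>)\<^sup>2" using eq zero_le_power2[of X] by linarith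
  then have Y: "Y \<le> sin \<theta>" using theta_bounds by (simp add: power2_le_iff_abs_le)
  define q where "q = arcsin Y"
  have Y1: "Y \<le> 1" using Y sin_le_one[of \<theta>] by linarith
  have sq: "sin q = Y" using XY Y1 by (simp add: q_def)
  have "q \<le> arcsin (sin \<theta>)" unfolding q_def using XY Y Y1 by (intro arcsin_le_arcsin) auto
  then have q\<theta>: "q \<le> \<theta>" using theta_bounds by (simp add: arcsin_sin)
  have q0: "0 \<le> q" using arcsin_le_arcsin[of 0 Y] XY Y1 by (simp add: q_def)
  define X' where "X' = sin (\<theta> - q)"
  have X'0: "0 \<le> X'" unfolding X'_def using q0 q\<theta> theta_bounds by (intro sin_ge_zero) auto
  have eq': "X'\<^sup>2 + Y\<^sup>2 + 2 * k * X' * Y = (sin \<theta>)\<^sup>2"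
  proof -
    define s cq where "s = sin \<theta>" and "cq = cos q"
    have X': "X' = s * cq - k * Y" by (simp add: X'_def sin_diff sq s_def cq_def k_def)
    have "s\<^sup>2 + k\<^sup>2 = 1" by (simp add: s_def k_def)
    moreover have "cq\<^sup>2 + Y\<^sup>2 = 1" using sq by (metis cq_def sin_cos_squared_add2)
    moreover have "X'\<^sup>2 + Y\<^sup>2 + 2 * k * X' * Y = s\<^sup>2 * cq\<^sup>2 + (1 - k\<^sup>2) * Y\<^sup>2"
      by (simp add: X' power2_eq_square algebra_simps)
    ultimately show ?thesis
      by (metis (no_types, lifting) add_diff_cancel_right' distrib_left mult.right_neutral s_def)
  qed
  have "X = X'"
  proof -
    have "(X - X') * (X + X' + 2 * k * Y) = 0"
      using eq eq' by (simp add: power2_eq_square algebra_simps)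
    moreover have "X = X'" if "X + X' + 2 * k * Y = 0"
    proof -
      have "0 \<le> 2 * k * Y" using XY k by simp
      then show ?thesis using that XY X'0 by linarith
    qed
    ultimately show ?thesis by auto
  qed
  then have "u = gc i (i * \<theta> + q)"
    by (simp add: u_arc gc_def xA X'_def sq algebra_simps)
  also have "\<dots> = c (i * \<theta> + q)"
    using q0 q\<theta> by (intro c_eq_gc[symmetric]) (auto simp: algebra_simps)
  finally show "u \<in> c ` {i * \<theta>..i * \<theta> + \<theta>}"
    using q0 q\<theta> by (auto simp: algebra_simps)
qed

section \<open>Locally geodesic loops in the link of \<open>S\<close>\<close>

lemma facet_in_J: "facet i \<in> J"
  using S_nonempty by (auto simp: J_def generated_complex_def facet_def)

lemma S_sub_facet: "S \<subseteq> facet i"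
  by (auto simp: facet_def)

lemma link_cell_sub_facet:
  assumes "k \<in> link_cells J S"
  obtains i where "k \<subseteq> metric_link S (facet i)"
proof -
  obtain \<tau> where \<tau>: "k = metric_link S \<tau>" "\<tau> \<in> J" "S \<subseteq> \<tau>" using assms by (auto simp: link_cells_def)
  then obtain i where "\<tau> \<subseteq> facet i" by (auto simp: J_def generated_complex_def)
  then show ?thesis using metric_link_mono[OF finite_facet S_nonempty \<tau>(3)] \<tau>(1) that by blast
qed

lemma link_facet_cell: "metric_link S (facet i) \<in> link_cells J S"
  using facet_in_J S_sub_facet by (auto simp: link_cells_def)

text \<open>A great arc inside an edge is recognized by its distances to its two ends.\<close>

lemma great_arc_in_link:
  assumes unit: "ip \<xi> \<xi> = 1" "ip (c r) \<xi> = 0"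
    and arc: "0 < \<epsilon>" "\<And>s. 0 \<le> s \<Longrightarrow> s \<le> \<epsilon> \<Longrightarrow> great_arc (c r) \<xi> s \<in> metric_link S (facet i)"
  obtains d \<epsilon>' where "d = 1 \<or> d = - 1" "0 < \<epsilon>'" "\<epsilon>' \<le> \<epsilon>"
    "\<And>s. 0 \<le> s \<Longrightarrow> s \<le> \<epsilon>' \<Longrightarrow> great_arc (c r) \<xi> s = c (r + d * s)"
proof -
  have "\<exists>q. i * \<theta> \<le> q \<and> q \<le> i * \<theta> + \<theta> \<and> great_arc (c r) \<xi> s = c q" if "0 \<le> s" "s \<le> \<epsilon>" for s
    using arc(2)[OF that] unfolding metric_link_facet by auto
  then obtain \<rho> where \<rho>: "\<And>s. 0 \<le> s \<Longrightarrow> s \<le> \<epsilon> \<Longrightarrow>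
    i * \<theta> \<le> \<rho> s \<and> \<rho> s \<le> i * \<theta> + \<theta> \<and> great_arc (c r) \<xi> s = c (\<rho> s)" by metis
  \<comment> \<open>The arc and the edge have the same inner products, so cosines of differences
    agree. Differences of \<rho> are at most \<theta>, and the cap 1 keeps those of the arc
    parameter within the range where cos is injective.\<close>
  have dist: "\<bar>\<rho> s - \<rho> s'\<bar> = \<bar>s - s'\<bar>"
    if "0 \<le> s" "s \<le> min \<epsilon> 1" "0 \<le> s'" "s' \<le> min \<epsilon> 1" for s s'
  proof -
    have "cos (\<rho> s - \<rho> s') = cos (s - s')"
      using ip_great_arc[OF c_unit unit, of s s'] \<rho>[of s] \<rho>[of s'] that ip_c[of i "\<rho> s" "\<rho> s'"] by auto
    then have "cos \<bar>\<rho> s - \<rho> s'\<bar> = cos \<bar>s - s'\<bar>" by simp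
    moreover have "\<bar>\<rho> s - \<rho> s'\<bar> \<le> pi"
      using \<rho>[of s] \<rho>[of s'] that theta_bounds by (auto simp: abs_le_iff)
    moreover have "\<bar>s - s'\<bar> \<le> pi" using that pi_gt3 by (auto simp: abs_le_iff)
    ultimately show ?thesis using cos_inj_pi abs_ge_zero by blast
  qed
  define e where "e = min \<epsilon> 1"
  have e: "0 < e" "e \<le> \<epsilon>" using arc(1) by (auto simp: e_def)
  obtain d where d: "d = 1 \<or> d = - 1" "\<rho> e = \<rho> 0 + d * e"
  proof -
    have "\<bar>\<rho> e - \<rho> 0\<bar> = e" using dist[of e 0] e by (simp add: e_def)
    then have "\<rho> e = \<rho> 0 + 1 * e \<or> \<rho> e = \<rho> 0 + (- 1) * e" by linarith
    then show ?thesis using that by blast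
  qed
  have lin: "\<rho> s = \<rho> 0 + d * s" if "0 \<le> s" "s \<le> e" for s
    proof -
    have "\<bar>\<rho> s - \<rho> 0\<bar> = s" "\<bar>\<rho> s - \<rho> e\<bar> = e - s"
      using dist[of s 0] dist[of s e] that e by (auto simp: e_def[symmetric])
    moreover have "d = 1 \<and> \<rho> e = \<rho> 0 + e \<or> d = - 1 \<and> \<rho> e = \<rho> 0 - e" using d by auto
    ultimately show ?thesis by (auto simp: abs_if split: if_splits)
  qed
  obtain k :: int where k: "\<rho> 0 = r + 5 * \<theta> * of_int k"
    using c_inj[of r "\<rho> 0"] \<rho>[of 0] arc(1) by auto
  have "great_arc (c r) \<xi> s = c (r + d * s)" if "0 \<le> s" "s \<le> e" for s
  proof -
    have "great_arc (c r) \<xi> s = c (\<rho> s)" using \<rho> that e by auto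
    also have "\<rho> s = (r + d * s) + 5 * \<theta> * of_int k" using lin that k by simp
    finally show ?thesis by (simp only: c_period)
  qed
  then show ?thesis using that d(1) e by blast
qed

lemma departs_along_c:
  assumes "departs_along (link_cells J S) \<gamma> t \<xi>"
  shows "\<exists>r d \<epsilon>. (d = 1 \<or> d = - 1) \<and> 0 < \<epsilon> \<and> \<gamma> t = c r \<and> (\<forall>s. 0 \<le> s \<and> s \<le> \<epsilon> \<longrightarrow> \<gamma> (t + s) = c (r + d * s))"
proof -
  obtain \<tau> \<epsilon> where \<tau>: "\<tau> \<in> J" "S \<subseteq> \<tau>" "\<epsilon> > 0"
    "\<And>s. 0 \<le> s \<Longrightarrow> s \<le> \<epsilon> \<Longrightarrow> \<gamma> (t + s) = great_arc (\<gamma> t) \<xi> s"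
    "\<And>s. 0 \<le> s \<Longrightarrow> s \<le> \<epsilon> \<Longrightarrow> great_arc (\<gamma> t) \<xi> s \<in> metric_link S \<tau>"
    "ip \<xi> \<xi> = 1" "ip (\<gamma> t) \<xi> = 0" "\<gamma> t \<in> metric_link S \<tau>"
    using assms by (rule departs_along_cell) metis
  have "metric_link S \<tau> \<in> link_cells J S" using \<tau>(1,2) by (auto simp: link_cells_def)
  then obtain i where i: "metric_link S \<tau> \<subseteq> metric_link S (facet i)" by (rule link_cell_sub_facet)
  then obtain r where r: "\<gamma> t = c r" using \<tau>(8) unfolding metric_link_facet by auto
  have u: "ip (c r) \<xi> = 0" using \<tau>(7) r by simp
  have "great_arc (c r) \<xi> s \<in> metric_link S (facet i)" if "0 \<le> s" "s \<le> \<epsilon>" for s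
    using \<tau>(5)[OF that] i r by auto
  then obtain d \<epsilon>' where "d = 1 \<or> d = - 1" "0 < \<epsilon>'" "\<epsilon>' \<le> \<epsilon>"
    "\<And>s. 0 \<le> s \<Longrightarrow> s \<le> \<epsilon>' \<Longrightarrow> great_arc (c r) \<xi> s = c (r + d * s)"
    using great_arc_in_link[OF \<tau>(6) u \<tau>(3), of i] by metis
  then show ?thesis
    using \<tau>(4) r
    by (intro exI[of _ r] exI[of _ d] exI[of _ \<epsilon>'] conjI allI impI) simp_all
qed

text \<open>The two parameters differ by k periods at 0 and by k' periods at h. Up to h they drift
  apart by at most 2 * h \<le> 2 * \<theta>, which is less than a period, so k' = k and there is no
  drift.\<close>

lemma c_affine_unique:
  assumes "0 < \<epsilon>" "d = 1 \<or> d = - 1" "d' = 1 \<or> d' = - 1"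
    and eq: "\<And>h. 0 \<le> h \<Longrightarrow> h \<le> \<epsilon> \<Longrightarrow> c (p + d * h) = c (q + d' * h)"
  shows "d = d'" "\<exists>k::int. q = p + 5 * \<theta> * of_int k"
proof -
  obtain k :: int where k: "q = p + 5 * \<theta> * of_int k" using eq[of 0] c_inj assms(1) by force
  then show "\<exists>k::int. q = p + 5 * \<theta> * of_int k" by blast
  define h where "h = min \<epsilon> \<theta>"
  have h: "0 < h" "h \<le> \<epsilon>" "h \<le> \<theta>" using assms(1) theta_bounds by (auto simp: h_def)
  obtain k' :: int where k': "q + d' * h = p + d * h + 5 * \<theta> * of_int k'"
    using eq[of h] c_inj h by force
  have "5 * \<theta> * of_int (k' - k) = (d' - d) * h" using k k' by (simp add: algebra_simps)
  then have "\<bar>5 * \<theta> * of_int (k' - k)\<bar> = \<bar>d' - d\<bar> * h" using h by (simp add: abs_mult)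
  also have "\<dots> \<le> 2 * h" using assms h by (intro mult_right_mono) auto
  also have "\<dots> < 5 * \<theta> * 1" using h by simp
  finally have "5 * \<theta> * \<bar>real_of_int (k' - k)\<bar> < 5 * \<theta> * 1"
    using theta_bounds by (simp add: abs_mult)
  then have "\<bar>real_of_int (k' - k)\<bar> < 1"
    using theta_bounds(1) by (simp only: mult_less_cancel_left_pos zero_less_mult_iff zero_less_numeral simp_thms)
  then have "k' = k" by linarith
  then show "d = d'" using k k' h by simp
qed

text \<open>Each branch at t follows the circle in one of its two directions. If both took the same
  one, the loop would retrace its own path, against injectivity; so it runs straight through
  t.\<close>

lemma loop_local_form:
  assumes loop: "locally_geodesic_loop (link_cells J S) l \<gamma>"
  obtains r d \<epsilon> where "d = 1 \<or> d = - 1" "0 < \<epsilon>" "\<And>h. \<bar>h\<bar> \<le> \<epsilon> \<Longrightarrow> \<gamma> (t + h) = c (r + d * h)"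
proof -
  note L = locally_geodesic_loopD[OF loop]
  obtain \<xi> \<eta> where dep: "departs_along (link_cells J S) \<gamma> t \<xi>"
    "departs_along (link_cells J S) (\<lambda>s. \<gamma> (- s)) (- t) \<eta>"
    using L(4) by blast
  obtain r d \<epsilon> where 1: "d = 1 \<or> d = - 1" "0 < \<epsilon>" "\<gamma> t = c r"
    "\<And>s. 0 \<le> s \<Longrightarrow> s \<le> \<epsilon> \<Longrightarrow> \<gamma> (t + s) = c (r + d * s)"
    using departs_along_c[OF dep(1)] by blast
  obtain r' d' \<epsilon>' where 2: "d' = 1 \<or> d' = - 1" "0 < \<epsilon>'" "\<gamma> t = c r'"
    "\<And>s. 0 \<le> s \<Longrightarrow> s \<le> \<epsilon>' \<Longrightarrow> \<gamma> (t - s) = c (r' + d' * s)"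
    using departs_along_c[OF dep(2)] by (force simp: algebra_simps)
  obtain k :: int where k: "r' = r + 5 * \<theta> * of_int k" using c_inj 1(3) 2(3) by metis
  have 3: "\<gamma> (t - s) = c (r + d' * s)" if "0 \<le> s" "s \<le> \<epsilon>'" for s
  proof -
    have "\<gamma> (t - s) = c ((r + d' * s) + 5 * \<theta> * of_int k)" using 2(4)[OF that] k by (simp add: algebra_simps)
    then show ?thesis by (simp only: c_period)
  qed
  have "d' = - d"
  proof (rule ccontr)
    assume "d' \<noteq> - d"
    then have "d' = d" using 1 2 by auto
    \<comment> \<open>The bound l / 4 keeps t + s and t - s less than l apart, as
      \<open>periodic_inj_eq\<close> requires.\<close>
    define s where "s = min (min \<epsilon> \<epsilon>') (l / 4)"
    have s: "0 < s" "s \<le> \<epsilon>" "s \<le> \<epsilon>'" "s \<le> l / 4" using 1 2 L(1) by (auto simp: s_def)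
    have "\<gamma> (t + s) = \<gamma> (t - s)" using 1(4) 3 s \<open>d' = d\<close> by simp
    then have "t + s = t - s" by (rule periodic_inj_eq[OF L(1-3)]) (use s L(1) in auto)
    then show False using s by simp
  qed
  show ?thesis
  proof (rule that[of d "min \<epsilon> \<epsilon>'" r])
    fix h assume h: "\<bar>h\<bar> \<le> min \<epsilon> \<epsilon>'"
    show "\<gamma> (t + h) = c (r + d * h)"
    proof (cases "0 \<le> h")
      case True
      then show ?thesis using 1(4) h by auto
    next
      case False
      then show ?thesis using 3[of "- h"] h \<open>d' = - d\<close> by auto
    qed
  qed (use 1 2 in auto)
qed

text \<open>The times near which the formula found at 0 is valid form an open set. Its complement is
  open too: if the formula were valid near some y in the interval of the local formula at t, then
  \<open>c_affine_unique\<close> would identify the two formulas, and t would belong to the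
  set.\<close>

lemma loop_global_form:
  assumes loop: "locally_geodesic_loop (link_cells J S) l \<gamma>"
  obtains r d where "d = 1 \<or> d = - 1" "\<And>t. \<gamma> t = c (r + d * t)"
proof -
  obtain r d \<epsilon>0 where 0: "d = 1 \<or> d = - 1" "0 < \<epsilon>0" "\<And>h. \<bar>h\<bar> \<le> \<epsilon>0 \<Longrightarrow> \<gamma> (0 + h) = c (r + d * h)"
    using loop_local_form[OF loop, of 0] by metis
  \<comment> \<open>Validity is demanded around t and not only at t, so that two formulas can be
    compared on an interval and not at an accidental crossing.\<close>
  define B where "B = {t. \<exists>\<epsilon>>0. \<forall>h. \<bar>h\<bar> \<le> \<epsilon> \<longrightarrow> \<gamma> (t + h) = c (r + d * (t + h))}"
  have "open B"
    unfolding open_dist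
  proof
    fix t assume "t \<in> B"
    then obtain \<epsilon> where \<epsilon>: "\<epsilon> > 0" "\<And>h. \<bar>h\<bar> \<le> \<epsilon> \<Longrightarrow> \<gamma> (t + h) = c (r + d * (t + h))" by (auto simp: B_def)
    have "y \<in> B" if "dist y t < \<epsilon> / 2" for y
      unfolding B_def
    proof (intro CollectI exI[of _ "\<epsilon> / 2"] conjI allI impI)
      fix h :: real assume "\<bar>h\<bar> \<le> \<epsilon> / 2"
      then have "\<bar>y - t + h\<bar> \<le> \<epsilon>" using that unfolding dist_real_def by linarith
      then show "\<gamma> (y + h) = c (r + d * (y + h))" using \<epsilon>(2)[of "y - t + h"] by simp
    qed (use \<epsilon> in simp)
    then show "\<exists>e>0. \<forall>y. dist y t < e \<longrightarrow> y \<in> B" using \<epsilon>(1) by (intro exI[of _ "\<epsilon> / 2"]) auto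
  qed
  moreover have "open (- B)"
    unfolding open_dist
  proof
    fix t assume t: "t \<in> - B"
    obtain r' d' \<epsilon> where l: "d' = 1 \<or> d' = - 1" "0 < \<epsilon>" "\<And>h. \<bar>h\<bar> \<le> \<epsilon> \<Longrightarrow> \<gamma> (t + h) = c (r' + d' * h)"
      using loop_local_form[OF loop, of t] by metis
    have "y \<in> - B" if y: "dist y t < \<epsilon>" for y
    proof
      assume "y \<in> B"
      then obtain \<epsilon>' where \<epsilon>': "\<epsilon>' > 0" "\<And>h. \<bar>h\<bar> \<le> \<epsilon>' \<Longrightarrow> \<gamma> (y + h) = c (r + d * (y + h))" by (auto simp: B_def)
      define e where "e = min \<epsilon>' (\<epsilon> - dist y t)"
      have e: "0 < e" "e \<le> \<epsilon>'" "e \<le> \<epsilon> - dist y t" using \<epsilon>' y by (auto simp: e_def)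
      have eq: "c ((r + d * y) + d * h) = c ((r' + d' * (y - t)) + d' * h)" if "0 \<le> h" "h \<le> e" for h
      proof -
        have "\<gamma> (y + h) = c (r + d * (y + h))" using that e by (intro \<epsilon>'(2)) auto
        moreover have "\<gamma> (t + (y - t + h)) = c (r' + d' * (y - t + h))"
          using that e by (intro l(3)) (auto simp: dist_real_def)
        ultimately show ?thesis by (simp add: algebra_simps)
      qed
      have dd: "d = d'" using c_affine_unique(1)[OF e(1) 0(1) l(1) eq] .
      obtain k :: int where k: "r' + d' * (y - t) = r + d * y + 5 * \<theta> * of_int k"
        using c_affine_unique(2)[OF e(1) 0(1) l(1) eq] by blast
      have "\<gamma> (t + h) = c (r + d * (t + h))" if "\<bar>h\<bar> \<le> \<epsilon>" for h
      proof -
        have "\<gamma> (t + h) = c (r' + d' * h)" using l(3)[OF that] .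
        also have "r' + d' * h = (r + d * (t + h)) + 5 * \<theta> * of_int k"
          using k dd by (simp add: algebra_simps)
        finally show ?thesis by (simp only: c_period)
      qed
      then have "t \<in> B" using l(2) by (auto simp: B_def)
      then show False using t by simp
    qed
    then show "\<exists>e>0. \<forall>y. dist y t < e \<longrightarrow> y \<in> - B" using l(2) by blast
  qed
  ultimately have "B = {} \<or> B = UNIV" using clopen[of B] by (simp add: closed_def)
  moreover have "0 \<in> B" using 0 by (auto simp: B_def)
  ultimately have "B = UNIV" by blast
  have "\<gamma> t = c (r + d * t)" for t
  proof -
    have "t \<in> B" using \<open>B = UNIV\<close> by simp
    then obtain \<epsilon> where "\<epsilon> > 0" "\<forall>h. \<bar>h\<bar> \<le> \<epsilon> \<longrightarrow> \<gamma> (t + h) = c (r + d * (t + h))" by (auto simp: B_def)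
    then show ?thesis by (auto dest: spec[of _ 0])
  qed
  then show ?thesis using that 0(1) by blast
qed

text \<open>Closing up after time l makes l a nonzero multiple of the period of
  \<open>c\<close>.\<close>

lemma loop_length:
  assumes loop: "locally_geodesic_loop (link_cells J S) l \<gamma>"
  shows "5 * \<theta> \<le> l"
proof -
  have l: "0 < l" using locally_geodesic_loopD(1)[OF loop] .
  obtain r d where d: "d = 1 \<or> d = - 1" "\<And>t. \<gamma> t = c (r + d * t)"
    using loop_global_form[OF loop] by metis
  have "\<gamma> (0 + l) = \<gamma> 0" using locally_geodesic_loopD(2)[OF loop] by blast
  then have "c (r + d * 0) = c (r + d * l)" by (simp add: d(2))
  then obtain k :: int where k: "r + d * l = r + d * 0 + 5 * \<theta> * of_int k"
    using c_inj by blast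
  then have "l = \<bar>5 * \<theta> * of_int k\<bar>" using d(1) l by auto
  then have lk: "l = 5 * \<theta> * \<bar>real_of_int k\<bar>" using theta_bounds by (simp add: abs_mult)
  then have "k \<noteq> 0" using l by auto
  then have "1 \<le> \<bar>real_of_int k\<bar>" by linarith
  then show ?thesis using lk theta_bounds mult_left_mono[of 1 "\<bar>real_of_int k\<bar>" "5 * \<theta>"] by simp
qed

lemma circle_directions:
  fixes t :: real
  obtains \<xi> \<eta> \<epsilon> i j where "0 < \<epsilon>" "\<epsilon> < \<theta>" "ip \<xi> \<xi> = 1" "ip (c t) \<xi> = 0" "ip \<eta> \<eta> = 1" "ip (c t) \<eta> = 0"
    "\<And>s. 0 \<le> s \<Longrightarrow> s \<le> \<epsilon> \<Longrightarrow> c (t + s) = great_arc (c t) \<xi> s \<and> c (t + s) \<in> metric_link S (facet i)"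
    "\<And>s. 0 \<le> s \<Longrightarrow> s \<le> \<epsilon> \<Longrightarrow> c (t - s) = great_arc (c t) \<eta> s \<and> c (t - s) \<in> metric_link S (facet j)"
proof -
  define i where "i = \<lfloor>t / \<theta>\<rfloor>"
  \<comment> \<open>The branch behind t needs the edge that ends at t if t is a multiple of
    \<theta>; the ceiling minus 1 selects it, and equals i otherwise.\<close>
  define j where "j = \<lceil>t / \<theta>\<rceil> - 1"
  have i: "i * \<theta> \<le> t" "t < i * \<theta> + \<theta>" using floor_theta[of t] by (auto simp: i_def)
  have j: "j * \<theta> < t" "t \<le> j * \<theta> + \<theta>"
  proof -
    have "of_int j < t / \<theta>" "t / \<theta> \<le> of_int j + 1" unfolding j_def by linarith+
    then show "j * \<theta> < t" "t \<le> j * \<theta> + \<theta>"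
      using theta_bounds(1) by (simp_all only: pos_less_divide_eq pos_divide_le_eq distrib_right mult_1)
  qed
  define \<epsilon> where "\<epsilon> = min (\<theta> / 2) (min (i * \<theta> + \<theta> - t) (t - j * \<theta>))"
  have \<epsilon>: "0 < \<epsilon>" "\<epsilon> < \<theta>" "\<epsilon> \<le> i * \<theta> + \<theta> - t" "\<epsilon> \<le> t - j * \<theta>"
    using i j theta_bounds by (auto simp: \<epsilon>_def)
  have ci: "c t = gc i t" and cj: "c t = gc j t" using i j by (auto intro: c_eq_gc)
  show ?thesis
  proof (rule that[of \<epsilon> "gc i (t + pi / 2)" "gc j (t - pi / 2)" i j])
    show "ip (c t) (gc i (t + pi / 2)) = 0" unfolding ci by (simp add: ip_gc)
    show "ip (c t) (gc j (t - pi / 2)) = 0" unfolding cj by (simp add: ip_gc)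
  next
    fix s assume "0 \<le> s" "s \<le> \<epsilon>"
    then have "i * \<theta> \<le> t + s" "t + s \<le> i * \<theta> + \<theta>" using i \<epsilon> by auto
    then show "c (t + s) = great_arc (c t) (gc i (t + pi / 2)) s \<and> c (t + s) \<in> metric_link S (facet i)"
      unfolding ci great_arc_gc metric_link_facet using c_eq_gc[of i "t + s"] by (auto intro!: image_eqI)
  next
    fix s assume "0 \<le> s" "s \<le> \<epsilon>"
    then have "j * \<theta> \<le> t - s" "t - s \<le> j * \<theta> + \<theta>" using j \<epsilon> by auto
    then show "c (t - s) = great_arc (c t) (gc j (t - pi / 2)) s \<and> c (t - s) \<in> metric_link S (facet j)"
      unfolding cj great_arc_gc metric_link_facet using c_eq_gc[of j "t - s"] by (auto intro!: image_eqI)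
  qed (use \<epsilon> in \<open>simp_all add: ip_gc\<close>)
qed

lemma great_arc_direction_eq:
  assumes "0 < s" "s < pi" "great_arc x \<xi> s = great_arc x \<eta> s"
  shows "\<xi> = \<eta>"
proof
  fix a
  have "sin s * \<xi> a = sin s * \<eta> a" using fun_cong[OF assms(3), of a] by (simp add: great_arc_def)
  then show "\<xi> a = \<eta> a" using sin_gt_zero[OF assms(1,2)] by simp
qed

text \<open>The link of a point of the circle has only the two directions \<xi> and \<eta>. Inside
  an edge they are opposite vectors of one cell; at a vertex they lie in different cells and are at
  infinite distance. Both cases meet the hypothesis of
  \<open>string_length_two_points\<close>.\<close>

lemma circle_is_loop: "locally_geodesic_loop (link_cells J S) (5 * \<theta>) c"
  unfolding locally_geodesic_loop_def
proof (intro conjI allI)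
  let ?C = "link_cells J S"
  show "0 < 5 * \<theta>" using theta_bounds by simp
  show "c (t + 5 * \<theta>) = c t" for t using c_period[of t 1] by simp
  show "inj_on c {0..<5 * \<theta>}"
  proof (rule inj_onI)
    fix x y assume xy: "x \<in> {0..<5 * \<theta>}" "y \<in> {0..<5 * \<theta>}" "c x = c y"
    then obtain k :: int where k: "y = x + 5 * \<theta> * of_int k" using c_inj by blast
    then have "\<bar>5 * \<theta> * of_int k\<bar> < 5 * \<theta> * 1" using xy by auto
    then have "5 * \<theta> * \<bar>real_of_int k\<bar> < 5 * \<theta> * 1" using theta_bounds by (simp add: abs_mult)
    then have "\<bar>real_of_int k\<bar> < 1"
      using theta_bounds(1) by (simp only: mult_less_cancel_left_pos zero_less_mult_iff zero_less_numeral simp_thms)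
    then have "k = 0" by linarith
    then show "x = y" using k by simp
  qed
  fix t
  obtain \<xi> \<eta> \<epsilon> i j where E: "0 < \<epsilon>" "\<epsilon> < \<theta>"
    and \<xi>: "ip \<xi> \<xi> = 1" "ip (c t) \<xi> = 0" and \<eta>: "ip \<eta> \<eta> = 1" "ip (c t) \<eta> = 0"
    and f: "\<And>s. 0 \<le> s \<Longrightarrow> s \<le> \<epsilon> \<Longrightarrow> c (t + s) = great_arc (c t) \<xi> s \<and> c (t + s) \<in> metric_link S (facet i)"
    and b: "\<And>s. 0 \<le> s \<Longrightarrow> s \<le> \<epsilon> \<Longrightarrow> c (t - s) = great_arc (c t) \<eta> s \<and> c (t - s) \<in> metric_link S (facet j)"
    using circle_directions[of t] by metis
  have dep1: "departs_along ?C c t \<xi>"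
    unfolding departs_along_def
  proof (intro conjI bexI[of _ "metric_link S (facet i)"] exI[of _ \<epsilon>] ballI)
    fix s assume "s \<in> {0..\<epsilon>}"
    then show "c (t + s) = great_arc (c t) \<xi> s" "c (t + s) \<in> metric_link S (facet i)"
      using f[of s] by auto
  qed (use \<xi> E link_facet_cell in auto)
  have dep2: "departs_along ?C (\<lambda>s. c (- s)) (- t) \<eta>"
    unfolding departs_along_def
  proof (intro conjI bexI[of _ "metric_link S (facet j)"] exI[of _ \<epsilon>] ballI)
    fix s assume "s \<in> {0..\<epsilon>}"
    then show "c (- (- t + s)) = great_arc (c (- (- t))) \<eta> s" "c (- (- t + s)) \<in> metric_link S (facet j)"
      using b[of s] by auto
  qed (use \<eta> E link_facet_cell in auto)
  have dir: "\<zeta> \<in> {\<xi>, \<eta>}" if zD: "\<zeta> \<in> D" and D: "D \<in> point_link_cells ?C (c t)" for \<zeta> D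
  proof -
    obtain k where k: "k \<in> ?C" "D = direction_cell k (c t)" using D by (auto simp: point_link_cells_def)
    obtain a where a: "k \<subseteq> metric_link S (facet a)" using k(1) by (rule link_cell_sub_facet)
    obtain \<epsilon>1 where z: "ip \<zeta> \<zeta> = 1" "ip (c t) \<zeta> = 0" "0 < \<epsilon>1"
      "\<And>s. 0 \<le> s \<Longrightarrow> s \<le> \<epsilon>1 \<Longrightarrow> great_arc (c t) \<zeta> s \<in> metric_link S (facet a)"
      using zD a unfolding k direction_cell_def by force
    obtain d \<epsilon>2 where d: "d = 1 \<or> d = - 1" "0 < \<epsilon>2"
      "\<And>s. 0 \<le> s \<Longrightarrow> s \<le> \<epsilon>2 \<Longrightarrow> great_arc (c t) \<zeta> s = c (t + d * s)"
      using great_arc_in_link[OF z(1-3), of a] z(4) by metis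
    define s where "s = min \<epsilon> \<epsilon>2"
    have s: "0 < s" "s \<le> \<epsilon>" "s \<le> \<epsilon>2" "s < pi" using E d(2) theta_bounds by (auto simp: s_def)
    have "great_arc (c t) \<zeta> s = great_arc (c t) \<xi> s \<or> great_arc (c t) \<zeta> s = great_arc (c t) \<eta> s"
      using d(1) d(3)[of s] f[of s] b[of s] s by auto
    then show ?thesis using great_arc_direction_eq[OF s(1,4)] by blast
  qed
  have ne: "\<xi> \<noteq> \<eta>"
  proof
    assume "\<xi> = \<eta>"
    then have "c (t + 1 * h) = c (t + (- 1) * h)" if "0 \<le> h" "h \<le> \<epsilon>" for h using f[OF that] b[OF that] by simp
    then have "(1::real) = - 1" by (intro c_affine_unique(1)[OF E(1), of 1 "- 1" t t]) auto
    then show False by simp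
  qed
  have opposite: "ip \<xi> \<eta> = - 1" if in_D: "\<xi> \<in> D" "\<eta> \<in> D" "D \<in> point_link_cells ?C (c t)" for D
  proof -
    obtain k where k: "k \<in> ?C" "D = direction_cell k (c t)" using in_D(3) by (auto simp: point_link_cells_def)
    obtain a where a: "k \<subseteq> metric_link S (facet a)" using k(1) by (rule link_cell_sub_facet)
    obtain \<epsilon>1 where e1: "0 < \<epsilon>1" "\<And>s. 0 \<le> s \<Longrightarrow> s \<le> \<epsilon>1 \<Longrightarrow> great_arc (c t) \<xi> s \<in> metric_link S (facet a)"
      using in_D(1) a unfolding k direction_cell_def by force
    obtain \<epsilon>2 where e2: "0 < \<epsilon>2" "\<And>s. 0 \<le> s \<Longrightarrow> s \<le> \<epsilon>2 \<Longrightarrow> great_arc (c t) \<eta> s \<in> metric_link S (facet a)"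
      using in_D(2) a unfolding k direction_cell_def by force
    define s where "s = min \<epsilon> (min \<epsilon>1 \<epsilon>2)"
    have s: "0 < s" "s \<le> \<epsilon>" "s \<le> \<epsilon>1" "s \<le> \<epsilon>2" "s < pi" using E e1 e2 theta_bounds by (auto simp: s_def)
    have "c (t + s) \<in> metric_link S (facet a)" "c (t - s) \<in> metric_link S (facet a)"
      using e1(2)[of s] e2(2)[of s] f[of s] b[of s] s by auto
    then obtain p q where p: "a * \<theta> \<le> p" "p \<le> a * \<theta> + \<theta>" "c (t + s) = c p"
      and q: "a * \<theta> \<le> q" "q \<le> a * \<theta> + \<theta>" "c (t - s) = c q"
      unfolding metric_link_facet by auto
    obtain n1 n2 :: int where n: "p = t + s + 5 * \<theta> * of_int n1" "q = t - s + 5 * \<theta> * of_int n2"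
      using c_inj[OF p(3)] c_inj[OF q(3)] by blast
    have "n1 = n2"
    proof -
      have "5 * \<theta> * of_int (n1 - n2) = (p - q) - 2 * s" using n by (simp add: algebra_simps)
      then have "\<bar>5 * \<theta> * of_int (n1 - n2)\<bar> < 5 * \<theta> * 1" using p q s E by auto
      then have "5 * \<theta> * \<bar>real_of_int (n1 - n2)\<bar> < 5 * \<theta> * 1" using theta_bounds by (simp add: abs_mult)
      then have "\<bar>real_of_int (n1 - n2)\<bar> < 1"
        using theta_bounds(1) by (simp only: mult_less_cancel_left_pos zero_less_mult_iff zero_less_numeral simp_thms)
      then show ?thesis by linarith
    qed
    \<comment> \<open>Within one edge the two points are 2 * s apart. Comparison with the expansion
      in \<xi> and \<eta> leaves -1 as the only value of \<open>ip \<xi> \<eta>\<close>.\<close>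
    then have "ip (c (t + s)) (c (t - s)) = cos (2 * s)"
      unfolding p(3) q(3) using ip_c[OF p(1,2) q(1,2)] n by simp
    moreover have "ip (c (t + s)) (c (t - s)) = cos s * cos s + sin s * sin s * ip \<xi> \<eta>"
    proof -
      have "ip (c (t + s)) (c (t - s)) = ip (great_arc (c t) \<xi> s) (great_arc (c t) \<eta> s)"
        using f[of s] b[of s] s by simp
      also have "\<dots> = cos s * ip (great_arc (c t) \<eta> s) (c t) + sin s * ip (great_arc (c t) \<eta> s) \<xi>"
        by (simp only: ip_great_arc_left[OF c_unit \<xi>(1)] ip_commute[of "great_arc (c t) \<eta> s"])
      also have "\<dots> = cos s * cos s + sin s * sin s * ip \<xi> \<eta>"
        using \<xi>(2) \<eta>(2) by (simp add: ip_great_arc_left[OF c_unit \<eta>(1)] c_unit ip_commute[of \<eta>])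
      finally show ?thesis .
    qed
    ultimately have "sin s * sin s * (ip \<xi> \<eta> + 1) = 0"
      by (simp add: cos_double power2_eq_square distrib_left)
    moreover have "sin s \<noteq> 0" using sin_gt_zero[of s] s by simp
    ultimately show ?thesis by simp
  qed
  have "ereal pi \<le> angle_at ?C (c t) \<xi> \<eta>"
    unfolding angle_at_def intrinsic_dist_def
  proof (rule INF_greatest, clarify)
    fix xs :: "('v \<Rightarrow> real) list"
    assume xs: "xs \<noteq> []" "successively (\<lambda>a b. \<exists>D\<in>point_link_cells ?C (c t). a \<in> D \<and> b \<in> D) xs"
      and ends: "\<xi> = hd xs" "\<eta> = last xs"
    have "pi \<le> string_length xs"
    proof (rule string_length_two_points[OF _ \<xi>(1) \<eta>(1) xs(1) ends(1)[symmetric] ends(2)[symmetric] xs(2) ne])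
      fix p q assume "\<exists>D\<in>point_link_cells ?C (c t). p \<in> D \<and> q \<in> D"
      then obtain D where D: "D \<in> point_link_cells ?C (c t)" "p \<in> D" "q \<in> D" by blast
      then have "p \<in> {\<xi>, \<eta>}" "q \<in> {\<xi>, \<eta>}" using dir by blast+
      moreover have "ip p q = - 1" if "p \<noteq> q"
        using that calculation opposite[OF _ _ D(1)] D by (auto simp: ip_commute[of \<eta> \<xi>])
      ultimately show "p \<in> {\<xi>, \<eta>} \<and> q \<in> {\<xi>, \<eta>} \<and> (p \<noteq> q \<longrightarrow> ip p q = - 1)" by blast
    qed
    then show "ereal pi \<le> ereal (string_length xs)" by simp
  qed
  then show "\<exists>\<xi> \<eta>. departs_along ?C c t \<xi> \<and> departs_along ?C (\<lambda>s. c (- s)) (- t) \<eta> \<and>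
      ereal pi \<le> angle_at ?C (c t) \<xi> \<eta>"
    using dep1 dep2 by blast
qed

section \<open>Curvature of the join\<close>

lemma S_in_J: "S \<in> J"
  using S_nonempty by (auto simp: J_def generated_complex_def facet_def)

lemma not_nonpositively_curved:
  assumes "card S = 1"
  shows "\<not> nonpositively_curved J"
proof -
  have "\<theta> = pi / 3"
  proof -
    have "\<theta> = arccos (cos (pi / 3))" by (simp add: \<theta>_def m_def assms cos_60)
    also have "\<dots> = pi / 3" by (rule arccos_cos) auto
    finally show ?thesis .
  qed
  then have "5 * \<theta> < 2 * pi" using pi_gt_zero by linarith
  then show ?thesis
    unfolding nonpositively_curved_def using circle_is_loop S_in_J by blast
qed

text \<open>The cosine of \<open>2 * pi / 5\<close> is the positive root of \<open>4 * y\<^sup>2 + 2 * y = 1\<close>.\<close>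

lemma cos_2pi_5_ge: "1 / 4 \<le> cos (2 * pi / 5)"
proof -
  define y where "y = cos (2 * pi / 5)"
  have pos: "0 < y" unfolding y_def by (rule cos_gt_zero) (use pi_gt_zero in auto)
  have "cos (2 * pi / 5) < cos 0" by (rule cos_monotone_0_pi) (use pi_gt_zero in auto)
  then have y1: "y < 1" by (simp add: y_def)
  \<comment> \<open>Twice and three times 2 * pi / 5 add up to 2 * pi, so their cosines agree. The
    resulting cubic in y has the factor y - 1, which y < 1 excludes.\<close>
  have "cos (3 * (2 * pi / 5)) = cos (2 * pi - 2 * (2 * pi / 5))" by (rule arg_cong[where f = cos]) simp
  also have "\<dots> = cos (2 * (2 * pi / 5))" by (simp only: cos_2pi_minus)
  finally have "4 * y ^ 3 - 3 * y = 2 * y\<^sup>2 - 1"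
    by (simp only: cos_treble_cos cos_double_cos y_def)
  then have "(y - 1) * (4 * y\<^sup>2 + 2 * y - 1) = 0"
    by (simp add: power2_eq_square power3_eq_cube algebra_simps)
  then have eq: "4 * y\<^sup>2 + 2 * y = 1" using y1 by auto
  show ?thesis
  proof (rule ccontr)
    assume "\<not> ?thesis"
    then have "y < 1 / 4" by (simp add: y_def)
    then have "y * y < 1 / 4 * (1 / 4)" using pos by (intro mult_strict_mono) auto
    then show False using eq \<open>y < 1 / 4\<close> by (simp add: power2_eq_square)
  qed
qed

lemma finite_J: "\<tau> \<in> J \<Longrightarrow> finite \<tau> \<and> \<tau> \<noteq> {}"
  unfolding J_def generated_complex_def using finite_facet finite_subset by blast

lemma nonpositively_curved:
  assumes "3 \<le> card S"
  shows "nonpositively_curved J"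
  unfolding nonpositively_curved_def
proof (intro ballI notI, elim exE conjE)
  fix \<sigma> l \<gamma>
  assume \<sigma>: "\<sigma> \<in> J" and l: "l < 2 * pi" and loop: "locally_geodesic_loop (link_cells J \<sigma>) l \<gamma>"
  have f\<sigma>: "finite \<sigma>" "\<sigma> \<noteq> {}" using finite_J[OF \<sigma>] by auto
  obtain i where i: "\<sigma> \<subseteq> facet i" using \<sigma> by (auto simp: J_def generated_complex_def)
  consider s where "s \<in> S" "s \<notin> \<sigma>" | "\<sigma> = S" | x where "S \<subseteq> \<sigma>" "x \<in> \<sigma>" "x \<notin> S" by blast
  then show False
  proof cases
    case 1
    have "insert s \<tau> \<in> J" if "\<tau> \<in> J" for \<tau>
      using that 1(1) by (auto simp: J_def generated_complex_def facet_def)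
    then show False using no_loop_in_star[OF _ _ f\<sigma>(2,1) 1(2), of J] finite_J loop by blast
  next
    case 2
    have "1 / (m + 1) \<le> 1 / 4" using assms by (simp add: m_def field_simps)
    then have "1 / (m + 1) \<le> cos (2 * pi / 5)" using cos_2pi_5_ge by simp
    moreover have "- 1 \<le> 1 / (m + 1)" by (rule order_trans[of _ 0]) (use m_pos in auto)
    ultimately have "arccos (cos (2 * pi / 5)) \<le> \<theta>"
      unfolding \<theta>_def by (intro arccos_le_arccos) auto
    moreover have "arccos (cos (2 * pi / 5)) = 2 * pi / 5" by (rule arccos_cos) auto
    ultimately have "2 * pi \<le> 5 * \<theta>" by simp
    then show False using loop_length loop l 2 by fastforce
  next
    case 3
    have "\<exists>u. metric_link \<sigma> \<tau> \<subseteq> {u}" if "\<tau> \<in> J" "\<sigma> \<subseteq> \<tau>" for \<tau>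
    proof -
      obtain j where "\<tau> \<subseteq> facet j" using \<open>\<tau> \<in> J\<close> by (auto simp: J_def generated_complex_def)
      \<comment> \<open>The vertex x is one of the two rim vertices of the facet, so \<tau> exceeds
        \<sigma> by at most the other one.\<close>
      then have "\<tau> \<subseteq> insert (vx j) \<sigma> \<or> \<tau> \<subseteq> insert (vx (j + 1)) \<sigma>"
        using 3 that(2) unfolding facet_def by blast
      then show ?thesis
        using metric_link_one_vertex[OF conjunct1[OF finite_J[OF that(1)]] that(2) f\<sigma>(2)] by blast
    qed
    then show False using no_loop_in_small_links loop by blast
  qed
qed

end

subsection \<open>Topology of realizations\<close>

lemma continuous_on_coordinate [continuous_intros]:
  assumes "continuous_on A f"
  shows "continuous_on A (\<lambda>x. f x a)"
  using continuous_on_product_then_coordinatewise[OF assms] .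

text \<open>The function space is a product of lines and hence Hausdorff. This supplies a closedness
  hypothesis of \<open>homeomorphism_common_quotient\<close>.\<close>

lemma compact_imp_closed_fun:
  fixes C :: "('v \<Rightarrow> real) set"
  assumes "compact C"
  shows "closed C"
proof -
  have "Hausdorff_space (euclidean :: ('v \<Rightarrow> real) topology)"
    unfolding euclidean_product_topology[symmetric]
    by (simp add: Hausdorff_space_product_topology)
  then have "closedin (euclidean :: ('v \<Rightarrow> real) topology) C"
    using assms by (intro compactin_imp_closedin) auto
  then show ?thesis by simp
qed

lemma star_segment:
  assumes star: "\<And>\<tau>. \<tau> \<in> K \<Longrightarrow> finite \<tau> \<and> insert s \<tau> \<in> K"
    and x: "x \<in> realization K" and t: "0 \<le> t" "t \<le> (1::real)"
  shows "(\<lambda>v. (1 - t) * x v + t * vertex_point s v) \<in> realization K"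
proof -
  obtain \<tau> where \<tau>: "\<tau> \<in> K" "x \<in> closed_cell \<tau>" using x by (auto simp: realization_def)
  then have f: "finite \<tau>" "insert s \<tau> \<in> K" using star by auto
  have "sum x (insert s \<tau>) = sum x \<tau>"
    using \<tau>(2) f by (intro sum.mono_neutral_right) (auto simp: closed_cell_def)
  moreover have "sum (vertex_point s) (insert s \<tau>) = 1"
    using vertex_point_in_closed_cell[of "insert s \<tau>" s] f by (simp add: closed_cell_def)
  ultimately have "(\<Sum>v\<in>insert s \<tau>. (1 - t) * x v + t * vertex_point s v) = 1"
    using \<tau>(2) by (simp only: sum.distrib sum_distrib_left[symmetric]) (simp add: closed_cell_def)
  then have "(\<lambda>v. (1 - t) * x v + t * vertex_point s v) \<in> closed_cell (insert s \<tau>)"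
    using \<tau>(2) t unfolding closed_cell_def by (auto simp: vertex_point_def)
  then show ?thesis using f by (auto simp: realization_def)
qed

lemma star_connected:
  assumes star: "\<And>\<tau>. \<tau> \<in> K \<Longrightarrow> finite \<tau> \<and> insert s \<tau> \<in> K"
  shows "connected (realization K)"
proof -
  define H where "H x t = (\<lambda>v. (1 - t) * x v + t * vertex_point s v)" for x :: "'a \<Rightarrow> real" and t :: real
  have "connected (\<Union>x\<in>realization K. H x ` {0..1})"
  proof (rule connected_Union)
    fix A assume "A \<in> (\<lambda>x. H x ` {0..1}) ` realization K"
    then obtain x where A: "A = H x ` {0..1}" by blast
    have "continuous_on {0..1} (H x)"
      unfolding H_def by (intro continuous_intros)
    then show "connected A" unfolding A by (intro connected_continuous_image) auto
  next
    have "vertex_point s \<in> H x ` {0..1}" for x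
      by (rule image_eqI[of _ _ 1]) (simp_all add: H_def)
    then show "\<Inter> ((\<lambda>x. H x ` {0..1}) ` realization K) \<noteq> {}" by blast
  qed
  also have "(\<Union>x\<in>realization K. H x ` {0..1}) = realization K"
  proof
    show "(\<Union>x\<in>realization K. H x ` {0..1}) \<subseteq> realization K"
      using star_segment[OF star] by (auto simp: H_def)
    have "x \<in> H x ` {0..1}" for x by (rule image_eqI[of _ _ 0]) (simp_all add: H_def)
    then show "realization K \<subseteq> (\<Union>x\<in>realization K. H x ` {0..1})" by blast
  qed
  finally show ?thesis .
qed

text \<open>The segments to the apex s contract every loop freely to the constant loop there, so any
  two loops are homotopic to each other.\<close>

lemma star_simply_connected:
  assumes star: "\<And>\<tau>. \<tau> \<in> K \<Longrightarrow> finite \<tau> \<and> insert s \<tau> \<in> K"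
  shows "simply_connected (realization K)"
proof -
  have null: "homotopic_loops (realization K) p (\<lambda>_. vertex_point s)"
    if p: "path p" "pathfinish p = pathstart p" "path_image p \<subseteq> realization K" for p
    unfolding homotopic_loops
  proof (intro exI conjI ballI)
    define h where "h = (\<lambda>z v. (1 - fst z) * p (snd z) v + fst z * vertex_point s v)"
    have cp: "continuous_on ({0..1} \<times> {0..1}) (\<lambda>z. p (snd z))"
      by (rule continuous_on_compose2[OF p(1)[unfolded path_def] continuous_on_snd[OF continuous_on_id]]) auto
    show "continuous_on ({0..1} \<times> {0..1}) h"
      unfolding h_def
      by (intro continuous_on_coordinatewise_then_product continuous_on_add continuous_on_mult
          continuous_on_diff continuous_on_const continuous_on_fst continuous_on_id
          continuous_on_product_then_coordinatewise[OF cp])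
    show "h \<in> {0..1} \<times> {0..1} \<rightarrow> realization K"
    proof
      fix z :: "real \<times> real" assume z: "z \<in> {0..1} \<times> {0..1}"
      then have "p (snd z) \<in> realization K" using p(3) by (auto simp: path_image_def)
      then show "h z \<in> realization K" unfolding h_def using z by (intro star_segment[OF star]) auto
    qed
    show "h (0, x) = p x" "h (1, x) = vertex_point s" for x by (auto simp: h_def)
    show "pathfinish (h \<circ> Pair t) = pathstart (h \<circ> Pair t)" for t
      using p(2) by (simp add: h_def pathfinish_def pathstart_def)
  qed
  show ?thesis
    unfolding simply_connected_def
  proof (intro allI impI, elim conjE)
    fix p q :: "real \<Rightarrow> 'a \<Rightarrow> real"
    assume "path p" "pathfinish p = pathstart p" "path_image p \<subseteq> realization K"
      and "path q" "pathfinish q = pathstart q" "path_image q \<subseteq> realization K"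
    then show "homotopic_loops (realization K) p q"
      by (intro homotopic_loops_trans[OF null homotopic_loops_sym[OF null]])
  qed
qed

section \<open>Local structure of triangulated disks\<close>

text \<open>Invariance of domain applies to f composed with k, a continuous injection of an open
  subset of the open disk into the plane. The second claim holds because the open disk is dense in
  the closed one: a nonempty relatively open piece of X cannot be mapped into the circle
  alone.\<close>

lemma disk_chart_open:
  fixes f :: "('v \<Rightarrow> real) \<Rightarrow> complex"
  assumes hom: "homeomorphism X (cball (0::complex) 1) h k"
    and U: "open U" "X \<inter> U \<noteq> {}" and f: "continuous_on (X \<inter> U) f" "inj_on f (X \<inter> U)"
  shows "open (f ` {x \<in> X \<inter> U. h x \<in> ball 0 1})" "{x \<in> X \<inter> U. h x \<in> ball 0 1} \<noteq> {}"
proof -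
  have hk: "\<And>x. x \<in> X \<Longrightarrow> h x \<in> cball 0 1 \<and> k (h x) = x"
    "\<And>z. z \<in> cball 0 1 \<Longrightarrow> k z \<in> X \<and> h (k z) = z" "continuous_on (cball 0 1) k"
    using hom unfolding homeomorphism_def by blast+
  define W where "W = ball 0 1 \<inter> k -` U"
  have kb: "continuous_on (ball 0 1) k" by (rule continuous_on_subset[OF hk(3)]) auto
  have oW: "open W" unfolding W_def by (rule continuous_open_preimage[OF kb _ U(1)]) simp
  have eq: "{x \<in> X \<inter> U. h x \<in> ball 0 1} = k ` W"
  proof
    show "{x \<in> X \<inter> U. h x \<in> ball 0 1} \<subseteq> k ` W"
    proof
      fix x assume "x \<in> {x \<in> X \<inter> U. h x \<in> ball 0 1}"
      then show "x \<in> k ` W" using hk(1)[of x] by (intro image_eqI[of _ _ "h x"]) (auto simp: W_def)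
    qed
    show "k ` W \<subseteq> {x \<in> X \<inter> U. h x \<in> ball 0 1}"
    proof
      fix x assume "x \<in> k ` W"
      then obtain z where "z \<in> W" "x = k z" by blast
      then show "x \<in> {x \<in> X \<inter> U. h x \<in> ball 0 1}" using hk(2)[of z] by (auto simp: W_def)
    qed
  qed
  have kW: "k ` W \<subseteq> X \<inter> U" using eq by blast
  have "open ((f \<circ> k) ` W)"
  proof (rule invariance_of_domain[OF _ oW])
    show "continuous_on W (f \<circ> k)"
      by (rule continuous_on_compose[OF continuous_on_subset[OF kb] continuous_on_subset[OF f(1) kW]])
        (auto simp: W_def)
    show "inj_on (f \<circ> k) W"
    proof (rule comp_inj_on)
      show "inj_on k W" by (rule inj_on_inverseI[of _ h]) (use hk(2) in \<open>auto simp: W_def\<close>)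
      show "inj_on f (k ` W)" by (rule inj_on_subset[OF f(2) kW])
    qed
  qed
  then show "open (f ` {x \<in> X \<inter> U. h x \<in> ball 0 1})" unfolding eq by (simp add: image_comp)
  obtain x where x: "x \<in> X" "x \<in> U" using U(2) by blast
  obtain A where A: "open A" "A \<inter> cball 0 1 = k -` U \<inter> cball 0 1"
    using hk(3) U(1) unfolding continuous_on_open_invariant by blast
  have "h x \<in> A \<inter> closure (ball 0 1)" using hk(1)[OF x(1)] x A by auto
  then obtain z where "z \<in> A \<inter> ball 0 1" using open_Int_closure_eq_empty[OF A(1)] by blast
  then have "z \<in> W" using A(2) by (auto simp: W_def)
  then show "{x \<in> X \<inter> U. h x \<in> ball 0 1} \<noteq> {}" unfolding eq by blast
qed

lemma open_positive_star:
  assumes "finite \<tau>"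
  shows "open {x :: 'v \<Rightarrow> real. \<forall>v\<in>\<tau>. 0 < x v}"
proof -
  have "{x :: 'v \<Rightarrow> real. \<forall>v\<in>\<tau>. 0 < x v} = (\<Inter>v\<in>\<tau>. {x. 0 < x v})" by auto
  also have "open \<dots>" using assms by (intro open_INT ballI open_Collect_less continuous_intros) auto
  finally show ?thesis .
qed

lemma closed_cell_support:
  assumes "x \<in> closed_cell \<tau>" "\<forall>v\<in>\<rho>. 0 < x v"
  shows "\<rho> \<subseteq> \<tau>"
  using assms by (force simp: closed_cell_def)

lemma barycenter_in_closed_cell:
  assumes "finite \<tau>" "\<tau> \<noteq> {}"
  shows "(\<lambda>v. if v \<in> \<tau> then 1 / card \<tau> else 0) \<in> closed_cell \<tau>"
  using assms by (auto simp: closed_cell_def)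

text \<open>The open star U of a maximal simplex meets the disk only in its own cell. With at most
  two vertices this cell is charted by a single real coordinate, and a nonempty open subset of the
  plane does not fit into the real axis.\<close>

lemma disk_no_small_maximal_simplex:
  assumes hom: "homeomorphism (realization D) (cball (0::complex) 1) h k"
    and \<tau>: "\<tau> \<in> D" "finite \<tau>" "\<tau> \<noteq> {}" "card \<tau> \<le> 2"
  shows "\<exists>\<tau>'\<in>D. \<tau> \<subset> \<tau>'"
proof (rule ccontr)
  assume max: "\<not> ?thesis"
  define U where "U = {x :: 'a \<Rightarrow> real. \<forall>v\<in>\<tau>. 0 < x v}"
  have U: "open U" unfolding U_def by (rule open_positive_star[OF \<tau>(2)])
  have sub: "realization D \<inter> U \<subseteq> closed_cell \<tau>"
  proof
    fix x assume x: "x \<in> realization D \<inter> U"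
    then obtain \<tau>' where \<tau>': "\<tau>' \<in> D" "x \<in> closed_cell \<tau>'" by (auto simp: realization_def)
    moreover have "\<tau> \<subseteq> \<tau>'" using closed_cell_support[OF \<tau>'(2)] x by (simp add: U_def)
    ultimately show "x \<in> closed_cell \<tau>" using max by blast
  qed
  obtain a where a: "a \<in> \<tau>" using \<tau> by blast
  define f where "f x = complex_of_real (x a)" for x :: "'a \<Rightarrow> real"
  have "(\<lambda>v. if v \<in> \<tau> then 1 / card \<tau> else 0) \<in> realization D \<inter> U"
    using barycenter_in_closed_cell[OF \<tau>(2,3)] \<tau> by (auto simp: realization_def U_def card_gt_0_iff)
  then have ne: "realization D \<inter> U \<noteq> {}" by blast
  have cont: "continuous_on (realization D \<inter> U) f"
    unfolding f_def by (intro continuous_intros)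
  have inj: "inj_on f (realization D \<inter> U)"
  proof (rule inj_onI)
    fix x y assume "x \<in> realization D \<inter> U" "y \<in> realization D \<inter> U" and f: "f x = f y"
    then have xy: "x \<in> closed_cell \<tau>" "y \<in> closed_cell \<tau>" using sub by auto
    have xa: "x a = y a" using f by (simp add: f_def)
    have "card (\<tau> - {a}) \<le> Suc 0" using \<tau> a by simp
    then have one: "v = v'" if "v \<in> \<tau> - {a}" "v' \<in> \<tau> - {a}" for v v'
      using that \<tau>(2) card_le_Suc0_iff_eq[of "\<tau> - {a}"] by blast
    have "sum z \<tau> = z a + sum z (\<tau> - {a})" for z :: "'a \<Rightarrow> real" using a \<tau>(2) by (simp add: sum.remove)
    then have s: "sum x (\<tau> - {a}) = sum y (\<tau> - {a})" using xy xa by (auto simp: closed_cell_def)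
    have "x v = y v" for v
    proof (cases "v \<in> \<tau> - {a}")
      case True
      then have "\<tau> - {a} = {v}" using one by blast
      then show ?thesis using s by simp
    next
      case False
      then have "v = a \<or> v \<notin> \<tau>" by blast
      then show ?thesis using xy xa unfolding closed_cell_def by fastforce
    qed
    then show "x = y" by blast
  qed
  let ?I = "f ` {x \<in> realization D \<inter> U. h x \<in> ball 0 1}"
  obtain z where z: "z \<in> ?I" using disk_chart_open(2)[OF hom U ne cont inj] by blast
  then obtain e where e: "0 < e" "ball z e \<subseteq> ?I"
    using disk_chart_open(1)[OF hom U ne cont inj] by (auto simp: open_contains_ball)
  have "z + \<i> * of_real (e / 2) \<in> ball z e" using e(1) by (simp add: dist_norm norm_mult)
  then have "z + \<i> * of_real (e / 2) \<in> ?I" using e(2) by blast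
  moreover have "Im y = 0" if "y \<in> ?I" for y using that by (auto simp: f_def)
  ultimately have "Im (z + \<i> * of_real (e / 2)) = 0" by blast
  moreover have "Im z = 0" using z by (auto simp: f_def)
  ultimately show False using e(1) by simp
qed

text \<open>Around the midpoint p of the edge, the disk is contained in the triangle with third
  vertex u. The coordinates at a and u chart it in a half plane with p on the bounding line. An
  interior point p would have a full neighbourhood in the image, including points with a negative
  coordinate at u.\<close>

lemma disk_free_edge_in_boundary:
  assumes hom: "homeomorphism (realization D) (cball (0::complex) 1) h k"
    and bd: "h ` realization \<alpha> = sphere 0 1" "\<alpha> \<subseteq> D"
    and \<alpha>: "\<And>\<tau> \<rho>. \<tau> \<in> \<alpha> \<Longrightarrow> \<rho> \<subseteq> \<tau> \<Longrightarrow> \<rho> \<noteq> {} \<Longrightarrow> \<rho> \<in> \<alpha>"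
    and ab: "{a, b} \<in> D" "a \<noteq> b" "u \<notin> {a, b}"
    and free: "\<And>\<tau>. \<tau> \<in> D \<Longrightarrow> {a, b} \<subseteq> \<tau> \<Longrightarrow> \<tau> \<subseteq> {a, b, u}"
  shows "{a, b} \<in> \<alpha>"
proof -
  define U where "U = {x :: 'a \<Rightarrow> real. \<forall>v\<in>{a, b}. 0 < x v}"
  have U: "open U" unfolding U_def by (rule open_positive_star) simp
  define p where "p v = (if v \<in> {a, b} then 1 / 2 else (0::real))" for v
  have "p \<in> closed_cell {a, b}" using ab(2) by (auto simp: closed_cell_def p_def)
  then have pU: "p \<in> realization D \<inter> U" using ab(1) by (auto simp: realization_def U_def p_def)
  have cell: "(\<forall>v. 0 \<le> x v) \<and> (\<forall>v. v \<notin> {a, b, u} \<longrightarrow> x v = 0) \<and> x a + x b + x u = 1"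
    if x: "x \<in> realization D \<inter> U" for x
  proof -
    obtain \<tau> where \<tau>: "\<tau> \<in> D" "x \<in> closed_cell \<tau>" using x by (auto simp: realization_def)
    have sub: "\<tau> \<subseteq> {a, b, u}"
      using free[OF \<tau>(1)] closed_cell_support[OF \<tau>(2), of "{a, b}"] x by (auto simp: U_def)
    have "sum x \<tau> = sum x {a, b, u}"
      using \<tau>(2) sub by (intro sum.mono_neutral_left) (auto simp: closed_cell_def)
    then show ?thesis using \<tau>(2) sub ab(2,3) by (auto simp: closed_cell_def)
  qed
  define f where "f x = Complex (x a) (x u)" for x :: "'a \<Rightarrow> real"
  have cont: "continuous_on (realization D \<inter> U) f"
    unfolding f_def Complex_eq by (intro continuous_intros)
  have inj: "inj_on f (realization D \<inter> U)"
  proof (rule inj_onI)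
    fix x y assume x: "x \<in> realization D \<inter> U" and y: "y \<in> realization D \<inter> U" and f: "f x = f y"
    have "x a = y a" "x u = y u" using f by (auto simp: f_def)
    then have "x v = y v" for v using cell[OF x] cell[OF y] by (cases "v \<in> {a, b, u}") auto
    then show "x = y" by blast
  qed
  have "p \<in> realization \<alpha>"
  proof (rule ccontr)
    assume p: "p \<notin> realization \<alpha>"
    have "h p \<notin> sphere 0 1"
    proof
      assume "h p \<in> sphere 0 1"
      then obtain q where q: "q \<in> realization \<alpha>" "h p = h q" unfolding bd(1)[symmetric] by blast
      then have "q \<in> realization D" using bd(2) by (auto simp: realization_def)
      then have "p = q" using q(2) hom pU unfolding homeomorphism_def by (metis IntD1)
      then show False using p q by simp
    qed
    moreover have "h p \<in> cball 0 1" using hom pU unfolding homeomorphism_def by blast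
    ultimately have "h p \<in> ball 0 1" by auto
    then have "f p \<in> f ` {x \<in> realization D \<inter> U. h x \<in> ball 0 1}" using pU by blast
    then obtain e where e: "0 < e" "ball (f p) e \<subseteq> f ` {x \<in> realization D \<inter> U. h x \<in> ball 0 1}"
      using disk_chart_open(1)[OF hom U _ cont inj] pU unfolding open_contains_ball by blast
    have "f p - \<i> * of_real (e / 2) \<in> ball (f p) e" using e(1) by (simp add: dist_norm norm_mult)
    then have "f p - \<i> * of_real (e / 2) \<in> f ` (realization D \<inter> U)" using e(2) by blast
    then obtain x where x: "x \<in> realization D \<inter> U" "f p - \<i> * of_real (e / 2) = f x" by blast
    have "Im (f p - \<i> * of_real (e / 2)) = Im (f x)" using x(2) by simp
    moreover have "0 \<le> x u" using cell[OF x(1)] by blast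
    ultimately show False using e(1) ab(3) by (simp add: f_def p_def)
  qed
  then obtain \<tau> where \<tau>: "\<tau> \<in> \<alpha>" "p \<in> closed_cell \<tau>" by (auto simp: realization_def)
  then have "{a, b} \<subseteq> \<tau>" by (intro closed_cell_support) (auto simp: p_def)
  then show ?thesis using \<alpha>[OF \<tau>(1)] by blast
qed

text \<open>Both maps send closed subsets of the compact A to compact, hence closed sets, so their
  images are quotients of A by the same relation. Closedness of compact sets enters as a hypothesis
  so that \<open>compact_imp_closed_fun\<close> can provide it.\<close>

lemma homeomorphism_common_quotient:
  fixes e :: "'a::t2_space \<Rightarrow> 'b::topological_space" and g :: "'a \<Rightarrow> 'c::topological_space"
  assumes A: "compact A" and cont: "continuous_on A e" "continuous_on A g"
    and fib: "\<And>x y. x \<in> A \<Longrightarrow> y \<in> A \<Longrightarrow> e x = e y \<longleftrightarrow> g x = g y"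
    and closed: "\<And>C :: 'b set. compact C \<Longrightarrow> closed C" "\<And>C :: 'c set. compact C \<Longrightarrow> closed C"
  obtains h k where "homeomorphism (e ` A) (g ` A) h k" "\<And>x. x \<in> A \<Longrightarrow> h (e x) = g x"
proof -
  define h where "h y = g (SOME x. x \<in> A \<and> e x = y)" for y
  define k where "k z = e (SOME x. x \<in> A \<and> g x = z)" for z
  have he: "h (e x) = g x" if "x \<in> A" for x
  proof -
    have "\<exists>x'. x' \<in> A \<and> e x' = e x" using that by blast
    from someI_ex[OF this] show ?thesis unfolding h_def using fib that by blast
  qed
  have kg: "k (g x) = e x" if "x \<in> A" for x
  proof -
    have "\<exists>x'. x' \<in> A \<and> g x' = g x" using that by blast
    from someI_ex[OF this] show ?thesis unfolding k_def using fib that by blast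
  qed
  have ch: "continuous_on (e ` A) h"
    unfolding continuous_on_closed_invariant
  proof (intro allI impI)
    fix B :: "'c set" assume B: "closed B"
    have "compact (A \<inter> (A \<inter> g -` B))"
      using A B cont compact_imp_closed[OF A] by (intro compact_Int_closed continuous_closed_preimage)
    then have "compact (e ` (A \<inter> g -` B))"
      using cont(1) by (intro compact_continuous_image[OF continuous_on_subset]) auto
    then have "closed (e ` (A \<inter> g -` B))" by (rule closed(1))
    moreover have "e ` (A \<inter> g -` B) \<inter> e ` A = h -` B \<inter> e ` A" using he by force
    ultimately show "\<exists>C. closed C \<and> C \<inter> e ` A = h -` B \<inter> e ` A" by blast
  qed
  have ck: "continuous_on (g ` A) k"
    unfolding continuous_on_closed_invariant
  proof (intro allI impI)
    fix B :: "'b set" assume B: "closed B"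
    have "compact (A \<inter> (A \<inter> e -` B))"
      using A B cont compact_imp_closed[OF A] by (intro compact_Int_closed continuous_closed_preimage)
    then have "compact (g ` (A \<inter> e -` B))"
      using cont(2) by (intro compact_continuous_image[OF continuous_on_subset]) auto
    then have "closed (g ` (A \<inter> e -` B))" by (rule closed(2))
    moreover have "g ` (A \<inter> e -` B) \<inter> g ` A = k -` B \<inter> g ` A" using kg by force
    ultimately show "\<exists>C. closed C \<and> C \<inter> g ` A = k -` B \<inter> g ` A" by blast
  qed
  have "homeomorphism (e ` A) (g ` A) h k"
    unfolding homeomorphism_def
    using ch ck he kg by (force simp: image_iff)
  then show ?thesis using that he by blast
qed

subsection \<open>Minimal disks spanning the rim\<close>

context pentagon_join begin

section \<open>Rim, join and cone disks as complexes\<close>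

definition edge :: "int \<Rightarrow> 'v set" where "edge i = {vx i, vx (i + 1)}"

definition rim :: "'v set set" where "rim = generated_complex (range edge)"

lemma facet_edge: "facet i = S \<union> edge i"
  by (simp add: facet_def edge_def)

lemma J_iff: "\<tau> \<in> J \<longleftrightarrow> \<tau> \<noteq> {} \<and> (\<exists>i. \<tau> \<subseteq> facet i)"
  by (auto simp: J_def generated_complex_def)

lemma rim_iff: "\<tau> \<in> rim \<longleftrightarrow> \<tau> \<noteq> {} \<and> (\<exists>i. \<tau> \<subseteq> edge i)"
  by (auto simp: rim_def generated_complex_def)

lemma edge_in_rim: "edge i \<in> rim"
  unfolding rim_iff by (metis edge_def insert_not_empty order_refl)

text \<open>Subtracting the two congruences would make 5 divide 2: consecutive vertices of the cycle
  are consecutive in one order only.\<close>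

lemma not_both_neighbours:
  fixes i j :: int
  assumes "i mod 5 = (j + 1) mod 5" "(i + 1) mod 5 = j mod 5"
  shows False
proof -
  have "5 dvd (i + 1) - j" "5 dvd i - (j + 1)" using assms by (simp_all only: mod_eq_dvd_iff)
  from dvd_diff[OF this] show False by simp
qed

lemma edge_sub_facet:
  assumes "edge i \<subseteq> facet j"
  shows "i mod 5 = j mod 5"
proof -
  have "vx i \<in> {vx j, vx (j + 1)}" "vx (i + 1) \<in> {vx j, vx (j + 1)}"
    using assms by (auto simp: edge_def facet_def)
  then have "i mod 5 = j mod 5 \<or> i mod 5 = (j + 1) mod 5" "(i + 1) mod 5 = j mod 5 \<or> (i + 1) mod 5 = (j + 1) mod 5"
    by (simp_all add: vx_eq_iff)
  moreover have "i mod 5 = j mod 5" if "(i + 1) mod 5 = (j + 1) mod 5"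
  proof -
    have "(i + 1 - 1) mod 5 = (j + 1 - 1) mod 5" using that by (rule mod_diff_cong) simp
    then show ?thesis by simp
  qed
  ultimately show ?thesis using not_both_neighbours by blast
qed

lemma edge_period: "i mod 5 = j mod 5 \<Longrightarrow> edge i = edge j"
proof -
  assume "i mod 5 = j mod 5"
  then have "vx i = vx j" "vx (i + 1) = vx (j + 1)" by (auto simp: vx_eq_iff mod_add_cong)
  then show ?thesis by (simp add: edge_def)
qed

lemma edge_v: "i < 5 \<Longrightarrow> edge (int i) = {v i, v (Suc i)}"
  using vx_v[of i] vx_v[of "Suc i"] by (simp add: edge_def add.commute)

lemma edge_range: "range edge = {{v i, v (Suc i)} |i. i < 5}"
proof
  show "range edge \<subseteq> {{v i, v (Suc i)} |i. i < 5}"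
  proof
    fix e assume "e \<in> range edge"
    then obtain i where i: "e = edge i" by blast
    have "edge i = edge (int (nat (i mod 5)))" by (rule edge_period) simp
    moreover have "nat (i mod 5) < 5" by auto
    ultimately show "e \<in> {{v i, v (Suc i)} |i. i < 5}" using edge_v i by blast
  qed
  show "{{v i, v (Suc i)} |i. i < 5} \<subseteq> range edge"
    using edge_v by force
qed

lemma card_edge: "card (edge i) = 2"
  by (simp add: edge_def)

lemma S_neq_vx: "w \<in> S \<Longrightarrow> w \<noteq> vx i"
  using vx_notin by metis

lemma card_triangle: "w \<in> S \<Longrightarrow> card (insert w (edge i)) = 3"
  by (simp add: edge_def S_neq_vx)

lemma edge_disjoint: "S \<inter> edge i = {}"
  by (auto simp: edge_def)

lemma cycle_complex_eq_rim: "cycle_complex 5 v = rim"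
  by (simp add: cycle_complex_def rim_def edge_range)

lemma simplicial_join_eq_J: "simplicial_join (generated_complex {S}) rim = J"
proof (intro set_eqI iffI)
  fix \<tau> assume "\<tau> \<in> simplicial_join (generated_complex {S}) rim"
  then obtain a b where \<tau>: "\<tau> = a \<union> b" "\<tau> \<noteq> {}" "a \<subseteq> S" "b = {} \<or> b \<in> rim"
    by (auto simp: simplicial_join_def generated_complex_def)
  then have "\<exists>i. b \<subseteq> edge i" by (auto simp: rim_iff)
  then show "\<tau> \<in> J" using \<tau> unfolding J_iff facet_edge by blast
next
  fix \<tau> assume "\<tau> \<in> J"
  then obtain i where i: "\<tau> \<noteq> {}" "\<tau> \<subseteq> S \<union> edge i" by (auto simp: J_iff facet_edge)
  have "\<tau> \<inter> S \<in> insert {} (generated_complex {S})" by (auto simp: generated_complex_def)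
  moreover have "\<tau> \<inter> edge i \<in> insert {} rim" by (auto simp: rim_iff)
  moreover have "\<tau> = (\<tau> \<inter> S) \<union> (\<tau> \<inter> edge i)" using i by blast
  ultimately show "\<tau> \<in> simplicial_join (generated_complex {S}) rim"
    using i(1) unfolding simplicial_join_def by blast
qed

lemma abstract_complex_J: "abstract_complex J"
  unfolding abstract_complex_def using finite_J by (meson J_iff subset_trans)

lemma has_dimension_J:
  assumes "card S + 1 = n"
  shows "has_dimension J n"
proof -
  have c: "card (facet i) = n + 1" for i
    unfolding facet_edge using assms finite_S card_edge[of i] edge_disjoint[of i]
    by (subst card_Un_disjoint) (auto simp: edge_def)
  then show ?thesis
    unfolding has_dimension_def using facet_in_J card_mono[OF finite_facet] by (metis J_iff)
qed

lemma star_J: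
  assumes "s \<in> S" "\<tau> \<in> J"
  shows "finite \<tau> \<and> insert s \<tau> \<in> J"
  using assms finite_J by (auto simp: J_iff facet_def)

lemma CAT0_J:
  assumes "3 \<le> card S"
  shows "CAT0 J"
proof -
  obtain s where "s \<in> S" using S_nonempty by blast
  then show ?thesis
    unfolding CAT0_def
    using nonpositively_curved[OF assms] star_connected[OF star_J] star_simply_connected[OF star_J] by blast
qed

lemma finite_J_set: "finite J"
proof -
  have "vx i \<in> vx ` {0..<5}" for i
    by (rule image_eqI[of _ _ "i mod 5"]) (auto simp: vx_eq_iff)
  then have "J \<subseteq> Pow (S \<union> vx ` {0..<5})"
    unfolding J_iff facet_def subset_iff by (fastforce simp: J_iff facet_def)
  then show ?thesis using finite_S by (auto intro: finite_subset)
qed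

lemma cone_pentagon_join: "w \<in> S \<Longrightarrow> pentagon_join {w} v"
  using inj_v v5 disjoint by unfold_locales auto

lemma cone_disk_iff:
  "\<tau> \<in> cone_disk w rim \<longleftrightarrow> \<tau> \<noteq> {} \<and> (\<exists>i. \<tau> \<subseteq> insert w (edge i))"
proof -
  have "{e \<in> rim. card e = 2} = range edge"
  proof (intro set_eqI iffI)
    fix e assume e: "e \<in> {e \<in> rim. card e = 2}"
    then obtain i where "e \<subseteq> edge i" by (auto simp: rim_iff)
    moreover have "finite (edge i)" by (simp add: edge_def)
    ultimately have "e = edge i" using e card_edge[of i] by (intro card_subset_eq) simp_all
    then show "e \<in> range edge" by blast
  qed (auto simp: rim_iff edge_def)
  moreover have "{insert w e |e. e \<in> rim \<and> card e = 2} = insert w ` {e \<in> rim. card e = 2}" by blast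
  ultimately show ?thesis by (simp add: cone_disk_def generated_complex_def)
qed

lemma cone_disk_eq_J:
  assumes "w \<in> S"
  shows "cone_disk w rim = pentagon_join.J {w} v"
proof -
  interpret cone: pentagon_join "{w}" v by (rule cone_pentagon_join[OF assms])
  have "cone.facet i = insert w (edge i)" for i by (auto simp: cone.facet_def edge_def)
  then show ?thesis by (intro set_eqI) (simp only: cone_disk_iff cone.J_iff)
qed

text \<open>The only vertex of S in the cone disk is w. A simplex of the join has its rim vertices
  in a single edge, so if all its vertices lie in the disk, it is a face of the triangle from w over
  that edge.\<close>

lemma cone_disk_full:
  assumes "w \<in> S"
  shows "full_subcomplex (cone_disk w rim) J"
proof -
  have "abstract_complex (cone_disk w rim)"
    unfolding cone_disk_eq_J[OF assms] by (rule pentagon_join.abstract_complex_J[OF cone_pentagon_join[OF assms]])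
  moreover have "cone_disk w rim \<subseteq> J"
  proof
    fix \<tau> assume "\<tau> \<in> cone_disk w rim"
    then obtain i where "\<tau> \<noteq> {}" "\<tau> \<subseteq> insert w (edge i)" unfolding cone_disk_iff by blast
    then have "\<tau> \<noteq> {}" "\<tau> \<subseteq> facet i" using assms unfolding facet_edge by blast+
    then show "\<tau> \<in> J" unfolding J_iff by blast
  qed
  moreover have "\<tau> \<in> cone_disk w rim" if \<tau>: "\<tau> \<in> J" "\<forall>x\<in>\<tau>. {x} \<in> cone_disk w rim" for \<tau>
  proof -
    obtain i where i: "\<tau> \<subseteq> S \<union> edge i" using \<tau>(1) by (auto simp: J_iff facet_edge)
    have "x \<in> insert w (edge i)" if x: "x \<in> \<tau>" for x
    proof -
      obtain j where "x \<in> insert w (edge j)" using \<tau>(2) x by (auto simp: cone_disk_iff)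
      then show ?thesis using i x edge_disjoint[of j] by blast
    qed
    then show ?thesis using finite_J[OF \<tau>(1)] by (auto simp: cone_disk_iff)
  qed
  ultimately show ?thesis by (simp add: full_subcomplex_def subcomplex_def)
qed

lemma cone_disk_not_nonpositively_curved:
  assumes "w \<in> S"
  shows "\<not> nonpositively_curved (cone_disk w rim)"
  unfolding cone_disk_eq_J[OF assms]
  by (rule pentagon_join.not_nonpositively_curved[OF cone_pentagon_join[OF assms]]) simp

lemma triangles_cone_disk:
  assumes "w \<in> S"
  shows "triangles (cone_disk w rim) = insert w ` range edge"
proof (intro set_eqI iffI)
  have c: "card (insert w (edge i)) = 3" for i
    by (rule card_triangle[OF assms])
  {
    fix \<tau> assume "\<tau> \<in> triangles (cone_disk w rim)"
    then obtain i where "\<tau> \<subseteq> insert w (edge i)" "card \<tau> = 3" by (auto simp: triangles_def cone_disk_iff)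
    then have "\<tau> = insert w (edge i)" using c[of i] by (intro card_subset_eq) (auto simp: edge_def)
    then show "\<tau> \<in> insert w ` range edge" by blast
  }
  show "\<tau> \<in> triangles (cone_disk w rim)" if "\<tau> \<in> insert w ` range edge" for \<tau>
    using that c by (auto simp: triangles_def cone_disk_iff)
qed

text \<open>The apex is off the rim, so a triangle determines its rim edge. The apex may vary with
  the edge, since in an arbitrary spanning disk it can.\<close>

lemma inj_triangles:
  assumes "\<And>i. w i \<in> S"
  shows "inj_on (\<lambda>i. insert (w i) (edge i)) {0..<5::int}"
proof (rule inj_onI)
  fix i j :: int assume ij: "i \<in> {0..<5}" "j \<in> {0..<5}" "insert (w i) (edge i) = insert (w j) (edge j)"
  then have "edge i \<subseteq> insert (w j) (edge j)" by blast
  then have "edge i \<subseteq> facet j" using assms[of j] unfolding facet_edge by blast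
  then show "i = j" using edge_sub_facet ij(1,2) by fastforce
qed

lemma area_cone_disk:
  assumes "w \<in> S"
  shows "combinatorial_area (cone_disk w rim) = 5"
proof -
  have "insert w ` range edge = (\<lambda>i. insert w (edge i)) ` {0..<5}"
  proof (intro set_eqI iffI)
    fix \<tau> assume "\<tau> \<in> insert w ` range edge"
    then obtain i where "\<tau> = insert w (edge i)" by blast
    moreover have "edge i = edge (i mod 5)" by (rule edge_period) simp
    ultimately show "\<tau> \<in> (\<lambda>i. insert w (edge i)) ` {0..<5}" by (intro image_eqI[of _ _ "i mod 5"]) auto
  qed auto
  then show ?thesis
    unfolding combinatorial_area_def triangles_cone_disk[OF assms]
    using card_image[OF inj_triangles[of "\<lambda>_. w"]] assms by simp
qed

section \<open>Spanning disks and their area\<close>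

lemma spanning_diskD:
  assumes "spanning_disk K \<alpha> D"
  shows "\<alpha> \<subseteq> D" "D \<subseteq> K" "\<tau> \<in> D \<Longrightarrow> \<rho> \<subseteq> \<tau> \<Longrightarrow> \<rho> \<noteq> {} \<Longrightarrow> \<rho> \<in> D"
proof -
  have "\<alpha> \<subseteq> D" "D \<subseteq> K" "abstract_complex D"
    using assms by (simp_all add: spanning_disk_def subcomplex_def)
  then show "\<alpha> \<subseteq> D" "D \<subseteq> K" "\<tau> \<in> D \<Longrightarrow> \<rho> \<subseteq> \<tau> \<Longrightarrow> \<rho> \<noteq> {} \<Longrightarrow> \<rho> \<in> D"
    unfolding abstract_complex_def by blast+
qed

text \<open>A rim edge is not maximal in the disk. A larger simplex lies in a facet, which must be
  the one over this edge, so its additional vertices are in S.\<close>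

lemma disk_triangles:
  assumes D: "spanning_disk J rim D"
  obtains w where "\<And>i. w i \<in> S" "\<And>i. insert (w i) (edge i) \<in> triangles D"
    "\<And>i j. i mod 5 = j mod 5 \<Longrightarrow> w i = w j"
proof -
  obtain h k where hom: "homeomorphism (realization D) (cball (0::complex) 1) h k"
    using D by (auto simp: spanning_disk_def)
  have sub: "rim \<subseteq> D" "D \<subseteq> J" and closed: "\<And>\<tau> \<rho>. \<tau> \<in> D \<Longrightarrow> \<rho> \<subseteq> \<tau> \<Longrightarrow> \<rho> \<noteq> {} \<Longrightarrow> \<rho> \<in> D"
    using spanning_diskD[OF D] by blast+
  have "\<exists>w. w \<in> S \<and> insert w (edge i) \<in> D" for i
  proof -
    have "edge i \<in> D" using sub(1) edge_in_rim by blast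
    then obtain \<tau> where \<tau>: "\<tau> \<in> D" "edge i \<subset> \<tau>"
      using disk_no_small_maximal_simplex[OF hom, of "edge i"] card_edge[of i] by (auto simp: edge_def)
    have "\<tau> \<in> J" using \<tau>(1) sub(2) by blast
    then obtain j where j: "\<tau> \<subseteq> facet j" unfolding J_iff by blast
    then have "edge i = edge j" using \<tau>(2) edge_sub_facet[of i j] edge_period by blast
    then obtain w where "w \<in> \<tau>" "w \<in> S" using j \<tau>(2) unfolding facet_edge by blast
    then show ?thesis using closed[OF \<tau>(1), of "insert w (edge i)"] \<tau>(2) by blast
  qed
  then obtain w where w: "\<And>i. w i \<in> S \<and> insert (w i) (edge i) \<in> D" by metis
  have c: "card (insert (w i) (edge j)) = 3" for i j
    using w[of i] by (intro card_triangle) blast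
  show ?thesis
  \<comment> \<open>The choice of apices was made for every integer; reduction modulo 5 makes
    indices of the same edge share one apex.\<close>
  proof (rule that[of "\<lambda>i. w (i mod 5)"])
    fix i
    have "edge i = edge (i mod 5)" by (rule edge_period) simp
    then show "insert (w (i mod 5)) (edge i) \<in> triangles D" using w[of "i mod 5"] c by (simp add: triangles_def)
  qed (use w in auto)
qed

lemma disk_area_ge:
  assumes D: "spanning_disk J rim D"
  shows "5 \<le> combinatorial_area D"
proof -
  obtain w where w: "\<And>i. w i \<in> S" "\<And>i. insert (w i) (edge i) \<in> triangles D"
    using disk_triangles[OF D] by metis
  have "finite (triangles D)"
    using D finite_J_set by (auto simp: spanning_disk_def subcomplex_def triangles_def intro: finite_subset)
  then have "card ((\<lambda>i. insert (w i) (edge i)) ` {0..<5}) \<le> card (triangles D)"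
    using w(2) by (intro card_mono) auto
  then show ?thesis using card_image[OF inj_triangles[OF w(1)]] by (simp add: combinatorial_area_def)
qed

lemma disk_area_5:
  assumes D: "spanning_disk J rim D" and area: "combinatorial_area D \<le> 5"
  shows "\<exists>w\<in>S. D = cone_disk w rim"
proof -
  obtain h k where hom: "homeomorphism (realization D) (cball (0::complex) 1) h k"
    and bd: "h ` realization rim = sphere 0 1"
    using D by (auto simp: spanning_disk_def)
  have sub: "rim \<subseteq> D" "D \<subseteq> J" and closed: "\<And>\<tau> \<rho>. \<tau> \<in> D \<Longrightarrow> \<rho> \<subseteq> \<tau> \<Longrightarrow> \<rho> \<noteq> {} \<Longrightarrow> \<rho> \<in> D"
    using spanning_diskD[OF D] by blast+
  have fin: "finite D" using sub finite_J_set finite_subset by blast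
  obtain w where w: "\<And>i. w i \<in> S" "\<And>i. insert (w i) (edge i) \<in> triangles D"
    "\<And>i j. i mod 5 = j mod 5 \<Longrightarrow> w i = w j"
    using disk_triangles[OF D] by metis
  define T where "T i = insert (w i) (edge i)" for i
  have T_period: "T i = T j" if "i mod 5 = j mod 5" for i j
    using w(3)[OF that] edge_period[OF that] by (simp add: T_def)
  have TD: "T i \<in> D" for i using w(2) by (auto simp: T_def triangles_def)
  have TS: "T i \<inter> S = {w i}" for i using w(1) edge_disjoint[of i] by (auto simp: T_def)
  have "T ` {0..<5} = triangles D"
  proof (rule card_seteq)
    show "finite (triangles D)" using fin by (simp add: triangles_def)
    show "T ` {0..<5} \<subseteq> triangles D" using w(2) by (auto simp: T_def)
    show "card (triangles D) \<le> card (T ` {0..<5})"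
      using area card_image[OF inj_triangles[OF w(1)]] by (simp add: combinatorial_area_def T_def)
  qed
  then have tri: "\<exists>i. \<tau> = T i" if "\<tau> \<in> D" "card \<tau> = 3" for \<tau>
    using that by (auto simp: triangles_def)
  \<comment> \<open>Otherwise the edge from \<open>w i\<close> to \<open>vx (i + 1)\<close> has no
    triangle other than \<open>T i\<close>, so it would belong to the rim, which contains no vertex
    of S.\<close>
  have step: "w (i + 1) = w i" for i
  proof (rule ccontr)
    assume neq: "w (i + 1) \<noteq> w i"
    have "{w i, vx (i + 1)} \<in> rim"
    proof (rule disk_free_edge_in_boundary[OF hom bd sub(1)])
      show "\<rho> \<in> rim" if "\<tau> \<in> rim" "\<rho> \<subseteq> \<tau>" "\<rho> \<noteq> {}" for \<tau> \<rho>
        using that by (meson rim_iff subset_trans)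
      show "{w i, vx (i + 1)} \<in> D" using closed[OF TD[of i]] by (auto simp: T_def edge_def)
      show wv: "w i \<noteq> vx (i + 1)" using w(1)[of i] vx_notin by metis
      show "vx i \<notin> {w i, vx (i + 1)}" using S_neq_vx[OF w(1), of i i] by simp
      fix \<tau> assume \<tau>: "\<tau> \<in> D" "{w i, vx (i + 1)} \<subseteq> \<tau>"
      show "\<tau> \<subseteq> {w i, vx (i + 1), vx i}"
      proof
        fix x assume x: "x \<in> \<tau>"
        show "x \<in> {w i, vx (i + 1), vx i}"
        proof (rule ccontr)
          assume nx: "x \<notin> {w i, vx (i + 1), vx i}"
          have "{w i, vx (i + 1), x} \<in> D" using closed[OF \<tau>(1)] \<tau>(2) x by simp
          moreover have "card {w i, vx (i + 1), x} = 3" using nx wv by auto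
          ultimately obtain j where j: "{w i, vx (i + 1), x} = T j" using tri by blast
          then have wj: "w i = w j" using TS[of j] w(1)[of i] by blast
          have "vx (i + 1) \<in> T j" using j by blast
          then have "vx (i + 1) \<in> {vx j, vx (j + 1)}"
            using S_neq_vx[OF w(1), of j "i + 1"] by (simp add: T_def edge_def)
          then have "(i + 1) mod 5 = j mod 5 \<or> (i + 1) mod 5 = (j + 1) mod 5" by (simp add: vx_eq_iff)
          \<comment> \<open>A triangle \<open>T j\<close> through \<open>vx (i + 1)\<close> stands
            over the edge i + 1, where the apex differs from \<open>w i\<close>, or over the edge i,
            where it is \<open>T i\<close>.\<close>
          then show False
          proof
            assume "(i + 1) mod 5 = j mod 5"
            then show False using w(3) wj neq by metis
          next
            assume "(i + 1) mod 5 = (j + 1) mod 5"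
            then have "(i + 1 - 1) mod 5 = (j + 1 - 1) mod 5" by (rule mod_diff_cong) simp
            then have "T j = T i" by (intro T_period) simp
            then show False using j nx by (auto simp: T_def edge_def)
          qed
        qed
      qed
    qed
    then obtain j where "w i \<in> edge j" by (auto simp: rim_iff)
    then show False using w(1)[of i] edge_disjoint by blast
  qed
  have w0: "w i = w 0" for i
  proof -
    have "w (int n) = w 0" for n
    proof (induction n)
      case (Suc n)
      then show ?case using step[of "int n"] by (simp add: add.commute)
    qed simp
    from this[of "nat (i mod 5)"] show ?thesis using w(3)[of i "i mod 5"] by simp
  qed
  have Tw: "T i = insert (w 0) (edge i)" for i using w0[of i] by (simp only: T_def)
  have "D = cone_disk (w 0) rim"
  proof (intro set_eqI iffI)
    fix \<tau> assume "\<tau> \<in> cone_disk (w 0) rim"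
    then obtain i where "\<tau> \<subseteq> T i" "\<tau> \<noteq> {}" unfolding cone_disk_iff Tw by blast
    then show "\<tau> \<in> D" using closed[OF TD] by blast
  next
    fix \<tau> assume \<tau>: "\<tau> \<in> D"
    then obtain \<mu> where \<mu>: "\<mu> \<in> D" "\<tau> \<subseteq> \<mu>" "\<And>\<mu>'. \<mu>' \<in> D \<Longrightarrow> \<mu> \<subseteq> \<mu>' \<Longrightarrow> \<mu> = \<mu>'"
      using finite_has_maximal2[OF fin] by metis
    have f\<mu>: "finite \<mu>" "\<mu> \<noteq> {}" using finite_J \<mu>(1) sub(2) by auto
    have "3 \<le> card \<mu>"
    proof (rule ccontr)
      assume "\<not> 3 \<le> card \<mu>"
      then have "card \<mu> \<le> 2" by simp
      then obtain \<mu>' where "\<mu>' \<in> D" "\<mu> \<subset> \<mu>'"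
        using disk_no_small_maximal_simplex[OF hom \<mu>(1) f\<mu>] by blast
      then show False using \<mu>(3)[of \<mu>'] by blast
    qed
    \<comment> \<open>A simplex with four or more vertices has at least two of them in S, since an
      edge of the rim takes up only two. It would then have a face with three vertices, two of them
      in S, whereas every triangle \<open>T i\<close> meets S in one vertex.\<close>
    have "card \<mu> = 3"
    proof (rule ccontr)
      assume "card \<mu> \<noteq> 3"
      then have c4: "4 \<le> card \<mu>" using \<open>3 \<le> card \<mu>\<close> by simp
      have "\<mu> \<in> J" using \<mu>(1) sub(2) by blast
      then obtain j where j: "\<mu> \<subseteq> S \<union> edge j" unfolding J_iff facet_edge by blast
      have "card (\<mu> - edge j) \<ge> 2"
        using diff_card_le_card_Diff[of "edge j" \<mu>] c4 card_edge[of j] by (simp add: edge_def)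
      then obtain B where B: "B \<subseteq> \<mu> - edge j" "card B = 2" "finite B"
        using obtain_subset_with_card_n by metis
      then have "card (\<mu> - B) \<ge> 2" using diff_card_le_card_Diff[of B \<mu>] c4 by simp
      then have "\<mu> - B \<noteq> {}" by (metis card.empty not_numeral_le_zero)
      then obtain x where x: "x \<in> \<mu> - B" by blast
      have "insert x B \<in> D" using closed[OF \<mu>(1)] x B(1) by blast
      moreover have "card (insert x B) = 3" using B x by simp
      ultimately obtain i where "insert x B = T i" using tri by blast
      then have "B \<subseteq> {w i}" using TS[of i] B(1) j by blast
      then have "card B \<le> 1" using card_mono[of "{w i}" B] by simp
      then show False using B(2) by simp
    qed
    then obtain i where "\<mu> = T i" using tri \<mu>(1) by blast
    moreover have "\<tau> \<noteq> {}" using finite_J \<tau> sub(2) by blast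
    ultimately show "\<tau> \<in> cone_disk (w 0) rim"
      using \<mu>(2) unfolding cone_disk_iff Tw by blast
  qed
  then show ?thesis using w(1) by blast
qed

text \<open>The polygonal parametrization of the rim, with the vertices at integer times; the summands are
  tent functions.\<close>

definition rim_point :: "real \<Rightarrow> 'v \<Rightarrow> real" where
  "rim_point u a = (\<Sum>j\<le>5. of_bool (a = vx (int j)) * max 0 (1 - \<bar>u - real j\<bar>))"

text \<open>Six tents serve five vertices, those at times 0 and 5 belonging to the same vertex. On
  the interval considered only the tents at its two ends are nonzero.\<close>

lemma rim_point_edge:
  assumes "i < 5" "0 \<le> s" "s \<le> 1"
  shows "rim_point (real i + s) a =
    of_bool (a = vx (int i)) * (1 - s) + of_bool (a = vx (int i + 1)) * s"
proof -
  have "rim_point (real i + s) a =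
    (\<Sum>j\<in>{i, Suc i}. of_bool (a = vx (int j)) * max 0 (1 - \<bar>real i + s - real j\<bar>))"
    unfolding rim_point_def
  proof (rule sum.mono_neutral_right)
    show "\<forall>j\<in>{..5} - {i, Suc i}. of_bool (a = vx (int j)) * max 0 (1 - \<bar>real i + s - real j\<bar>) = 0"
    proof
      fix j assume "j \<in> {..5} - {i, Suc i}"
      then have "j < i \<or> i + 2 \<le> j" by auto
      then have "real j \<le> real i - 1 \<or> real i + 2 \<le> real j" by linarith
      then have "1 \<le> \<bar>real i + s - real j\<bar>" using assms by auto
      then show "of_bool (a = vx (int j)) * max 0 (1 - \<bar>real i + s - real j\<bar>) = 0" by simp
    qed
  qed (use assms in auto)
  then show ?thesis using assms by (simp add: add.commute)
qed

lemma rim_point_decompose: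
  assumes "0 \<le> u" "u < 5"
  obtains i s where "i < 5" "0 \<le> s" "s < 1" "u = real i + s"
proof (rule that[of "nat \<lfloor>u\<rfloor>" "u - \<lfloor>u\<rfloor>"])
  show "nat \<lfloor>u\<rfloor> < 5" using assms by linarith
  show "u = real (nat \<lfloor>u\<rfloor>) + (u - \<lfloor>u\<rfloor>)" using assms by simp
qed linarith+

text \<open>As for \<open>c_inj\<close>: the first vertex of the half-open edge has positive weight,
  which identifies the edge, and the weight of the second vertex is the position on it.\<close>

lemma rim_point_inj:
  assumes "0 \<le> u" "u < 5" "0 \<le> u'" "u' < 5" "rim_point u = rim_point u'"
  shows "u = u'"
proof -
  obtain i s where i: "i < 5" "0 \<le> s" "s < 1" "u = real i + s" using rim_point_decompose[OF assms(1,2)] .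
  obtain i' s' where i': "i' < 5" "0 \<le> s'" "s' < 1" "u' = real i' + s'" using rim_point_decompose[OF assms(3,4)] .
  have p: "rim_point u a = of_bool (a = vx (int i)) * (1 - s) + of_bool (a = vx (int i + 1)) * s"
    "rim_point u' a = of_bool (a = vx (int i')) * (1 - s') + of_bool (a = vx (int i' + 1)) * s'" for a
    using rim_point_edge[of i s a] rim_point_edge[of i' s' a] i i' by simp_all
  have "rim_point u (vx (int i)) \<noteq> 0" using i(3) by (simp add: p)
  then have 1: "vx (int i) = vx (int i') \<or> vx (int i) = vx (int i' + 1)" unfolding assms(5) p by auto
  have "rim_point u' (vx (int i')) \<noteq> 0" using i'(3) by (simp add: p)
  then have 2: "vx (int i') = vx (int i) \<or> vx (int i') = vx (int i + 1)" unfolding assms(5)[symmetric] p by auto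
  have "int i mod 5 = int i' mod 5"
    using 1 2 not_both_neighbours[of "int i" "int i'"] unfolding vx_eq_iff by auto
  then have "i = i'" using i(1) i'(1) by simp
  then have "s = s'" using fun_cong[OF assms(5), of "vx (int i + 1)"] unfolding p by simp
  then show ?thesis using \<open>i = i'\<close> i(4) i'(4) by simp
qed

lemma rim_point_5: "rim_point 5 = rim_point 0"
proof
  fix a
  have "vx (int 4 + 1) = vx (int 0)" by (simp add: vx_eq_iff)
  then show "rim_point 5 a = rim_point 0 a"
    using rim_point_edge[of 4 1 a] rim_point_edge[of 0 0 a] by simp
qed

lemma cis_inj_5:
  assumes "0 \<le> u" "u < 5" "0 \<le> u'" "u' < 5" "cis (2 * pi * u / 5) = cis (2 * pi * u' / 5)"
  shows "u = u'"
proof -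
  have "sin (2 * pi * u / 5) = sin (2 * pi * u' / 5) \<and> cos (2 * pi * u / 5) = cos (2 * pi * u' / 5)"
    using assms(5) by (simp add: complex_eq_iff)
  then obtain n :: int where "2 * pi * u / 5 = 2 * pi * u' / 5 + 2 * pi * n"
    using sin_cos_eq_iff by blast
  then have "2 * pi * u = 2 * pi * (u' + 5 * n)" by (simp add: field_simps)
  then have n: "u = u' + 5 * n" by simp
  then have "\<bar>real_of_int n\<bar> < 1" using assms by linarith
  then have "n = 0" by linarith
  then show ?thesis using n by simp
qed

lemma rim_point_eq_iff_cis:
  assumes "u \<in> {0..5}" "u' \<in> {0..5}"
  shows "rim_point u = rim_point u' \<longleftrightarrow> cis (2 * pi * u / 5) = cis (2 * pi * u' / 5)"
proof -
  \<comment> \<open>Both closed curves are injective on the half-open interval and close up at 5, so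
    folding 5 back to 0 reduces the claim to injectivity.\<close>
  define r where "r x = (if x = 5 then 0 else x)" for x :: real
  have r: "0 \<le> r x" "r x < 5" "rim_point (r x) = rim_point x" "cis (2 * pi * r x / 5) = cis (2 * pi * x / 5)"
    if "x \<in> {0..5}" for x
    using that rim_point_5 by (auto simp: r_def)
  have "rim_point u = rim_point u' \<longleftrightarrow> r u = r u'"
    using rim_point_inj r[OF assms(1)] r[OF assms(2)] by metis
  also have "\<dots> \<longleftrightarrow> cis (2 * pi * u / 5) = cis (2 * pi * u' / 5)"
    using cis_inj_5 r[OF assms(1)] r[OF assms(2)] by metis
  finally show ?thesis .
qed

text \<open>Polar coordinates \<open>(u, t)\<close> parametrize both the cone over the rim with apex \<open>w\<close> and the unit
  disk, with the same identifications.\<close>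

definition cone_point :: "'v \<Rightarrow> real \<times> real \<Rightarrow> 'v \<Rightarrow> real" where
  "cone_point w z a = (if a = w then 1 - snd z else snd z * rim_point (fst z) a)"

definition disk_point :: "real \<times> real \<Rightarrow> complex" where
  "disk_point z = of_real (snd z) * cis (2 * pi * fst z / 5)"

lemma rim_point_S: "w \<in> S \<Longrightarrow> rim_point u w = 0"
  by (simp add: rim_point_def S_neq_vx)

text \<open>The radius can be read off on both sides, from the coordinate at w and from the norm. At
  positive radius the position on the boundary is determined as well, and there
  \<open>rim_point_eq_iff_cis\<close> compares the two identifications.\<close>

lemma cone_point_eq_iff:
  assumes w: "w \<in> S" and z: "z \<in> {0..5} \<times> {0..1}" "z' \<in> {0..5} \<times> {0..1}"
  shows "cone_point w z = cone_point w z' \<longleftrightarrow> disk_point z = disk_point z'"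
proof -
  obtain u t u' t' where eq: "z = (u, t)" "z' = (u', t')" by (cases z, cases z')
  have b: "u \<in> {0..5}" "u' \<in> {0..5}" "0 \<le> t" "0 \<le> t'" using z eq by auto
  have "cone_point w z = cone_point w z' \<longleftrightarrow> t = t' \<and> (t = 0 \<or> rim_point u = rim_point u')"
  proof
    assume e: "cone_point w z = cone_point w z'"
    have "t = t'" using fun_cong[OF e, of w] by (simp add: cone_point_def eq)
    moreover have "rim_point u a = rim_point u' a" if "t \<noteq> 0" for a
      using fun_cong[OF e, of a] that \<open>t = t'\<close> rim_point_S[OF w]
      by (cases "a = w") (simp_all add: cone_point_def eq)
    ultimately show "t = t' \<and> (t = 0 \<or> rim_point u = rim_point u')" by blast
  qed (auto simp: cone_point_def eq fun_eq_iff)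
  also have "\<dots> \<longleftrightarrow> t = t' \<and> (t = 0 \<or> cis (2 * pi * u / 5) = cis (2 * pi * u' / 5))"
    using rim_point_eq_iff_cis[OF b(1,2)] by simp
  also have "\<dots> \<longleftrightarrow> disk_point z = disk_point z'"
  proof
    assume e: "disk_point z = disk_point z'"
    then have "norm (disk_point z) = norm (disk_point z')" by simp
    then have "t = t'" using b by (simp add: disk_point_def eq norm_mult)
    then show "t = t' \<and> (t = 0 \<or> cis (2 * pi * u / 5) = cis (2 * pi * u' / 5))"
      using e by (auto simp: disk_point_def eq)
  qed (auto simp: disk_point_def eq)
  finally show ?thesis .
qed

lemma continuous_cone_point: "continuous_on Z (cone_point w)"
proof -
  have "continuous_on Z (\<lambda>z. cone_point w z a)" for a
  proof (cases "a = w")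
    case True
    then show ?thesis unfolding cone_point_def by (simp, intro continuous_intros)
  next
    case False
    have "continuous_on Z (\<lambda>z. snd z * rim_point (fst z) a)"
      unfolding rim_point_def by (intro continuous_intros)
    then show ?thesis using False by (simp add: cone_point_def)
  qed
  then show ?thesis by (rule continuous_on_coordinatewise_then_product)
qed

lemma continuous_disk_point: "continuous_on Z disk_point"
  unfolding disk_point_def cis_conv_exp by (intro continuous_intros) auto

text \<open>A set T of radii is allowed so that \<open>{0..1}\<close> yields the disk and
  \<open>{1}\<close> its boundary circle.\<close>

lemma disk_point_image:
  assumes T: "T \<subseteq> {0..1}"
  shows "disk_point ` ({0..5} \<times> T) = {z. norm z \<in> T}"
proof
  show "disk_point ` ({0..5} \<times> T) \<subseteq> {z. norm z \<in> T}"
    using T by (auto simp: disk_point_def norm_mult)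
  show "{z. norm z \<in> T} \<subseteq> disk_point ` ({0..5} \<times> T)"
  proof
    fix z :: complex assume z: "z \<in> {z. norm z \<in> T}"
    define u where "u = 5 * Arg2pi z / (2 * pi)"
    have "0 \<le> u" using Arg2pi_ge_0[of z] by (simp add: u_def)
    moreover have "u \<le> 5" using Arg2pi_lt_2pi[of z] by (simp add: u_def field_simps)
    moreover have "2 * pi * u / 5 = Arg2pi z" by (simp add: u_def)
    then have "disk_point (u, norm z) = z"
      using Arg2pi_eq[of z] by (simp add: disk_point_def cis_conv_exp)
    ultimately show "z \<in> disk_point ` ({0..5} \<times> T)"
      using z by (intro image_eqI[of _ _ "(u, norm z)"]) auto
  qed
qed

lemma cone_point_image:
  assumes w: "w \<in> S"
  shows "cone_point w ` ({0..5} \<times> {0..1}) = realization (cone_disk w rim)"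
proof
  show "cone_point w ` ({0..5} \<times> {0..1}) \<subseteq> realization (cone_disk w rim)"
  proof
    fix x assume "x \<in> cone_point w ` ({0..5} \<times> {0..1})"
    then obtain u0 t where ut: "u0 \<in> {0..5}" "t \<in> {0..1}" "x = cone_point w (u0, t)" by auto
    define u where "u = (if u0 = 5 then 0 else u0)"
    have u: "0 \<le> u" "u < 5" "x = cone_point w (u, t)"
      using ut rim_point_5 by (auto simp: u_def cone_point_def fun_eq_iff)
    obtain i s where i: "i < 5" "0 \<le> s" "s < 1" "u = real i + s" using rim_point_decompose[OF u(1,2)] .
    define a b where "a = vx (int i)" and "b = vx (int i + 1)"
    have d: "w \<noteq> a" "w \<noteq> b" "a \<noteq> b" using S_neq_vx[OF w] by (auto simp: a_def b_def)
    have x: "x c = (if c = w then 1 - t else if c = a then t * (1 - s) else if c = b then t * s else 0)" for c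
      using rim_point_edge[of i s c] i d unfolding u(3) cone_point_def a_def b_def by auto
    have "sum x {w, a, b} = 1" using d by (simp add: x algebra_simps)
    then have "x \<in> closed_cell {w, a, b}"
      using ut(2) i(2,3) unfolding closed_cell_def by (auto simp: x)
    moreover have "{w, a, b} \<in> cone_disk w rim"
      unfolding cone_disk_iff by (auto simp: a_def b_def edge_def)
    ultimately show "x \<in> realization (cone_disk w rim)" by (auto simp: realization_def)
  qed
  show "realization (cone_disk w rim) \<subseteq> cone_point w ` ({0..5} \<times> {0..1})"
  proof
    fix x assume "x \<in> realization (cone_disk w rim)"
    then obtain \<tau> j where \<tau>: "x \<in> closed_cell \<tau>" "\<tau> \<subseteq> insert w (edge j)"
      by (auto simp: realization_def cone_disk_iff)
    define i where "i = nat (j mod 5)"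
    have i: "i < 5" "int i mod 5 = j mod 5" by (auto simp: i_def)
    define a b where "a = vx (int i)" and "b = vx (int i + 1)"
    have d: "w \<noteq> a" "w \<noteq> b" "a \<noteq> b" using S_neq_vx[OF w] by (auto simp: a_def b_def)
    have sub: "\<tau> \<subseteq> {w, a, b}" using \<tau>(2) edge_period[OF i(2)] by (auto simp: a_def b_def edge_def)
    have "sum x \<tau> = sum x {w, a, b}"
      using \<tau>(1) sub by (intro sum.mono_neutral_left) (auto simp: closed_cell_def)
    then have s1: "x w + x a + x b = 1" using \<tau>(1) d by (simp add: closed_cell_def)
    have pos: "0 \<le> x c" for c using \<tau>(1) by (simp add: closed_cell_def)
    have out: "x c = 0" if "c \<notin> {w, a, b}" for c using \<tau>(1) sub that by (auto simp: closed_cell_def)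
    define t where "t = x a + x b"
    have t: "0 \<le> t" "t \<le> 1" "x w = 1 - t" using pos[of a] pos[of b] pos[of w] s1 by (auto simp: t_def)
    \<comment> \<open>At the apex t is 0 and the quotient is 0 by convention, an admissible
      position, as all of them give the same point.\<close>
    define s where "s = x b / t"
    have s: "0 \<le> s" "s \<le> 1" using pos[of a] pos[of b] t(1) by (auto simp: s_def t_def divide_le_eq)
    have ts: "t * s = x b" "t * (1 - s) = x a"
    proof -
      show "t * s = x b" using pos[of a] pos[of b] by (cases "t = 0") (auto simp: s_def t_def)
      then show "t * (1 - s) = x a" by (simp add: algebra_simps t_def)
    qed
    have "cone_point w (real i + s, t) c = x c" for c
      using rim_point_edge[OF i(1) s, of c] ts t(3) d out[of c]
      by (auto simp: cone_point_def a_def[symmetric] b_def[symmetric])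
    then have "x = cone_point w (real i + s, t)" by (simp add: fun_eq_iff)
    then show "x \<in> cone_point w ` ({0..5} \<times> {0..1})"
      using t s i(1) by (intro image_eqI[of _ _ "(real i + s, t)"]) auto
  qed
qed

text \<open>This identifies the rim with the points of radius 1 in the polar parametrization, where
  the coordinate at w is 1 - t.\<close>

lemma realization_rim:
  assumes w: "w \<in> S"
  shows "realization rim = {x \<in> realization (cone_disk w rim). x w = 0}"
proof (intro set_eqI iffI)
  fix x assume "x \<in> realization rim"
  then obtain \<tau> where x: "\<tau> \<in> rim" "x \<in> closed_cell \<tau>" by (auto simp: realization_def)
  then obtain i where \<tau>: "\<tau> \<noteq> {}" "\<tau> \<subseteq> edge i" unfolding rim_iff by blast
  then have "\<tau> \<in> cone_disk w rim" unfolding cone_disk_iff by blast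
  moreover have "w \<notin> \<tau>" using \<tau>(2) S_neq_vx[OF w] by (auto simp: edge_def)
  ultimately show "x \<in> {x \<in> realization (cone_disk w rim). x w = 0}"
    using x(2) by (auto simp: realization_def closed_cell_def)
next
  fix x assume "x \<in> {x \<in> realization (cone_disk w rim). x w = 0}"
  then obtain \<tau> i where \<tau>: "\<tau> \<subseteq> insert w (edge i)" "x \<in> closed_cell \<tau>" "x w = 0"
    by (auto simp: realization_def cone_disk_iff)
  have f: "finite \<tau>" using \<tau>(1) by (rule finite_subset) (simp add: edge_def)
  have "sum x (\<tau> - {w}) = sum x \<tau>" using f \<tau>(3) by (intro sum.mono_neutral_left) auto
  then have c: "x \<in> closed_cell (\<tau> - {w})" using \<tau>(2,3) by (auto simp: closed_cell_def)
  have "\<tau> - {w} \<noteq> {}"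
  proof
    assume "\<tau> - {w} = {}"
    then have "sum x (\<tau> - {w}) = 0" by (simp only: sum.empty)
    then show False using c by (simp add: closed_cell_def)
  qed
  then have "\<tau> - {w} \<in> rim" using \<tau>(1) unfolding rim_iff by blast
  then show "x \<in> realization rim" using c by (auto simp: realization_def)
qed

lemma cone_disk_spanning:
  assumes w: "w \<in> S"
  shows "spanning_disk J rim (cone_disk w rim)"
proof -
  have "disk_point ` ({0..5} \<times> {0..1}) = {z. norm z \<in> {0..1}}" by (rule disk_point_image) simp
  then have disk: "disk_point ` ({0..5} \<times> {0..1}) = cball 0 1" by auto
  have "disk_point ` ({0..5} \<times> {1}) = {z. norm z \<in> {1}}" by (rule disk_point_image) simp
  then have circle: "disk_point ` ({0..5} \<times> {1}) = sphere 0 1" by auto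
  have "compact ({0..5::real} \<times> {0..1::real})" by (intro compact_Times) auto
  then obtain h k where hom: "homeomorphism (cone_point w ` ({0..5} \<times> {0..1})) (disk_point ` ({0..5} \<times> {0..1})) h k"
    and h: "\<And>z. z \<in> {0..5} \<times> {0..1} \<Longrightarrow> h (cone_point w z) = disk_point z"
    using homeomorphism_common_quotient[OF _ continuous_cone_point continuous_disk_point
        cone_point_eq_iff[OF w] compact_imp_closed_fun compact_imp_closed] by metis
  have "realization rim = cone_point w ` ({0..5} \<times> {1})"
    unfolding realization_rim[OF w] cone_point_image[OF w, symmetric]
    by (force simp: cone_point_def)
  then have "h ` realization rim = (\<lambda>z. h (cone_point w z)) ` ({0..5} \<times> {1})" by (simp add: image_image)
  also have "\<dots> = disk_point ` ({0..5} \<times> {1})" by (intro image_cong refl h) auto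
  finally have "h ` realization rim = sphere 0 1" by (simp add: circle)
  moreover have "rim \<subseteq> cone_disk w rim"
    unfolding subset_iff rim_iff cone_disk_iff by blast
  moreover have "subcomplex (cone_disk w rim) J" using cone_disk_full[OF w] by (simp add: full_subcomplex_def)
  ultimately show ?thesis
    using hom unfolding spanning_disk_def disk cone_point_image[OF w] by blast
qed

section \<open>Classification of the minimal disks\<close>

lemma minimal_disks_eq: "minimal_disks J rim = (\<lambda>w. cone_disk w rim) ` S"
proof (intro set_eqI iffI)
  fix D assume "D \<in> minimal_disks J rim"
  then have D: "spanning_disk J rim D"
    "\<And>D'. spanning_disk J rim D' \<Longrightarrow> combinatorial_area D \<le> combinatorial_area D'"
    by (auto simp: minimal_disks_def)
  obtain w where w: "w \<in> S" using S_nonempty by blast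
  have "combinatorial_area D \<le> 5"
    using D(2)[OF cone_disk_spanning[OF w]] area_cone_disk[OF w] by simp
  then show "D \<in> (\<lambda>w. cone_disk w rim) ` S" using disk_area_5[OF D(1)] by blast
next
  fix D assume "D \<in> (\<lambda>w. cone_disk w rim) ` S"
  then obtain w where w: "w \<in> S" "D = cone_disk w rim" by blast
  then show "D \<in> minimal_disks J rim"
    using cone_disk_spanning[OF w(1)] area_cone_disk[OF w(1)] disk_area_ge by (simp add: minimal_disks_def)
qed

lemma vertex_in_cone_disk:
  assumes "w \<in> S" "w' \<in> S"
  shows "{w'} \<in> cone_disk w rim \<longleftrightarrow> w' = w"
  using S_neq_vx[OF assms(2)] by (auto simp: cone_disk_iff edge_def)

lemma bij_betw_minimal_disks: "bij_betw (\<lambda>w. cone_disk w rim) S (minimal_disks J rim)"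
proof -
  have "inj_on (\<lambda>w. cone_disk w rim) S"
  proof (rule inj_onI)
    fix w w' assume w: "w \<in> S" "w' \<in> S" and eq: "cone_disk w rim = cone_disk w' rim"
    then show "w = w'" using vertex_in_cone_disk[OF w(2,1)] vertex_in_cone_disk[OF w(1,1)] by simp
  qed
  then show ?thesis by (simp add: bij_betw_def minimal_disks_eq)
qed

end

section \<open>The results in terms of the dimension n\<close>

lemma pentagon_join_properties:
  fixes S :: "'v set"
  assumes n: "n \<ge> 4" and S: "finite S" "card S = n - 1"
    and v: "inj_on v {..<5}" "v 5 = v 0" "S \<inter> v ` {..<5} = {}"
    and "\<alpha> = cycle_complex 5 v" "K = simplicial_join (generated_complex {S}) \<alpha>"
  shows "abstract_complex K" "has_dimension K n" "CAT0 K" "card (minimal_disks K \<alpha>) = n - 1"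
    "bij_betw (\<lambda>w. cone_disk w \<alpha>) S (minimal_disks K \<alpha>)"
    "\<And>w. w \<in> S \<Longrightarrow> {D \<in> minimal_disks K \<alpha>. {w} \<in> D} = {cone_disk w \<alpha>}"
    "\<And>w. w \<in> S \<Longrightarrow> triangles (cone_disk w \<alpha>) = {{w, v i, v (Suc i)} |i. i < 5}"
    "\<And>w. w \<in> S \<Longrightarrow> combinatorial_area (cone_disk w \<alpha>) = 5"
    "\<And>D. D \<in> minimal_disks K \<alpha> \<Longrightarrow> full_subcomplex D K"
    "\<And>D. D \<in> minimal_disks K \<alpha> \<Longrightarrow> \<not> nonpositively_curved D"
proof -
  have "S \<noteq> {}" using n S by auto
  with S v interpret pentagon_join S v by unfold_locales auto
  have \<alpha>: "\<alpha> = rim" using assms cycle_complex_eq_rim by simp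
  have K: "K = J" using assms \<alpha> simplicial_join_eq_J by simp
  have card: "card S + 1 = n" "3 \<le> card S" using n S by auto
  show "abstract_complex K" "has_dimension K n" "CAT0 K" "bij_betw (\<lambda>w. cone_disk w \<alpha>) S (minimal_disks K \<alpha>)"
    unfolding K \<alpha>
    using abstract_complex_J has_dimension_J[OF card(1)] CAT0_J[OF card(2)] bij_betw_minimal_disks
    by blast+
  show "card (minimal_disks K \<alpha>) = n - 1"
    unfolding K \<alpha> using bij_betw_same_card[OF bij_betw_minimal_disks] card by simp
  show "full_subcomplex D K" "\<not> nonpositively_curved D" if "D \<in> minimal_disks K \<alpha>" for D
    using that cone_disk_full cone_disk_not_nonpositively_curved unfolding K \<alpha> minimal_disks_eq by blast+
  fix w assume w: "w \<in> S"
  show "{D \<in> minimal_disks K \<alpha>. {w} \<in> D} = {cone_disk w \<alpha>}"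
    unfolding K \<alpha> minimal_disks_eq using w vertex_in_cone_disk by blast
  show "triangles (cone_disk w \<alpha>) = {{w, v i, v (Suc i)} |i. i < 5}"
    unfolding \<alpha> triangles_cone_disk[OF w] edge_range by blast
  show "combinatorial_area (cone_disk w \<alpha>) = 5" unfolding \<alpha> by (rule area_cone_disk[OF w])
qed

lemma CAT0_with_curved_full_subcomplex:
  assumes n: "4 \<le> n"
  shows "\<exists>K L :: nat set set. abstract_complex K \<and> has_dimension K n \<and> CAT0 K \<and>
    full_subcomplex L K \<and> \<not> nonpositively_curved L"
proof -
  \<comment> \<open>The numbers below 5 are the vertices of the cycle, and the n - 1 numbers from 5
    on span the simplex.\<close>
  define S where "S = {5..<n + 4}"
  define v :: "nat \<Rightarrow> nat" where "v i = i mod 5" for i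
  interpret pentagon_join S v
    by unfold_locales (use n in \<open>auto simp: S_def v_def inj_on_def\<close>)
  have card: "card S + 1 = n" "3 \<le> card S" "5 \<in> S" using n by (auto simp: S_def)
  show ?thesis
    using abstract_complex_J has_dimension_J[OF card(1)] CAT0_J[OF card(2)] cone_disk_full[OF card(3)]
      cone_disk_not_nonpositively_curved[OF card(3)] by blast
qed

theorem mainTheorem2:
  shows "(\<forall>n\<ge>4. \<forall>(S::'v set) (v::nat \<Rightarrow> 'v) \<alpha> K.
            finite S \<and> card S = n - 1 \<and>
            inj_on v {..<5} \<and> v 5 = v 0 \<and> S \<inter> v ` {..<5} = {} \<and>
            \<alpha> = cycle_complex 5 v \<and>
            K = simplicial_join (generated_complex {S}) \<alpha> \<longrightarrow>
              abstract_complex K \<and> has_dimension K n \<and> CAT0 K \<and>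
              card (minimal_disks K \<alpha>) = n - 1 \<and>
              bij_betw (\<lambda>w. cone_disk w \<alpha>) S (minimal_disks K \<alpha>) \<and>
              (\<forall>w\<in>S. {D \<in> minimal_disks K \<alpha>. {w} \<in> D} = {cone_disk w \<alpha>} \<and>
                     triangles (cone_disk w \<alpha>) = {{w, v i, v (Suc i)} |i. i < 5} \<and>
                     combinatorial_area (cone_disk w \<alpha>) = 5) \<and>
              (\<forall>D\<in>minimal_disks K \<alpha>. full_subcomplex D K \<and> \<not> nonpositively_curved D)) \<and>
         (\<forall>n\<ge>4. \<exists>K L :: nat set set.
            abstract_complex K \<and> has_dimension K n \<and> CAT0 K \<and>
            full_subcomplex L K \<and> \<not> nonpositively_curved L)"
proof (rule conjI)
  show "\<forall>n\<ge>4. \<exists>K L :: nat set set.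
            abstract_complex K \<and> has_dimension K n \<and> CAT0 K \<and>
            full_subcomplex L K \<and> \<not> nonpositively_curved L"
    using CAT0_with_curved_full_subcomplex by blast
qed (intro allI impI, elim conjE, intro conjI ballI, (rule pentagon_join_properties; assumption)+)

end
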